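(* Let $s<0$ and $\mu\in\{-1,1\}$. For every sufficiently small $\varepsilon>0$ there exist $\phi\in H^\infty(\mathbb{R})$ with $\|\phi\|_{H^s}<\varepsilon$ and a time $0<T<\varepsilon$ such that the smooth solution $u$ of $$i\partial_t u-|D|u=\mu|u|^2u,\qquad u(0)=\phi,$$ exists on $[0,T]$ and satisfies $\|u(T)\|_{H^s}>\frac1\varepsilon$. In particular, the solution map fails to be continuous at zero in $H^s(\mathbb{R})$.
   Context: $|D|$ is the Fourier multiplier with symbol $|\xi|$. $H^\infty(\mathbb{R})=\bigcap_{\sigma>0}H^\sigma(\mathbb{R})$, and $\|f\|_{H^s}=\frac{1}{\sqrt{2\pi}}\big(\int\langle\xi\rangle^{2s}|\widehat f(\xi)|^2d\xi\big)^{1/2}$ with $\langle\xi\rangle=\sqrt{1+\xi^2}$, $\widehat f(\xi)=\int e^{-ix\xi}f(x)dx$. *)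

theory Defs
  imports "HOL-Analysis.Analysis"
begin

definition fourier :: "(real \<Rightarrow> complex) \<Rightarrow> real \<Rightarrow> complex" where
  "fourier f \<xi> = (\<integral>x. exp (- \<i> * complex_of_real (x * \<xi>)) * f x \<partial>lborel)"

definition test_fun :: "(real \<Rightarrow> real) \<Rightarrow> bool" where
  "test_fun \<psi> \<longleftrightarrow> (\<forall>n x. (deriv ^^ n) \<psi> differentiable (at x)) \<and> bounded {x. \<psi> x \<noteq> 0}"

definition has_fourier :: "(real \<Rightarrow> complex) \<Rightarrow> (real \<Rightarrow> complex) \<Rightarrow> bool" where
  "has_fourier f g \<longleftrightarrow> f \<in> borel_measurable lborel \<and> g \<in> borel_measurable lborel \<and>
     (\<forall>a b. set_integrable lborel {a..b} g) \<and>
     (\<forall>\<psi>. test_fun \<psi> \<longrightarrow>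
        integrable lborel (\<lambda>x. f x * fourier (\<lambda>\<xi>. complex_of_real (\<psi> \<xi>)) x) \<and>
        integrable lborel (\<lambda>\<xi>. g \<xi> * complex_of_real (\<psi> \<xi>)) \<and>
        (\<integral>x. f x * fourier (\<lambda>\<xi>. complex_of_real (\<psi> \<xi>)) x \<partial>lborel)
          = (\<integral>\<xi>. g \<xi> * complex_of_real (\<psi> \<xi>) \<partial>lborel))"

definition fourier_of :: "(real \<Rightarrow> complex) \<Rightarrow> real \<Rightarrow> complex" where
  "fourier_of f = (SOME g. has_fourier f g)"

definition in_H :: "real \<Rightarrow> (real \<Rightarrow> complex) \<Rightarrow> bool" where
  "in_H s f \<longleftrightarrow> (\<exists>g. has_fourier f g \<and>
       integrable lborel (\<lambda>\<xi>. (1 + \<xi>\<^sup>2) powr s * (cmod (g \<xi>))\<^sup>2))"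

definition sobolev_norm :: "real \<Rightarrow> (real \<Rightarrow> complex) \<Rightarrow> real" where
  "sobolev_norm s f = (1 / sqrt (2 * pi)) *
     sqrt (\<integral>\<xi>. (1 + \<xi>\<^sup>2) powr s * (cmod (fourier_of f \<xi>))\<^sup>2 \<partial>lborel)"

definition H_infty :: "(real \<Rightarrow> complex) \<Rightarrow> bool" where
  "H_infty f \<longleftrightarrow> (\<forall>\<sigma>>0. in_H \<sigma> f)"

definition is_absD :: "(real \<Rightarrow> complex) \<Rightarrow> (real \<Rightarrow> complex) \<Rightarrow> bool" where
  "is_absD f w \<longleftrightarrow> (\<exists>g. has_fourier f g \<and> has_fourier w (\<lambda>\<xi>. complex_of_real \<bar>\<xi>\<bar> * g \<xi>))"

text \<open>Smooth solution on [0,T] of  i u_t - |D| u = mu |u|^2 u,  u(0) = phi: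
  u(t) in H^infinity for all t, t -> u(t) continuous into every H^sigma,
  u and u_t jointly continuous, pointwise time derivative, equation holding
  for every t (a.e. in x, |D|u(t) being an L^2 object).\<close>
definition hw_solution :: "real \<Rightarrow> real \<Rightarrow> (real \<Rightarrow> complex) \<Rightarrow> (real \<Rightarrow> real \<Rightarrow> complex) \<Rightarrow> bool" where
  "hw_solution \<mu> T \<phi> u \<longleftrightarrow>
     u 0 = \<phi> \<and>
     (\<forall>t\<in>{0..T}. H_infty (u t)) \<and>
     (\<forall>\<sigma>>0. \<forall>t0\<in>{0..T}.
        ((\<lambda>t. sobolev_norm \<sigma> (\<lambda>x. u t x - u t0 x)) \<longlongrightarrow> 0) (at t0 within {0..T})) \<and>
     (\<exists>u'. continuous_on ({0..T} \<times> UNIV) (\<lambda>(t, x). u t x) \<and>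
           continuous_on ({0..T} \<times> UNIV) (\<lambda>(t, x). u' t x) \<and>
           (\<forall>x. \<forall>t\<in>{0..T}. ((\<lambda>\<tau>. u \<tau> x) has_vector_derivative u' t x) (at t within {0..T})) \<and>
           (\<forall>t\<in>{0..T}. \<exists>w. is_absD (u t) w \<and>
              (AE x in lborel. \<i> * u' t x - w x
                  = complex_of_real (\<mu> * (cmod (u t x))\<^sup>2) * u t x)))"

end

theory Submission
  imports Defs "HOL-Probability.Probability"
begin

text \<open>
  The datum has Fourier transform of size \<open>A\<close> supported near the frequencies \<open>N\<close> and \<open>2N\<close>, so for \<open>s < 0\<close> its
  \<open>H\<^sup>s\<close> norm is small once \<open>N\<close> is large compared with \<open>A\<close>. The interaction \<open>N - 2N + N\<close> feeds the frequencies
  in \<open>[0, 1/2]\<close>. All frequencies involved are nonnegative, where \<open>|D|\<close> is linear, so this interaction is exactly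
  resonant and contributes \<open>T A\<^sup>3\<close> at time \<open>T\<close>; the higher Picard iterates contribute \<open>O(T\<^sup>2 A\<^sup>5)\<close>. With
  \<open>T = \<delta> / A\<^sup>2\<close> and \<open>\<delta>\<close> a small constant the low frequencies reach size \<open>A\<close>, independently of \<open>N\<close>.

  All this happens on the Fourier side in the space of continuous functions bounded by a weight \<open>W\<close> with
  \<open>W * W \<le> K W\<close>, where \<open>K\<close> does not depend on \<open>N\<close> and \<open>W\<close> decays exponentially (at scale \<open>N\<close>), which gives
  smoothness of the solution on the same time interval. Any other solution coincides with this one by an
  \<open>L\<^sup>2\<close> energy estimate.
\<close>

subsection \<open>Smooth functions and bumps\<close>

text \<open>The theorem speaks about every solution in the sense of \<open>hw_solution\<close>,
  which records only qualitative regularity, while the growth is computed for one constructed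
  solution; uniqueness in exactly that class bridges the two. Since \<open>has_fourier\<close> is a
  pairing with test functions and \<open>fourier_of\<close> a choice, the pairing must first be
  shown to determine the transform from the function and the function from the transform. Of
  Plancherel's theorem two consequences suffice, an L2 bound for the inverse transform and the
  symmetry of |D|; both come from a Gaussian cut-off that is removed in the limit. Two demands force
  the shape of the weight: it is of order 1 at \<open>N\<close> and \<open>2N\<close>, where the
  datum has size \<open>A\<close>, and its convolution square is controlled uniformly in
  \<open>N\<close>, so that the time of existence does not shrink. A broad weight fails the second,
  a weight peaked only at 0 the first; teeth of unit width at the multiples of \<open>N\<close> meet
  both. The choice is then \<open>A\<close> and \<open>T\<close> from \<epsilon>, and
  \<open>N\<close> last. The sign of \<mu> is invisible, as the growth is read off absolute
  values.\<close>

definition smooth :: "(real \<Rightarrow> real) \<Rightarrow> bool" where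
  "smooth f \<longleftrightarrow> (\<forall>n x. (deriv ^^ n) f differentiable (at x))"

text \<open>Replaces formulas for the n-th derivative by an invariant: it suffices to find a class
  of differentiable functions that contains \<open>f\<close> and is stable under
  \<open>deriv\<close>.\<close>

lemma smooth_closedI:
  assumes "C f"
    and "\<And>f x. C f \<Longrightarrow> f differentiable (at x)"
    and "\<And>f. C f \<Longrightarrow> C (deriv f)"
  shows "smooth f"
proof -
  have "C ((deriv ^^ n) f)" for n
    using assms by (induction n) auto
  then show ?thesis
    using assms(2) by (auto simp: smooth_def)
qed

lemma smooth_imp_differentiable: "smooth f \<Longrightarrow> f differentiable (at x)"
  unfolding smooth_def by (metis funpow_0)

lemma smooth_deriv: "smooth f \<Longrightarrow> smooth (deriv f)"
  unfolding smooth_def by (metis comp_apply funpow_Suc_right)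

lemma smooth_DERIV: "smooth f \<Longrightarrow> DERIV f x :> deriv f x"
  using smooth_imp_differentiable
  by (simp add: DERIV_deriv_iff_real_differentiable)

lemma smooth_continuous_on: "smooth f \<Longrightarrow> continuous_on S f"
  by (meson DERIV_isCont continuous_at_imp_continuous_on smooth_DERIV)

text \<open>The invariant class for products: by the Leibniz rule products alone are not stable
  under \<open>deriv\<close>, but finite sums of them are.\<close>

inductive sum_of_products :: "(real \<Rightarrow> real) \<Rightarrow> bool" where
  prod: "smooth f \<Longrightarrow> smooth g \<Longrightarrow> sum_of_products (\<lambda>x. f x * g x)"
| add: "sum_of_products f \<Longrightarrow> sum_of_products g \<Longrightarrow> sum_of_products (\<lambda>x. f x + g x)"

lemma sum_of_products_closed:
  "sum_of_products f \<Longrightarrow> (\<forall>x. f differentiable (at x)) \<and> sum_of_products (deriv f)"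
proof (induction rule: sum_of_products.induct)
  case (prod f g)
  have D: "DERIV (\<lambda>x. f x * g x) x :> deriv f x * g x + f x * deriv g x" for x
    using prod smooth_DERIV by (auto intro!: derivative_eq_intros)
  have "deriv (\<lambda>x. f x * g x) = (\<lambda>x. deriv f x * g x + f x * deriv g x)"
    using D DERIV_imp_deriv by blast
  then show ?case
    using D prod by (auto intro!: sum_of_products.intros smooth_deriv simp: real_differentiable_def)
next
  case (add f g)
  have "deriv (\<lambda>x. f x + g x) = (\<lambda>x. deriv f x + deriv g x)"
  proof
    fix x
    have "DERIV (\<lambda>x. f x + g x) x :> deriv f x + deriv g x"
      using add by (auto intro!: derivative_eq_intros simp: DERIV_deriv_iff_real_differentiable)
    then show "deriv (\<lambda>x. f x + g x) x = deriv f x + deriv g x"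
      by (rule DERIV_imp_deriv)
  qed
  then show ?case
    using add by (auto intro: sum_of_products.intros)
qed

lemma smooth_mult:
  assumes "smooth f" "smooth g"
  shows "smooth (\<lambda>x. f x * g x)"
  using sum_of_products_closed sum_of_products.prod[OF assms]
  by (intro smooth_closedI[of sum_of_products]) auto

lemma smooth_affine:
  assumes "smooth f"
  shows "smooth (\<lambda>x. f (a * x + b))"
\<comment> \<open>The scalar \<open>c\<close> absorbs the powers of \<open>a\<close> that the chain
  rule produces.\<close>
proof (rule smooth_closedI[of "\<lambda>h. \<exists>c g. smooth g \<and> h = (\<lambda>x. c * g (a * x + b))"])
  show "\<exists>c g. smooth g \<and> (\<lambda>x. f (a * x + b)) = (\<lambda>x. c * g (a * x + b))"
    using assms by (intro exI[of _ 1] exI[of _ f]) auto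
next
  fix h
  assume "\<exists>c g. smooth g \<and> h = (\<lambda>x. c * g (a * x + b))"
  then obtain c g where g: "smooth g" and h: "h = (\<lambda>x. c * g (a * x + b))"
    by blast
  have D: "DERIV h x :> (c * a) * deriv g (a * x + b)" for x
    unfolding h by (auto intro!: derivative_eq_intros DERIV_chain2[OF smooth_DERIV[OF g]])
  show "h differentiable (at x)" for x
    using D real_differentiable_def by blast
  have "deriv h = (\<lambda>x. (c * a) * deriv g (a * x + b))"
    using D DERIV_imp_deriv by blast
  then show "\<exists>c g. smooth g \<and> deriv h = (\<lambda>x. c * g (a * x + b))"
    using smooth_deriv[OF g] by blast
qed

text \<open>Differentiation shifts the phase by \<open>pi / 2\<close>, so the free phase
  \<open>b\<close> closes the class, and sines are covered as well.\<close>

lemma smooth_cos_affine: "smooth (\<lambda>x. cos (a * x + b))"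
proof (rule smooth_closedI[of "\<lambda>h. \<exists>c b. h = (\<lambda>x. c * cos (a * x + b))"])
  show "\<exists>c b'. (\<lambda>x. cos (a * x + b)) = (\<lambda>x. c * cos (a * x + b'))"
    by (intro exI[of _ 1] exI[of _ b]) auto
next
  fix h
  assume "\<exists>c b. h = (\<lambda>x. c * cos (a * x + b))"
  then obtain c b where h: "h = (\<lambda>x. c * cos (a * x + b))"
    by blast
  have D: "DERIV h x :> (c * a) * cos (a * x + (b + pi / 2))" for x
    unfolding h by (auto intro!: derivative_eq_intros simp: minus_sin_cos_eq add.assoc)
  show "h differentiable (at x)" for x
    using D real_differentiable_def by blast
  have "deriv h = (\<lambda>x. (c * a) * cos (a * x + (b + pi / 2)))"
    using D DERIV_imp_deriv by blast
  then show "\<exists>c b. deriv h = (\<lambda>x. c * cos (a * x + b))"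
    by blast
qed

section \<open>Smooth bumps built from exp(-1/x)\<close>

lemma poly_exp_tendsto_0: "((\<lambda>y. poly p y * exp (- y)) \<longlongrightarrow> (0::real)) at_top"
proof -
  have "((\<lambda>y. \<Sum>i\<le>degree p. coeff p i * (y ^ i / exp y)) \<longlongrightarrow> (\<Sum>i\<le>degree p. coeff p i * 0)) at_top"
    by (intro tendsto_sum tendsto_mult tendsto_const tendsto_power_div_exp_0)
  moreover have "poly p y * exp (- y) = (\<Sum>i\<le>degree p. coeff p i * (y ^ i / exp y))" for y :: real
    by (simp add: poly_altdef sum_distrib_right exp_minus divide_inverse mult.assoc)
  ultimately show ?thesis
    by simp
qed

text \<open>A polynomial in \<open>1 / x\<close> times \<open>exp (- (1 / x))\<close>, glued to 0.
  The polynomial makes the family stable under differentiation; \<open>flat 1\<close> is the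
  classical smooth function that is flat at 0.\<close>

definition flat :: "real poly \<Rightarrow> real \<Rightarrow> real" where
  "flat p x = (if x > 0 then poly p (1 / x) * exp (- (1 / x)) else 0)"

lemma flat_tendsto_0: "(flat p \<longlongrightarrow> 0) (at 0)"
proof -
  have "((\<lambda>x. poly p (inverse x) * exp (- inverse x)) \<longlongrightarrow> 0) (at_right 0)"
    using filterlim_compose[OF poly_exp_tendsto_0 filterlim_inverse_at_top_right] .
  then have "(flat p \<longlongrightarrow> 0) (at_right 0)"
    by (rule Lim_transform_eventually)
       (auto simp: flat_def eventually_at_filter inverse_eq_divide)
  moreover have "(flat p \<longlongrightarrow> 0) (at_left 0)"
    by (rule Lim_transform_eventually[OF tendsto_const])
       (auto simp: flat_def eventually_at_filter)
  ultimately show ?thesis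
    by (simp add: filterlim_split_at)
qed

text \<open>In the variable \<open>y = 1 / x\<close> one has d/dx = - y^2 d/dy, which sends
  \<open>p(y) exp(- y)\<close> to \<open>y^2 (p - p')(y) exp(- y)\<close>; the factor
  \<open>[:0,0,1:]\<close> is y^2.\<close>

lemma flat_DERIV: "DERIV (flat p) x :> flat ([:0,0,1:] * (p - pderiv p)) x"
proof -
  consider "x > 0" | "x < 0" | "x = 0" by linarith
  then show ?thesis
  proof cases
    case 1
    have "DERIV (\<lambda>x. poly p (1 / x) * exp (- (1 / x))) x :> flat ([:0,0,1:] * (p - pderiv p)) x"
      using 1 unfolding flat_def
      by (auto intro!: derivative_eq_intros DERIV_chain2[OF poly_DERIV] simp: field_simps power2_eq_square)
    then show ?thesis
      by (rule has_field_derivative_transform_within_open[of _ _ _ "{0<..}"])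
         (use 1 in \<open>auto simp: flat_def\<close>)
  next
    case 2
    have "DERIV (\<lambda>x. 0) x :> flat ([:0,0,1:] * (p - pderiv p)) x"
      using 2 by (simp add: flat_def)
    then show ?thesis
      by (rule has_field_derivative_transform_within_open[of _ _ _ "{..<0}"])
         (use 2 in \<open>auto simp: flat_def\<close>)
  next
    case 3
    \<comment> \<open>Dividing by \<open>h\<close> multiplies the polynomial by its variable, so the
      difference quotient at 0 is again a \<open>flat\<close> function and tends to 0.\<close>
    have "((\<lambda>h. (flat p h - flat p 0) / h) \<longlongrightarrow> 0) (at 0)"
    proof (rule Lim_transform_eventually[OF flat_tendsto_0[of "pCons 0 p"]])
      show "\<forall>\<^sub>F h in at 0. flat (pCons 0 p) h = (flat p h - flat p 0) / h"
        by (auto simp: flat_def eventually_at_filter)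
    qed
    then show ?thesis
      using 3 by (simp add: DERIV_def flat_def)
  qed
qed

lemma smooth_flat: "smooth (flat p)"
proof (rule smooth_closedI[of "\<lambda>h. \<exists>p. h = flat p"])
  fix h
  assume "\<exists>p. h = flat p"
  then obtain p where h: "h = flat p"
    by blast
  show "h differentiable (at x)" for x
    using flat_DERIV h real_differentiable_def by blast
  show "\<exists>p. deriv h = flat p"
    using flat_DERIV h DERIV_imp_deriv by blast
qed auto

definition bump :: "real \<Rightarrow> real \<Rightarrow> real" where
  "bump R x = flat 1 (R + x) * flat 1 (R - x)"

lemma bump_pos: "\<bar>x\<bar> < R \<Longrightarrow> bump R x > 0"
  by (auto simp: bump_def flat_def)

lemma bump_eq_0: "\<bar>x\<bar> \<ge> R \<Longrightarrow> bump R x = 0"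
  by (auto simp: bump_def flat_def)

lemma smooth_bump: "smooth (bump R)"
  unfolding bump_def
  using smooth_mult[OF smooth_affine[OF smooth_flat, of 1 1 R] smooth_affine[OF smooth_flat, of 1 "-1" R]]
  by (simp add: add.commute)

lemma test_fun_iff: "test_fun \<psi> \<longleftrightarrow> smooth \<psi> \<and> bounded {x. \<psi> x \<noteq> 0}"
  by (simp add: test_fun_def smooth_def)

lemma test_fun_bump: "test_fun (bump R)"
proof -
  have "{x. bump R x \<noteq> 0} \<subseteq> {-R..R}"
    using bump_eq_0[of R] by force
  then show ?thesis
    using bounded_subset[OF compact_imp_bounded[OF compact_Icc]] smooth_bump by (auto simp: test_fun_iff)
qed

lemma test_fun_mult_smooth:
  assumes "test_fun \<psi>" "smooth f"
  shows "test_fun (\<lambda>x. \<psi> x * f x)"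
  using assms unfolding test_fun_iff
  by (auto intro: smooth_mult bounded_subset)

lemma test_fun_translate:
  assumes "test_fun \<psi>"
  shows "test_fun (\<lambda>x. \<psi> (x - a))"
proof -
  have "{x. \<psi> (x - a) \<noteq> 0} = (\<lambda>x. a + x) ` {x. \<psi> x \<noteq> 0}"
    by (force simp: image_iff intro: exI[of _ "_ - a"])
  then show ?thesis
    using assms smooth_affine[of \<psi> 1 "-a"]
    by (auto simp: test_fun_iff bounded_translation)
qed

lemma test_fun_deriv:
  assumes "test_fun \<psi>"
  shows "test_fun (deriv \<psi>)"
proof -
  have "{x. deriv \<psi> x \<noteq> 0} \<subseteq> closure {x. \<psi> x \<noteq> 0}"
  proof (rule ccontr)
    assume "\<not> ?thesis"
    then obtain x where x: "deriv \<psi> x \<noteq> 0" "x \<notin> closure {x. \<psi> x \<noteq> 0}"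
      by blast
    have "DERIV (\<lambda>x. 0) x :> 0"
      by simp
    then have "DERIV \<psi> x :> 0"
      by (rule has_field_derivative_transform_within_open[of _ _ _ "- closure {x. \<psi> x \<noteq> 0}"])
         (use x closure_subset[of "{x. \<psi> x \<noteq> 0}"] in auto)
    then show False
      using x DERIV_imp_deriv by blast
  qed
  then show ?thesis
    using assms bounded_closure bounded_subset smooth_deriv unfolding test_fun_iff by blast
qed

lemma test_fun_supportE:
  assumes "test_fun \<psi>"
  obtains R where "R > 0" "\<And>x. \<bar>x\<bar> \<ge> R \<Longrightarrow> \<psi> x = 0"
proof -
  obtain R where R: "\<forall>x\<in>{x. \<psi> x \<noteq> 0}. norm x \<le> R"
    using assms by (auto simp: test_fun_iff bounded_iff)
  show ?thesis
    by (rule that[of "\<bar>R\<bar> + 1"]) (use R in \<open>force+\<close>)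
qed

subsection \<open>Gaussians and the inverse Fourier transform\<close>

lemma continuous_on_lborel_integral:
  fixes f :: "'a::metric_space \<Rightarrow> real \<Rightarrow> 'b::{banach, second_countable_topology}"
  assumes meas: "\<And>t. t \<in> S \<Longrightarrow> f t \<in> borel_measurable lborel"
    and cont: "\<And>\<xi>. continuous_on S (\<lambda>t. f t \<xi>)"
    and h: "integrable lborel h"
    and bd: "\<And>t \<xi>. t \<in> S \<Longrightarrow> norm (f t \<xi>) \<le> h \<xi>"
  shows "continuous_on S (\<lambda>t. \<integral>\<xi>. f t \<xi> \<partial>lborel)"
proof (rule continuous_on_sequentiallyI)
  fix u a
  assume u: "\<forall>n. u n \<in> S" "a \<in> S" "u \<longlonglongrightarrow> a"
  show "(\<lambda>n. \<integral>\<xi>. f (u n) \<xi> \<partial>lborel) \<longlonglongrightarrow> (\<integral>\<xi>. f a \<xi> \<partial>lborel)"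
  proof (rule integral_dominated_convergence[OF _ _ h])
    show "f a \<in> borel_measurable lborel" and "\<And>n. f (u n) \<in> borel_measurable lborel"
      using meas u by auto
    show "AE \<xi> in lborel. (\<lambda>n. f (u n) \<xi>) \<longlonglongrightarrow> f a \<xi>"
      using cont u unfolding continuous_on_sequentially comp_def by blast
    show "\<And>n. AE \<xi> in lborel. norm (f (u n) \<xi>) \<le> h \<xi>"
      using bd u by auto
  qed
qed

text \<open>By the mean value inequality the remainder quotient is at most \<open>2 * h\<close>, so
  dominated convergence applies. The derivative is taken within the closed interval because
  \<open>hw_solution\<close> takes it within \<open>{0..T}\<close>, one-sidedly at the end
  points.\<close>

lemma has_vector_derivative_lborel_integral:
  fixes f :: "real \<Rightarrow> real \<Rightarrow> 'b::{banach, second_countable_topology}"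
  assumes int: "\<And>t. t \<in> {a..b} \<Longrightarrow> integrable lborel (f t)"
    and meas: "\<And>t. t \<in> {a..b} \<Longrightarrow> f' t \<in> borel_measurable lborel"
    and der: "\<And>t \<xi>. t \<in> {a..b} \<Longrightarrow> ((\<lambda>t. f t \<xi>) has_vector_derivative f' t \<xi>) (at t within {a..b})"
    and h: "integrable lborel h"
    and bd: "\<And>t \<xi>. t \<in> {a..b} \<Longrightarrow> norm (f' t \<xi>) \<le> h \<xi>"
    and t: "t \<in> {a..b}"
  shows "((\<lambda>t. \<integral>\<xi>. f t \<xi> \<partial>lborel) has_vector_derivative (\<integral>\<xi>. f' t \<xi> \<partial>lborel)) (at t within {a..b})"
proof -
  have int': "integrable lborel (f' s)" if "s \<in> {a..b}" for s
    using that by (intro Bochner_Integration.integrable_bound[OF h meas]) (auto intro!: order_trans[OF bd] simp del: abs_ge_self)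
  have lip: "norm (f y \<xi> - f t \<xi>) \<le> h \<xi> * \<bar>y - t\<bar>" if "y \<in> {a..b}" for y \<xi>
  proof -
    have "norm (f y \<xi> - f t \<xi>) \<le> h \<xi> * norm (y - t)"
    proof (rule differentiable_bound[where S = "{a..b}" and f' = "\<lambda>s k. k *\<^sub>R f' s \<xi>"])
      show "\<And>s. s \<in> {a..b} \<Longrightarrow> ((\<lambda>s. f s \<xi>) has_derivative (\<lambda>k. k *\<^sub>R f' s \<xi>)) (at s within {a..b})"
        using der by (simp add: has_vector_derivative_def)
      show "onorm (\<lambda>k. k *\<^sub>R f' s \<xi>) \<le> h \<xi>" if "s \<in> {a..b}" for s
        by (rule onorm_le) (use bd[OF that, of \<xi>] in \<open>simp add: mult.commute[of "h \<xi>"] mult_left_mono\<close>)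
    qed (use that t in auto)
    then show ?thesis
      by simp
  qed
  \<comment> \<open>The derivative within the interval exists exactly if this normalised Taylor
    remainder, integrated, tends to 0.\<close>
  let ?q = "\<lambda>y \<xi>. (1 / norm (y - t)) *\<^sub>R (f y \<xi> - (f t \<xi> + (y - t) *\<^sub>R f' t \<xi>))"
  have "((\<lambda>y. \<integral>\<xi>. ?q y \<xi> \<partial>lborel) \<longlongrightarrow> 0) (at t within {a..b})"
    unfolding tendsto_at_iff_sequentially comp_def
  proof (intro allI impI)
    fix X :: "nat \<Rightarrow> real"
    assume X: "\<forall>i. X i \<in> {a..b} - {t}" "X \<longlonglongrightarrow> t"
    have "(\<lambda>i. \<integral>\<xi>. ?q (X i) \<xi> \<partial>lborel) \<longlonglongrightarrow> (\<integral>\<xi>. 0 \<partial>(lborel :: real measure))"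
    proof (rule integral_dominated_convergence[where s = "\<lambda>i. ?q (X i)" and f = "\<lambda>_. 0" and w = "\<lambda>\<xi>. 2 * h \<xi>"])
      show "integrable lborel (\<lambda>\<xi>. 2 * h \<xi>)"
        using h by simp
      show "?q (X i) \<in> borel_measurable lborel" for i
        using X int[of "X i"] int[OF t] meas[OF t] by (auto intro!: borel_measurable_scaleR borel_measurable_diff borel_measurable_add dest: borel_measurable_integrable)
      show "AE \<xi> in lborel. (\<lambda>i. ?q (X i) \<xi>) \<longlonglongrightarrow> 0"
      proof (rule AE_I2)
        fix \<xi>
        have "((\<lambda>y. ?q y \<xi>) \<longlongrightarrow> 0) (at t within {a..b})"
          using der[OF t, of \<xi>] unfolding has_vector_derivative_def has_derivative_within by blast
        then show "(\<lambda>i. ?q (X i) \<xi>) \<longlonglongrightarrow> 0"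
          using X unfolding tendsto_at_iff_sequentially comp_def by blast
      qed
      show "AE \<xi> in lborel. norm (?q (X i) \<xi>) \<le> 2 * h \<xi>" for i
      proof (rule AE_I2)
        fix \<xi>
        have "norm (f (X i) \<xi> - (f t \<xi> + (X i - t) *\<^sub>R f' t \<xi>))
            \<le> norm (f (X i) \<xi> - f t \<xi>) + norm ((X i - t) *\<^sub>R f' t \<xi>)"
          by (metis diff_diff_add norm_triangle_ineq4)
        also have "\<dots> \<le> h \<xi> * \<bar>X i - t\<bar> + \<bar>X i - t\<bar> * h \<xi>"
          using X lip[of "X i" \<xi>] bd[OF t, of \<xi>] by (intro add_mono) (auto intro!: mult_left_mono)
        finally show "norm (?q (X i) \<xi>) \<le> 2 * h \<xi>"
          using X by (auto simp: divide_simps)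
      qed
    qed auto
    then show "(\<lambda>i. \<integral>\<xi>. ?q (X i) \<xi> \<partial>lborel) \<longlonglongrightarrow> 0"
      by simp
  qed
  moreover have "\<forall>\<^sub>F y in at t within {a..b}. (\<integral>\<xi>. ?q y \<xi> \<partial>lborel) =
      (1 / norm (y - t)) *\<^sub>R ((\<integral>\<xi>. f y \<xi> \<partial>lborel) - ((\<integral>\<xi>. f t \<xi> \<partial>lborel) + (y - t) *\<^sub>R (\<integral>\<xi>. f' t \<xi> \<partial>lborel)))"
    using int int'[OF t] t unfolding eventually_at_filter
    by (intro always_eventually) (auto simp del: scaleR_right_diff_distrib simp: Bochner_Integration.integral_diff Bochner_Integration.integral_add)
  ultimately have "((\<lambda>y. (1 / norm (y - t)) *\<^sub>R ((\<integral>\<xi>. f y \<xi> \<partial>lborel) - ((\<integral>\<xi>. f t \<xi> \<partial>lborel) + (y - t) *\<^sub>R (\<integral>\<xi>. f' t \<xi> \<partial>lborel)))) \<longlongrightarrow> 0) (at t within {a..b})"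
    by (rule Lim_transform_eventually)
  then show ?thesis
    unfolding has_vector_derivative_def has_derivative_within
    by (auto intro: bounded_linear_scaleR_left)
qed

lemma integrable_lborel_pair_mult:
  fixes p q :: "real \<Rightarrow> real"
  assumes "integrable lborel p" "integrable lborel q"
  shows "integrable (lborel \<Otimes>\<^sub>M lborel) (\<lambda>(x, y). p x * q y)"
proof (rule lborel_pair.Fubini_integrable)
  have [measurable]: "p \<in> borel_measurable lborel" "q \<in> borel_measurable lborel"
    using assms by auto
  show "(\<lambda>(x, y). p x * q y) \<in> borel_measurable (lborel \<Otimes>\<^sub>M lborel)"
    by measurable
  show "integrable lborel (\<lambda>x. \<integral>y. norm (case (x, y) of (x, y) \<Rightarrow> p x * q y) \<partial>lborel)"
    using assms by (simp add: abs_mult)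
  show "AE x in lborel. integrable lborel (\<lambda>y. case (x, y) of (x, y) \<Rightarrow> p x * q y)"
    using assms by simp
qed

text \<open>A majorant in product form fits oscillating kernels, as \<open>cis\<close> has modulus 1
  and disappears from the bound.\<close>

lemma Fubini_dominated:
  fixes f :: "real \<Rightarrow> real \<Rightarrow> 'b::{banach, second_countable_topology}"
  assumes f: "case_prod f \<in> borel_measurable (lborel \<Otimes>\<^sub>M lborel)"
    and p: "integrable lborel p" and q: "integrable lborel q"
    and bd: "\<And>x y. norm (f x y) \<le> p x * q y"
  shows "(\<integral>x. (\<integral>y. f x y \<partial>lborel) \<partial>lborel) = (\<integral>y. (\<integral>x. f x y \<partial>lborel) \<partial>lborel)"
    and "integrable lborel (\<lambda>x. \<integral>y. f x y \<partial>lborel)"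
    and "integrable lborel (\<lambda>y. \<integral>x. f x y \<partial>lborel)"
proof -
  have int: "integrable (lborel \<Otimes>\<^sub>M lborel) (case_prod f)"
    by (rule Bochner_Integration.integrable_bound[OF integrable_lborel_pair_mult[OF p q] f])
       (auto intro!: order_trans[OF bd])
  show "(\<integral>x. (\<integral>y. f x y \<partial>lborel) \<partial>lborel) = (\<integral>y. (\<integral>x. f x y \<partial>lborel) \<partial>lborel)"
    using lborel_pair.Fubini_integral[OF int] by simp
  show "integrable lborel (\<lambda>x. \<integral>y. f x y \<partial>lborel)"
    using lborel_pair.integrable_fst[OF int] .
  show "integrable lborel (\<lambda>y. \<integral>x. f x y \<partial>lborel)"
    using lborel_pair.integrable_snd[OF int] .
qed

lemma integrable_inverse_one_plus_square: "integrable lborel (\<lambda>x::real. 1 / (1 + x\<^sup>2))"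
  using integrable_inverse_1_plus_square
  by (simp add: set_integrable_def einterval_def inverse_eq_divide)

lemma integral_inverse_one_plus_square: "(\<integral>x. 1 / (1 + x\<^sup>2) \<partial>lborel) = pi"
  using LBINT_inverse_1_plus_square
  by (simp add: interval_lebesgue_integral_def set_lebesgue_integral_def einterval_def inverse_eq_divide)

lemma borel_measurable_cis [measurable]:
  "f \<in> borel_measurable M \<Longrightarrow> (\<lambda>x. cis (f x)) \<in> borel_measurable M"
  by (rule measurable_compose[of f M borel]) (auto intro!: borel_measurable_continuous_onI continuous_intros)

lemma integrable_cis_mult_iff [simp]:
  "integrable lborel (\<lambda>x. cis (a * x) * g x) \<longleftrightarrow> integrable lborel g"
  "integrable lborel (\<lambda>x. cis (x * a) * g x) \<longleftrightarrow> integrable lborel g" for g :: "real \<Rightarrow> complex"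
proof -
  have 1: "integrable lborel (\<lambda>x. cis (a * x) * g x)" if "integrable lborel g" for g :: "real \<Rightarrow> complex" and a
  proof (rule Bochner_Integration.integrable_bound[OF that])
    have [measurable]: "g \<in> borel_measurable lborel" using that by auto
    show "(\<lambda>x. cis (a * x) * g x) \<in> borel_measurable lborel" by measurable
  qed (auto simp: norm_mult)
  show "integrable lborel (\<lambda>x. cis (a * x) * g x) \<longleftrightarrow> integrable lborel g"
    using 1[of g a] 1[of "\<lambda>x. cis (a * x) * g x" "-a"]
    by (auto simp: cis_mult simp flip: mult.assoc)
  then show "integrable lborel (\<lambda>x. cis (x * a) * g x) \<longleftrightarrow> integrable lborel g"
    by (simp add: mult.commute)
qed

definition inv_fourier :: "(real \<Rightarrow> complex) \<Rightarrow> real \<Rightarrow> complex" where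
  "inv_fourier g x = (\<integral>\<xi>. cis (x * \<xi>) * g \<xi> \<partial>lborel) / (2 * pi)"

lemma fourier_eq: "fourier f \<xi> = (\<integral>x. cis (- (x * \<xi>)) * f x \<partial>lborel)"
  unfolding fourier_def by (simp add: cis_conv_exp)

lemma borel_measurable_inv_fourier [measurable]:
  assumes [measurable]: "g \<in> borel_measurable lborel"
  shows "inv_fourier g \<in> borel_measurable lborel"
  unfolding inv_fourier_def by measurable

lemma borel_measurable_fourier [measurable]:
  assumes [measurable]: "g \<in> borel_measurable lborel"
  shows "fourier g \<in> borel_measurable lborel"
  unfolding fourier_eq by measurable

lemma norm_inv_fourier_le:
  "norm (inv_fourier g x) \<le> (\<integral>\<xi>. norm (g \<xi>) \<partial>lborel) / (2 * pi)"
proof -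
  have "norm (\<integral>\<xi>. cis (x * \<xi>) * g \<xi> \<partial>lborel) \<le> (\<integral>\<xi>. norm (cis (x * \<xi>) * g \<xi>) \<partial>lborel)"
    by simp
  then show ?thesis
    by (simp add: inv_fourier_def norm_divide norm_mult divide_right_mono)
qed

lemma norm_fourier_le: "norm (fourier g x) \<le> (\<integral>\<xi>. norm (g \<xi>) \<partial>lborel)"
proof -
  have "norm (\<integral>\<xi>. cis (- (\<xi> * x)) * g \<xi> \<partial>lborel) \<le> (\<integral>\<xi>. norm (cis (- (\<xi> * x)) * g \<xi>) \<partial>lborel)"
    by simp
  then show ?thesis
    by (simp add: fourier_eq norm_mult)
qed

lemma continuous_on_inv_fourier:
  assumes "integrable lborel g"
  shows "continuous_on S (inv_fourier g)"
proof -
  have [measurable]: "g \<in> borel_measurable lborel"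
    using assms by auto
  have "continuous_on S (\<lambda>x. \<integral>\<xi>. cis (x * \<xi>) * g \<xi> \<partial>lborel)"
    by (rule continuous_on_lborel_integral[where h = "\<lambda>\<xi>. norm (g \<xi>)"])
       (auto intro!: continuous_intros simp: norm_mult assms)
  then show ?thesis
    unfolding inv_fourier_def by (intro continuous_intros) auto
qed

lemma inv_fourier_diff:
  "integrable lborel f \<Longrightarrow> integrable lborel g \<Longrightarrow>
    inv_fourier (\<lambda>\<xi>. f \<xi> - g \<xi>) x = inv_fourier f x - inv_fourier g x"
  by (simp add: inv_fourier_def right_diff_distrib diff_divide_distrib)

lemma inv_fourier_add:
  "integrable lborel f \<Longrightarrow> integrable lborel g \<Longrightarrow>
    inv_fourier (\<lambda>\<xi>. f \<xi> + g \<xi>) x = inv_fourier f x + inv_fourier g x"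
  by (simp add: inv_fourier_def distrib_left add_divide_distrib)

lemma inv_fourier_cmult: "inv_fourier (\<lambda>\<xi>. c * g \<xi>) x = c * inv_fourier g x"
  by (simp add: inv_fourier_def mult.left_commute)

lemma cnj_inv_fourier: "cnj (inv_fourier g x) = inv_fourier (\<lambda>\<xi>. cnj (g (- \<xi>))) x"
proof -
  have "cnj (\<integral>\<xi>. cis (x * \<xi>) * g \<xi> \<partial>lborel) = (\<integral>\<xi>. cnj (cis (x * \<xi>) * g \<xi>) \<partial>lborel)"
    by (rule Bochner_Integration.integral_cnj[symmetric])
  also have "\<dots> = (\<integral>\<xi>. cis (- (x * \<xi>)) * cnj (g \<xi>) \<partial>lborel)"
    by (intro Bochner_Integration.integral_cong) (simp_all add: cis_cnj)
  also have "\<dots> = (\<integral>\<xi>. cis (x * \<xi>) * cnj (g (- \<xi>)) \<partial>lborel)"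
    using lborel_integral_real_affine[of "-1" "\<lambda>\<xi>. cis (- (x * \<xi>)) * cnj (g \<xi>)" 0] by simp
  finally show ?thesis
    by (simp add: inv_fourier_def)
qed

section \<open>Gaussian regularisation and Fourier inversion\<close>

lemma integrable_gaussian: "integrable lborel (\<lambda>x::real. exp (- x\<^sup>2 / 2))"
proof -
  have "integrable lborel (\<lambda>x. sqrt (2 * pi) * std_normal_density x)"
    using integrable_std_normal_moment[of 0] by simp
  then show ?thesis
    by (simp add: std_normal_density_def)
qed

lemma integrable_gaussian_scaled: "e \<noteq> 0 \<Longrightarrow> integrable lborel (\<lambda>x::real. exp (- (e * x)\<^sup>2 / 2))"
  using lborel_integrable_real_affine[OF integrable_gaussian, of e 0] by simp

text \<open>This is the characteristic function of the standard normal distribution, freed from the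
  normalisation of the density.\<close>

lemma fourier_gaussian:
  "(\<integral>x. cis (x * t) * complex_of_real (exp (- x\<^sup>2 / 2)) \<partial>lborel) = complex_of_real (sqrt (2 * pi) * exp (- t\<^sup>2 / 2))"
proof -
  have "complex_of_real (exp (- t\<^sup>2 / 2)) = char std_normal_distribution t"
    by (simp add: char_std_normal_distribution)
  also have "\<dots> = (\<integral>x. std_normal_density x *\<^sub>R iexp (t * x) \<partial>lborel)"
    unfolding char_def by (subst integral_density) (auto simp: normal_density_nonneg)
  also have "\<dots> = (\<integral>x. (1 / sqrt (2 * pi)) * (cis (x * t) * complex_of_real (exp (- x\<^sup>2 / 2))) \<partial>lborel)"
    by (intro Bochner_Integration.integral_cong)
       (auto simp: std_normal_density_def cis_conv_exp scaleR_conv_of_real mult_ac)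
  also have "\<dots> = (1 / sqrt (2 * pi)) * (\<integral>x. cis (x * t) * complex_of_real (exp (- x\<^sup>2 / 2)) \<partial>lborel)"
    by (subst integral_mult_right_zero) simp
  finally show ?thesis
    by (simp add: field_simps flip: of_real_mult)
qed

text \<open>The transform of the cut-off \<open>exp (- (e * x)^2 / 2)\<close>: an approximate
  identity of total mass \<open>2 * pi\<close> as \<open>e\<close> tends to 0.\<close>

definition gauss_kernel :: "real \<Rightarrow> real \<Rightarrow> real" where
  "gauss_kernel e t = sqrt (2 * pi) / e * exp (- (t / e)\<^sup>2 / 2)"

lemma fourier_gaussian_scaled:
  assumes "e > 0"
  shows "(\<integral>x. cis (x * t) * complex_of_real (exp (- (e * x)\<^sup>2 / 2)) \<partial>lborel) = complex_of_real (gauss_kernel e t)"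
proof -
  have "(\<integral>x. cis (x * (t / e)) * complex_of_real (exp (- x\<^sup>2 / 2)) \<partial>lborel)
      = e * (\<integral>x. cis (x * t) * complex_of_real (exp (- (e * x)\<^sup>2 / 2)) \<partial>lborel)"
    using lborel_integral_real_affine[of e "\<lambda>x. cis (x * (t / e)) * complex_of_real (exp (- x\<^sup>2 / 2))" 0] assms
    by (simp add: scaleR_conv_of_real)
  then have "(\<integral>x. cis (x * t) * complex_of_real (exp (- (e * x)\<^sup>2 / 2)) \<partial>lborel)
      = complex_of_real (sqrt (2 * pi) * exp (- (t / e)\<^sup>2 / 2)) / e"
    unfolding fourier_gaussian using assms by (simp add: nonzero_eq_divide_eq mult.commute)
  then show ?thesis
    by (simp add: gauss_kernel_def)
qed

lemma gauss_kernel_nonneg: "e > 0 \<Longrightarrow> gauss_kernel e t \<ge> 0"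
  by (simp add: gauss_kernel_def)

lemma gauss_kernel_minus: "gauss_kernel e (- t) = gauss_kernel e t"
  by (simp add: gauss_kernel_def)

lemma gauss_kernel_commute: "gauss_kernel e (a - b) = gauss_kernel e (b - a)"
  using gauss_kernel_minus[of e "a - b"] by simp

lemma borel_measurable_gauss_kernel [measurable]: "gauss_kernel e \<in> borel_measurable borel"
  unfolding gauss_kernel_def by measurable

text \<open>The substitution \<open>t = e * z\<close> moves the dependence on \<open>e\<close> from
  the kernel into the argument of \<open>F\<close>, which leaves a Gaussian independent of
  \<open>e\<close> as majorant.\<close>

lemma gauss_kernel_substitution:
  fixes F :: "real \<Rightarrow> 'a::{banach, second_countable_topology}"
  assumes "e > 0"
  shows "integrable lborel (\<lambda>t. gauss_kernel e t *\<^sub>R F t) \<longleftrightarrow>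
      integrable lborel (\<lambda>z. (sqrt (2 * pi) * exp (- z\<^sup>2 / 2)) *\<^sub>R F (e * z))"
    and "(\<integral>t. gauss_kernel e t *\<^sub>R F t \<partial>lborel)
      = (\<integral>z. (sqrt (2 * pi) * exp (- z\<^sup>2 / 2)) *\<^sub>R F (e * z) \<partial>lborel)"
proof -
  let ?G = "\<lambda>z. (sqrt (2 * pi) * exp (- z\<^sup>2 / 2)) *\<^sub>R F (e * z)"
  have eq: "(\<lambda>z. gauss_kernel e (e * z) *\<^sub>R F (e * z)) = (\<lambda>z. (1 / e) *\<^sub>R ?G z)"
    using assms by (simp add: gauss_kernel_def)
  have "integrable lborel (\<lambda>t. gauss_kernel e t *\<^sub>R F t) \<longleftrightarrow> integrable lborel (\<lambda>z. (1 / e) *\<^sub>R ?G z)"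
    using lborel_integrable_real_affine_iff[of e "\<lambda>t. gauss_kernel e t *\<^sub>R F t" 0] assms
    unfolding add_0_left eq by blast
  moreover have "integrable lborel (\<lambda>z. (1 / e) *\<^sub>R ?G z) \<longleftrightarrow> integrable lborel ?G"
  proof
    assume "integrable lborel (\<lambda>z. (1 / e) *\<^sub>R ?G z)"
    then have "integrable lborel (\<lambda>z. e *\<^sub>R (1 / e) *\<^sub>R ?G z)"
      by (rule integrable_scaleR_right)
    then show "integrable lborel ?G"
      using assms by simp
  qed (rule integrable_scaleR_right)
  ultimately show "integrable lborel (\<lambda>t. gauss_kernel e t *\<^sub>R F t) \<longleftrightarrow> integrable lborel ?G"
    by blast
  have "(\<integral>t. gauss_kernel e t *\<^sub>R F t \<partial>lborel) = \<bar>e\<bar> *\<^sub>R (\<integral>z. (1 / e) *\<^sub>R ?G z \<partial>lborel)"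
    using lborel_integral_real_affine[of e "\<lambda>t. gauss_kernel e t *\<^sub>R F t" 0] assms
    unfolding add_0_left eq by blast
  also have "\<dots> = (\<integral>z. ?G z \<partial>lborel)"
    using assms by (subst integral_scaleR_right) auto
  finally show "(\<integral>t. gauss_kernel e t *\<^sub>R F t \<partial>lborel) = (\<integral>z. ?G z \<partial>lborel)" .
qed

lemma integral_gaussian: "(\<integral>z. sqrt (2 * pi) * exp (- z\<^sup>2 / 2) \<partial>lborel) = 2 * pi"
proof -
  have "complex_of_real (\<integral>x. exp (- x\<^sup>2 / 2) \<partial>lborel) = sqrt (2 * pi)"
    using fourier_gaussian[of 0] by simp
  then have "(\<integral>x. exp (- x\<^sup>2 / 2) \<partial>lborel) = sqrt (2 * pi)"
    using of_real_eq_iff by blast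
  then show ?thesis
    by simp
qed

lemma integrable_gauss_kernel: "e > 0 \<Longrightarrow> integrable lborel (gauss_kernel e)"
  using gauss_kernel_substitution(1)[of e "\<lambda>_. 1::real"] integrable_gaussian by simp

lemma integral_gauss_kernel: "e > 0 \<Longrightarrow> (\<integral>t. gauss_kernel e t \<partial>lborel) = 2 * pi"
  using gauss_kernel_substitution(2)[of e "\<lambda>_. 1::real"] integral_gaussian by simp

text \<open>The linear scaling in \<open>e\<close> is the smallness that makes the antisymmetric
  part vanish in \<open>absD_symmetric\<close>.\<close>

lemma abs_moment_gauss_kernel:
  obtains c where "\<And>e. e > 0 \<Longrightarrow> integrable lborel (\<lambda>t. gauss_kernel e t * \<bar>t\<bar>)"
    "\<And>e. e > 0 \<Longrightarrow> (\<integral>t. gauss_kernel e t * \<bar>t\<bar> \<partial>lborel) = c * e"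
proof
  have int: "integrable lborel (\<lambda>z. sqrt (2 * pi) * exp (- z\<^sup>2 / 2) * \<bar>z\<bar>)"
  proof -
    have "integrable lborel (\<lambda>x. (2 * pi) * (std_normal_density x * \<bar>x\<bar>))"
      using integrable_std_normal_moment_abs[of 1] by simp
    then show ?thesis
      by (rule back_subst[of "integrable lborel"]) (auto simp: std_normal_density_def field_simps)
  qed
  fix e :: real
  assume e: "e > 0"
  have eq: "sqrt (2 * pi) * exp (- z\<^sup>2 / 2) * \<bar>e * z\<bar> = e * (sqrt (2 * pi) * exp (- z\<^sup>2 / 2) * \<bar>z\<bar>)" for z
    using e by (simp add: abs_mult)
  show "integrable lborel (\<lambda>t. gauss_kernel e t * \<bar>t\<bar>)"
    using gauss_kernel_substitution(1)[OF e, of "\<lambda>t. \<bar>t\<bar>"] int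
    unfolding real_scaleR_def eq by simp
  show "(\<integral>t. gauss_kernel e t * \<bar>t\<bar> \<partial>lborel) = (\<integral>z. sqrt (2 * pi) * exp (- z\<^sup>2 / 2) * \<bar>z\<bar> \<partial>lborel) * e"
    using gauss_kernel_substitution(2)[OF e, of "\<lambda>t. \<bar>t\<bar>"]
    unfolding real_scaleR_def eq by simp
qed

definition eps :: "nat \<Rightarrow> real" where
  "eps n = 1 / real (Suc n)"

lemma eps_pos: "eps n > 0"
  by (simp add: eps_def)

lemma eps_tendsto_0: "eps \<longlonglongrightarrow> 0"
  unfolding eps_def by (rule LIMSEQ_Suc) (rule lim_1_over_n)

text \<open>Insert a Gaussian cut-off and exchange the integrals, which turns it into an average of
  \<psi> against \<open>gauss_kernel\<close>. As the cut-off tends to 1, one side tends to the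
  inversion integral and the other, by continuity of \<psi>, to \<open>2 * pi\<close> times the
  value of \<psi> at \<xi>.\<close>

lemma fourier_inversion:
  fixes \<psi> :: "real \<Rightarrow> complex"
  assumes cont: "continuous_on UNIV \<psi>" and int: "integrable lborel \<psi>"
    and bd: "\<And>x. norm (\<psi> x) \<le> B" and int': "integrable lborel (fourier \<psi>)"
  shows "inv_fourier (fourier \<psi>) \<xi> = \<psi> \<xi>"
proof -
  have [measurable]: "\<psi> \<in> borel_measurable borel" "\<psi> \<in> borel_measurable lborel"
    using int by auto
  have reg: "(\<integral>x. (cis (x * \<xi>) * fourier \<psi> x) * complex_of_real (exp (- (eps n * x)\<^sup>2 / 2)) \<partial>lborel)
      = (\<integral>z. (sqrt (2 * pi) * exp (- z\<^sup>2 / 2)) *\<^sub>R \<psi> (\<xi> - eps n * z) \<partial>lborel)" (is "?L = ?R") for n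
  proof -
    let ?f = "\<lambda>x \<eta>. (cis (x * (\<xi> - \<eta>)) * complex_of_real (exp (- (eps n * x)\<^sup>2 / 2))) * \<psi> \<eta>"
    have "?L = (\<integral>x. (\<integral>\<eta>. ?f x \<eta> \<partial>lborel) \<partial>lborel)"
    proof (rule Bochner_Integration.integral_cong[OF refl])
      fix x
      let ?K = "cis (x * \<xi>) * complex_of_real (exp (- (eps n * x)\<^sup>2 / 2))"
      have "?f x \<eta> = ?K * (cis (- (\<eta> * x)) * \<psi> \<eta>)" for \<eta>
        using cis_mult[of "x * \<xi>" "- (\<eta> * x)"] by (simp add: right_diff_distrib mult_ac)
      then have "(\<integral>\<eta>. ?f x \<eta> \<partial>lborel) = ?K * fourier \<psi> x"
        by (simp only: fourier_eq integral_mult_right_zero)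
      then show "cis (x * \<xi>) * fourier \<psi> x * complex_of_real (exp (- (eps n * x)\<^sup>2 / 2)) = (\<integral>\<eta>. ?f x \<eta> \<partial>lborel)"
        by (simp add: mult_ac)
    qed
    also have "\<dots> = (\<integral>\<eta>. (\<integral>x. ?f x \<eta> \<partial>lborel) \<partial>lborel)"
      by (rule Fubini_dominated(1)[OF _ integrable_gaussian_scaled integrable_norm[OF int], of _ "eps n"])
         (use eps_pos[of n] in \<open>auto simp: norm_mult\<close>)
    also have "\<dots> = (\<integral>\<eta>. gauss_kernel (eps n) (\<xi> - \<eta>) *\<^sub>R \<psi> \<eta> \<partial>lborel)"
      by (simp only: integral_mult_left_zero fourier_gaussian_scaled[OF eps_pos] scaleR_conv_of_real)
    also have "\<dots> = (\<integral>t. gauss_kernel (eps n) t *\<^sub>R \<psi> (\<xi> - t) \<partial>lborel)"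
      using lborel_integral_real_affine[of "-1" "\<lambda>\<eta>. gauss_kernel (eps n) (\<xi> - \<eta>) *\<^sub>R \<psi> \<eta>" \<xi>] by simp
    also have "\<dots> = ?R"
      by (rule gauss_kernel_substitution(2)[OF eps_pos])
    finally show ?thesis .
  qed
  have "(\<lambda>n. \<integral>x. (cis (x * \<xi>) * fourier \<psi> x) * complex_of_real (exp (- (eps n * x)\<^sup>2 / 2)) \<partial>lborel)
      \<longlonglongrightarrow> (\<integral>x. (cis (x * \<xi>) * fourier \<psi> x) * complex_of_real (exp (- (0 * x)\<^sup>2 / 2)) \<partial>lborel)"
  proof (rule integral_dominated_convergence[OF _ _ integrable_norm[OF int']])
    show "AE x in lborel. (\<lambda>n. cis (x * \<xi>) * fourier \<psi> x * complex_of_real (exp (- (eps n * x)\<^sup>2 / 2)))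
        \<longlonglongrightarrow> cis (x * \<xi>) * fourier \<psi> x * complex_of_real (exp (- (0 * x)\<^sup>2 / 2))"
      by (intro AE_I2 tendsto_intros eps_tendsto_0) auto
    show "AE x in lborel. norm (cis (x * \<xi>) * fourier \<psi> x * complex_of_real (exp (- (eps n * x)\<^sup>2 / 2))) \<le> norm (fourier \<psi> x)" for n
      by (intro AE_I2) (auto simp: norm_mult intro!: mult_left_le)
  qed measurable
  moreover have "(\<lambda>n. \<integral>z. (sqrt (2 * pi) * exp (- z\<^sup>2 / 2)) *\<^sub>R \<psi> (\<xi> - eps n * z) \<partial>lborel)
      \<longlonglongrightarrow> (\<integral>z. (sqrt (2 * pi) * exp (- z\<^sup>2 / 2)) *\<^sub>R \<psi> \<xi> \<partial>lborel)"
  proof (rule integral_dominated_convergence[where w = "\<lambda>z. (sqrt (2 * pi) * B) * exp (- z\<^sup>2 / 2)"])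
    show "AE z in lborel. (\<lambda>n. (sqrt (2 * pi) * exp (- z\<^sup>2 / 2)) *\<^sub>R \<psi> (\<xi> - eps n * z)) \<longlonglongrightarrow> (sqrt (2 * pi) * exp (- z\<^sup>2 / 2)) *\<^sub>R \<psi> \<xi>"
    proof (rule AE_I2)
      fix z
      have "(\<lambda>n. \<xi> - eps n * z) \<longlonglongrightarrow> \<xi> - 0 * z"
        by (intro tendsto_intros eps_tendsto_0)
      then have "(\<lambda>n. \<psi> (\<xi> - eps n * z)) \<longlonglongrightarrow> \<psi> \<xi>"
        using cont by (intro continuous_on_tendsto_compose[OF cont]) auto
      then show "(\<lambda>n. (sqrt (2 * pi) * exp (- z\<^sup>2 / 2)) *\<^sub>R \<psi> (\<xi> - eps n * z)) \<longlonglongrightarrow> (sqrt (2 * pi) * exp (- z\<^sup>2 / 2)) *\<^sub>R \<psi> \<xi>"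
        by (intro tendsto_intros)
    qed
    show "AE z in lborel. norm ((sqrt (2 * pi) * exp (- z\<^sup>2 / 2)) *\<^sub>R \<psi> (\<xi> - eps n * z)) \<le> sqrt (2 * pi) * B * exp (- z\<^sup>2 / 2)" for n
      using bd[of "\<xi> - eps n * _"] by (intro AE_I2) (auto simp: mult_ac intro!: mult_left_mono)
    show "integrable lborel (\<lambda>z. sqrt (2 * pi) * B * exp (- z\<^sup>2 / 2))"
      by (intro integrable_mult_right integrable_gaussian)
  qed measurable
  ultimately have "(\<integral>x. cis (x * \<xi>) * fourier \<psi> x \<partial>lborel) = (\<integral>z. (sqrt (2 * pi) * exp (- z\<^sup>2 / 2)) *\<^sub>R \<psi> \<xi> \<partial>lborel)"
    unfolding reg using LIMSEQ_unique by fastforce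
  also have "\<dots> = (\<integral>z. sqrt (2 * pi) * exp (- z\<^sup>2 / 2) \<partial>lborel) *\<^sub>R \<psi> \<xi>"
    by (rule integral_scaleR_left) (use integrable_gaussian in auto)
  finally show ?thesis
    unfolding integral_gaussian by (simp add: inv_fourier_def scaleR_conv_of_real mult.commute[of \<xi>])
qed

section \<open>Test functions and the pairing in \<open>has_fourier\<close>\<close>

lemma test_fun_integrable:
  assumes "test_fun \<psi>"
  shows "integrable lborel \<psi>"
proof -
  obtain R where R: "R > 0" "\<And>x. \<bar>x\<bar> \<ge> R \<Longrightarrow> \<psi> x = 0"
    using test_fun_supportE[OF assms] by blast
  have "integrable lborel (\<lambda>x. indicator {-R..R} x *\<^sub>R \<psi> x)"
    using borel_integrable_atLeastAtMost'[of "-R" R \<psi>] assms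
    by (auto simp: set_integrable_def test_fun_iff smooth_continuous_on)
  moreover have "(\<lambda>x. indicator {-R..R} x *\<^sub>R \<psi> x) = \<psi>"
  proof
    fix x
    show "indicator {-R..R} x *\<^sub>R \<psi> x = \<psi> x"
      using R(2)[of x] by (cases "\<bar>x\<bar> \<ge> R") (auto simp: indicator_def)
  qed
  ultimately show ?thesis
    by simp
qed

lemma test_fun_bounded:
  assumes "test_fun \<psi>"
  obtains B where "\<And>x. \<bar>\<psi> x\<bar> \<le> B"
proof -
  obtain R where R: "R > 0" "\<And>x. \<bar>x\<bar> \<ge> R \<Longrightarrow> \<psi> x = 0"
    using test_fun_supportE[OF assms] by blast
  have "compact (\<psi> ` {-R..R})"
    using assms by (intro compact_continuous_image) (auto simp: test_fun_iff smooth_continuous_on)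
  then obtain B where B: "\<And>x. x \<in> {-R..R} \<Longrightarrow> \<bar>\<psi> x\<bar> \<le> B"
    using compact_imp_bounded[of "\<psi> ` {-R..R}"] by (force simp: bounded_iff)
  have "\<bar>\<psi> x\<bar> \<le> max 0 B" for x
  proof -
    consider "\<bar>x\<bar> \<ge> R" | "x \<in> {-R..R}"
      by fastforce
    then show ?thesis
      by cases (use B[of x] R(2)[of x] in auto)
  qed
  then show ?thesis
    using that by blast
qed

lemma has_vector_derivative_cis_linear:
  "((\<lambda>t. cis (c * t)) has_vector_derivative \<i> * c * cis (c * t)) (at t within S)"
proof -
  have "((\<lambda>t. cis (c * t)) has_derivative (\<lambda>h. (c * h) *\<^sub>R (\<i> * cis (c * t)))) (at t within S)"
    by (auto intro!: derivative_eq_intros)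
  then show ?thesis
    by (simp add: has_vector_derivative_def scaleR_conv_of_real mult_ac)
qed

lemma fourier_deriv:
  assumes "test_fun \<psi>"
  shows "fourier (\<lambda>\<xi>. complex_of_real (deriv \<psi> \<xi>)) x = \<i> * x * fourier (\<lambda>\<xi>. complex_of_real (\<psi> \<xi>)) x"
proof -
  note td = test_fun_deriv[OF assms]
  have sm: "smooth \<psi>" "smooth (deriv \<psi>)"
    using assms td by (auto simp: test_fun_iff)
  obtain R1 where R1: "R1 > 0" "\<And>x. \<bar>x\<bar> \<ge> R1 \<Longrightarrow> \<psi> x = 0"
    using test_fun_supportE[OF assms] by blast
  obtain R2 where R2: "R2 > 0" "\<And>x. \<bar>x\<bar> \<ge> R2 \<Longrightarrow> deriv \<psi> x = 0"
    using test_fun_supportE[OF td] by blast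
  define R where "R = max R1 R2"
  \<comment> \<open>Integration by parts: \<open>q\<close> is the derivative of
    \<open>cis (- x * \<xi>) * \<psi> \<xi>\<close>, so its integral over an interval reaching past
    both supports is a difference of zeros.\<close>
  define q where "q = (\<lambda>\<xi>. cis (- x * \<xi>) * complex_of_real (deriv \<psi> \<xi>) - \<i> * x * (cis (- x * \<xi>) * complex_of_real (\<psi> \<xi>)))"
  have "(\<integral>\<xi>. indicator {-R..R} \<xi> *\<^sub>R q \<xi> \<partial>lborel) = cis (- x * R) * complex_of_real (\<psi> R) - cis (- x * - R) * complex_of_real (\<psi> (- R))"
  proof (rule integral_FTC_atLeastAtMost)
    show "-R \<le> R"
      using R1(1) by (simp add: R_def)
    show "continuous_on {- R..R} q"
      unfolding q_def by (intro continuous_intros smooth_continuous_on sm)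
    fix \<xi>
    have "((\<lambda>\<xi>. complex_of_real (\<psi> \<xi>)) has_vector_derivative complex_of_real (deriv \<psi> \<xi>)) (at \<xi> within {-R..R})"
      using smooth_DERIV[OF sm(1), of \<xi>]
      by (intro has_vector_derivative_of_real)
         (simp add: has_real_derivative_iff_has_vector_derivative has_vector_derivative_at_within)
    from has_vector_derivative_mult[OF has_vector_derivative_cis_linear[of "-x" \<xi>] this]
    show "((\<lambda>\<xi>. cis (- x * \<xi>) * complex_of_real (\<psi> \<xi>)) has_vector_derivative q \<xi>) (at \<xi> within {-R..R})"
      by (simp add: q_def mult_ac)
  qed
  also have "\<dots> = 0"
    using R1 by (simp add: R_def)
  also have "(\<lambda>\<xi>. indicator {-R..R} \<xi> *\<^sub>R q \<xi>) = q"
  proof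
    fix \<xi>
    show "indicator {-R..R} \<xi> *\<^sub>R q \<xi> = q \<xi>"
      using R1(2)[of \<xi>] R2(2)[of \<xi>]
      by (cases "\<bar>\<xi>\<bar> \<ge> R") (auto simp: indicator_def q_def R_def)
  qed
  finally have "(\<integral>\<xi>. q \<xi> \<partial>lborel) = 0" .
  moreover have "(\<integral>\<xi>. q \<xi> \<partial>lborel) = (\<integral>\<xi>. cis (- x * \<xi>) * complex_of_real (deriv \<psi> \<xi>) \<partial>lborel)
      - \<i> * x * (\<integral>\<xi>. cis (- x * \<xi>) * complex_of_real (\<psi> \<xi>) \<partial>lborel)"
    unfolding q_def
    using integrable_of_real[OF test_fun_integrable[OF assms]] integrable_of_real[OF test_fun_integrable[OF td]]
    by (subst Bochner_Integration.integral_diff) (auto simp: integrable_cis_mult_iff(1)[of "-x", simplified])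
  ultimately show ?thesis
    by (simp add: fourier_eq mult.commute)
qed

text \<open>Two integrations by parts bound the transform by a multiple of
  \<open>1 / (1 + x^2)\<close>.\<close>

lemma test_fun_fourier_integrable:
  assumes "test_fun \<psi>"
  shows "integrable lborel (fourier (\<lambda>\<xi>. complex_of_real (\<psi> \<xi>)))"
proof -
  let ?\<psi>2 = "deriv (deriv \<psi>)"
  define C where "C = (\<integral>\<xi>. norm (complex_of_real (\<psi> \<xi>)) \<partial>lborel) + (\<integral>\<xi>. norm (complex_of_real (?\<psi>2 \<xi>)) \<partial>lborel)"
  have [measurable]: "\<psi> \<in> borel_measurable lborel"
    using test_fun_integrable[OF assms] by auto
  have bd: "norm (fourier (\<lambda>\<xi>. complex_of_real (\<psi> \<xi>)) x) \<le> C * (1 / (1 + x\<^sup>2))" for x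
  proof -
    let ?F = "fourier (\<lambda>\<xi>. complex_of_real (\<psi> \<xi>)) x"
    have "fourier (\<lambda>\<xi>. complex_of_real (?\<psi>2 \<xi>)) x = - (x\<^sup>2 * ?F)"
      using fourier_deriv[OF test_fun_deriv[OF assms], of x] fourier_deriv[OF assms, of x]
      by (simp add: power2_eq_square algebra_simps)
    then have "norm ?F + x\<^sup>2 * norm ?F = norm ?F + norm (fourier (\<lambda>\<xi>. complex_of_real (?\<psi>2 \<xi>)) x)"
      by (simp add: norm_mult norm_power)
    also have "\<dots> \<le> C"
      unfolding C_def by (intro add_mono norm_fourier_le)
    finally have "(1 + x\<^sup>2) * norm ?F \<le> C"
      by (simp add: algebra_simps)
    moreover have "1 + x\<^sup>2 > 0"
      by (simp add: add_pos_nonneg)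
    ultimately show ?thesis
      by (simp add: pos_le_divide_eq mult.commute)
  qed
  show ?thesis
  proof (rule Bochner_Integration.integrable_bound)
    show "integrable lborel (\<lambda>x::real. C * (1 / (1 + x\<^sup>2)))"
      by (intro integrable_mult_right integrable_inverse_one_plus_square)
    show "AE x in lborel. norm (fourier (\<lambda>\<xi>. complex_of_real (\<psi> \<xi>)) x) \<le> norm (C * (1 / (1 + x\<^sup>2)))"
      by (intro AE_I2) (metis bd order_trans real_norm_def abs_ge_self)
  qed measurable
qed

lemma test_fun_inversion:
  assumes "test_fun \<psi>"
  shows "inv_fourier (fourier (\<lambda>\<xi>. complex_of_real (\<psi> \<xi>))) \<xi> = complex_of_real (\<psi> \<xi>)"
proof -
  obtain B where "\<And>x. \<bar>\<psi> x\<bar> \<le> B"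
    using test_fun_bounded[OF assms] by blast
  then show ?thesis
    using assms by (intro fourier_inversion[of _ B] test_fun_fourier_integrable integrable_of_real test_fun_integrable)
      (auto intro!: continuous_intros smooth_continuous_on simp: test_fun_iff)
qed

lemma integrable_mult_bounded:
  fixes f g :: "real \<Rightarrow> complex"
  assumes "integrable lborel f" "g \<in> borel_measurable lborel" "\<And>x. norm (g x) \<le> B"
  shows "integrable lborel (\<lambda>x. g x * f x)"
proof (rule Bochner_Integration.integrable_bound)
  have [measurable]: "f \<in> borel_measurable lborel" "g \<in> borel_measurable lborel"
    using assms by auto
  show "integrable lborel (\<lambda>x. B * norm (f x))"
    using assms by auto
  show "AE x in lborel. norm (g x * f x) \<le> norm (B * norm (f x))"
    using assms(3) by (intro AE_I2) (auto simp: norm_mult intro!: mult_right_mono intro: order_trans[OF _ abs_ge_self])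
qed (use assms in measurable)

text \<open>Both sides are the same double integral. This is the bridge from inverse transforms of
  integrable functions to the weak pairing, and also the core of the regularised Parseval
  identity.\<close>

lemma inv_fourier_transpose:
  assumes g: "integrable lborel g" and h: "integrable lborel h"
  shows "(\<integral>x. inv_fourier g x * h x \<partial>lborel) = (\<integral>\<xi>. g \<xi> * inv_fourier h \<xi> \<partial>lborel)"
proof -
  have [measurable]: "g \<in> borel_measurable borel" "h \<in> borel_measurable borel"
    using g h by auto
  have "(\<integral>x. inv_fourier g x * h x \<partial>lborel)
      = (\<integral>x. (\<integral>\<xi>. cis (x * \<xi>) * g \<xi> * h x \<partial>lborel) \<partial>lborel) / (2 * pi)"
    by (simp add: inv_fourier_def)
  also have "(\<integral>x. (\<integral>\<xi>. cis (x * \<xi>) * g \<xi> * h x \<partial>lborel) \<partial>lborel)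
      = (\<integral>\<xi>. (\<integral>x. cis (x * \<xi>) * g \<xi> * h x \<partial>lborel) \<partial>lborel)"
    by (rule Fubini_dominated(1)[OF _ integrable_norm[OF h] integrable_norm[OF g]])
       (auto simp: norm_mult)
  also have "\<dots> = (\<integral>\<xi>. 2 * pi * (g \<xi> * inv_fourier h \<xi>) \<partial>lborel)"
  proof (rule Bochner_Integration.integral_cong[OF refl])
    fix \<xi>
    have "(\<lambda>x. cis (x * \<xi>) * g \<xi> * h x) = (\<lambda>x. g \<xi> * (cis (\<xi> * x) * h x))"
      by (simp add: mult_ac)
    then show "(\<integral>x. cis (x * \<xi>) * g \<xi> * h x \<partial>lborel) = 2 * pi * (g \<xi> * inv_fourier h \<xi>)"
      by (simp add: inv_fourier_def)
  qed
  finally show ?thesis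
    by (simp only: integral_mult_right_zero) simp
qed

text \<open>The pairing puts the transform on the test function, so transposition and the inversion
  formula for test functions suffice; \<open>g\<close> itself is never inverted.\<close>

theorem has_fourier_inv_fourier:
  assumes g: "integrable lborel g"
  shows "has_fourier (inv_fourier g) g"
  unfolding has_fourier_def
proof (intro conjI allI impI)
  have [measurable]: "g \<in> borel_measurable lborel" "g \<in> borel_measurable borel"
    using g by auto
  show "g \<in> borel_measurable lborel" "inv_fourier g \<in> borel_measurable lborel"
    by measurable
  show "set_integrable lborel {a..b} g" for a b
    using g by (auto simp: set_integrable_def intro: integrable_mult_indicator)
  fix \<psi>
  assume \<psi>: "test_fun \<psi>"
  let ?\<psi> = "\<lambda>\<xi>. complex_of_real (\<psi> \<xi>)"
  have [measurable]: "\<psi> \<in> borel_measurable lborel" "\<psi> \<in> borel_measurable borel"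
    using test_fun_integrable[OF \<psi>] by auto
  note F = test_fun_fourier_integrable[OF \<psi>]
  show "integrable lborel (\<lambda>x. inv_fourier g x * fourier ?\<psi> x)"
    by (rule integrable_mult_bounded[OF F _ norm_inv_fourier_le]) measurable
  obtain B where "\<And>x. \<bar>\<psi> x\<bar> \<le> B"
    using test_fun_bounded[OF \<psi>] by blast
  then show "integrable lborel (\<lambda>\<xi>. g \<xi> * ?\<psi> \<xi>)"
    using integrable_mult_bounded[OF g, of ?\<psi> B] by (simp add: mult.commute)
  show "(\<integral>x. inv_fourier g x * fourier ?\<psi> x \<partial>lborel) = (\<integral>\<xi>. g \<xi> * ?\<psi> \<xi> \<partial>lborel)"
    using inv_fourier_transpose[OF g F] by (simp add: test_fun_inversion[OF \<psi>])
qed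

subsection \<open>Injectivity of the Fourier transform\<close>

text \<open>The normalised positive and negative parts are probability densities with the same characteristic function.\<close>

lemma fourier_zero_imp_AE_zero_real:
  fixes D :: "real \<Rightarrow> real"
  assumes D: "integrable lborel D"
    and z: "\<And>t. (\<integral>x. cis (t * x) * complex_of_real (D x) \<partial>lborel) = 0"
  shows "AE x in lborel. D x = 0"
proof -
  define p where "p = (\<lambda>x. max 0 (D x))"
  define q where "q = (\<lambda>x. max 0 (- D x))"
  have Dpq: "D x = p x - q x" for x
    by (auto simp: p_def q_def)
  have p: "integrable lborel p" "\<And>x. p x \<ge> 0" and q: "integrable lborel q" "\<And>x. q x \<ge> 0"
    using D by (auto simp: p_def q_def)
  have [measurable]: "p \<in> borel_measurable borel" "q \<in> borel_measurable borel"
    using p q by auto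
  have eq: "(\<integral>x. cis (t * x) * complex_of_real (p x) \<partial>lborel) = (\<integral>x. cis (t * x) * complex_of_real (q x) \<partial>lborel)" for t
  proof -
    have "(\<integral>x. cis (t * x) * complex_of_real (D x) \<partial>lborel)
        = (\<integral>x. cis (t * x) * complex_of_real (p x) - cis (t * x) * complex_of_real (q x) \<partial>lborel)"
      by (simp add: Dpq right_diff_distrib)
    also have "\<dots> = (\<integral>x. cis (t * x) * complex_of_real (p x) \<partial>lborel) - (\<integral>x. cis (t * x) * complex_of_real (q x) \<partial>lborel)"
      using p q by (intro Bochner_Integration.integral_diff) (auto simp: integrable_of_real)
    finally show ?thesis
      using z by simp
  qed
  \<comment> \<open>The common total mass: the two transforms agree at 0.\<close>
  define m where "m = (\<integral>x. p x \<partial>lborel)"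
  have mq: "m = (\<integral>x. q x \<partial>lborel)"
    using eq[of 0] by (simp add: m_def)
  show ?thesis
  \<comment> \<open>Normalising to probability densities divides by \<open>m\<close>; if there is no
    mass, both parts vanish almost everywhere.\<close>
  proof (cases "m = 0")
    case True
    then have "AE x in lborel. p x = 0"
      using p by (subst (asm) m_def, subst (asm) integral_nonneg_eq_0_iff_AE) auto
    moreover have "AE x in lborel. q x = 0"
      using q mq True by (subst (asm) mq, subst (asm) integral_nonneg_eq_0_iff_AE) auto
    ultimately show ?thesis
      by eventually_elim (simp add: Dpq)
  next
    case False
    then have m: "m > 0"
      using p by (simp add: m_def less_le integral_nonneg)
    have dist: "real_distribution (density lborel (\<lambda>x. ennreal (r x / m)))"
      and char: "char (density lborel (\<lambda>x. ennreal (r x / m))) t = (\<integral>x. cis (t * x) * complex_of_real (r x) \<partial>lborel) / m"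
      if r: "integrable lborel r" "\<And>x. r x \<ge> 0" "m = (\<integral>x. r x \<partial>lborel)" for r t
    proof -
      have [measurable]: "r \<in> borel_measurable borel"
        using r by auto
      have "emeasure (density lborel (\<lambda>x. ennreal (r x / m))) UNIV = (\<integral>\<^sup>+x. ennreal (r x / m) \<partial>lborel)"
        by (simp add: emeasure_density)
      also have "\<dots> = ennreal (\<integral>x. r x / m \<partial>lborel)"
        using r m by (intro nn_integral_eq_integral) auto
      also have "\<dots> = 1"
        using r m by simp
      finally have "prob_space (density lborel (\<lambda>x. ennreal (r x / m)))"
        by (intro prob_spaceI) simp
      then show "real_distribution (density lborel (\<lambda>x. ennreal (r x / m)))"
        by (auto simp: real_distribution_def real_distribution_axioms_def)
      have "char (density lborel (\<lambda>x. ennreal (r x / m))) t = (\<integral>x. (r x / m) *\<^sub>R iexp (t * x) \<partial>lborel)"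
        unfolding char_def using r m by (subst integral_density) auto
      also have "\<dots> = (\<integral>x. cis (t * x) * complex_of_real (r x) / m \<partial>lborel)"
        by (simp add: cis_conv_exp scaleR_conv_of_real mult.commute)
      finally show "char (density lborel (\<lambda>x. ennreal (r x / m))) t = (\<integral>x. cis (t * x) * complex_of_real (r x) \<partial>lborel) / m"
        by simp
    qed
    have "density lborel (\<lambda>x. ennreal (p x / m)) = density lborel (\<lambda>x. ennreal (q x / m))"
      by (intro Levy_uniqueness dist[OF p m_def] dist[OF q mq] ext) (simp only: char[OF p m_def] char[OF q mq] eq)
    then have "AE x in lborel. ennreal (p x / m) = ennreal (q x / m)"
      by (intro sigma_finite_measure.density_unique[OF sigma_finite_lborel]) auto
    then show ?thesis
      by eventually_elim (use m p q in \<open>simp add: Dpq\<close>)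
  qed
qed

text \<open>Reduction to real functions: the transform of \<open>cnj D\<close> is the reflected
  conjugate of that of \<open>D\<close> and vanishes too, hence so do the transforms of the real and
  imaginary parts.\<close>

theorem fourier_zero_imp_AE_zero:
  assumes D: "integrable lborel D" and z: "\<And>t. fourier D t = 0"
  shows "AE x in lborel. D x = 0"
proof -
  have z1: "(\<integral>x. cis (t * x) * D x \<partial>lborel) = 0" for t
    using z[of "- t"] by (simp add: fourier_eq mult.commute)
  have z2: "(\<integral>x. cis (t * x) * cnj (D x) \<partial>lborel) = 0" for t
  proof -
    have "(\<integral>x. cis (t * x) * cnj (D x) \<partial>lborel) = (\<integral>x. cnj (cis (- t * x) * D x) \<partial>lborel)"
      by (intro Bochner_Integration.integral_cong) (simp_all add: cis_cnj)
    also have "\<dots> = cnj (\<integral>x. cis (- t * x) * D x \<partial>lborel)"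
      by (rule Bochner_Integration.integral_cnj)
    finally show ?thesis
      by (simp only: z1) simp
  qed
  have intD: "integrable lborel (\<lambda>x. cis (t * x) * D x)" "integrable lborel (\<lambda>x. cis (t * x) * cnj (D x))" for t
    using D by auto
  have "AE x in lborel. Re (D x) = 0"
  proof (rule fourier_zero_imp_AE_zero_real)
    fix t
    have "cis (t * x) * complex_of_real (Re (D x)) = (cis (t * x) * D x + cis (t * x) * cnj (D x)) / 2" for x
      using complex_add_cnj[of "D x"] by (simp flip: distrib_left)
    then have "(\<integral>x. cis (t * x) * complex_of_real (Re (D x)) \<partial>lborel) = (\<integral>x. (cis (t * x) * D x + cis (t * x) * cnj (D x)) / 2 \<partial>lborel)"
      by (simp only:)
    also have "\<dots> = 0"
      using intD[of t] by (simp add: z1 z2)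
    finally show "(\<integral>x. cis (t * x) * complex_of_real (Re (D x)) \<partial>lborel) = 0" .
  qed (use D in auto)
  moreover have "AE x in lborel. Im (D x) = 0"
  proof (rule fourier_zero_imp_AE_zero_real)
    fix t
    have "cis (t * x) * complex_of_real (Im (D x)) = (cis (t * x) * D x - cis (t * x) * cnj (D x)) / (2 * \<i>)" for x
      by (subst right_diff_distrib[symmetric], subst complex_diff_cnj) (simp add: complex_eq_iff)
    then have "(\<integral>x. cis (t * x) * complex_of_real (Im (D x)) \<partial>lborel) = (\<integral>x. (cis (t * x) * D x - cis (t * x) * cnj (D x)) / (2 * \<i>) \<partial>lborel)"
      by (simp only:)
    also have "\<dots> = 0"
      using intD[of t] by (simp add: z1 z2)
    finally show "(\<integral>x. cis (t * x) * complex_of_real (Im (D x)) \<partial>lborel) = 0" .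
  qed (use D in auto)
  ultimately show ?thesis
    by eventually_elim (simp add: complex_eq_iff)
qed

text \<open>The test functions \<open>\<psi> cos\<close> and \<open>\<psi> sin\<close> show that the integrable function \<open>(g1 - g2) \<psi>\<close> has vanishing
  Fourier transform.\<close>

lemma has_fourier_unique:
  assumes g1: "has_fourier f g1" and g2: "has_fourier f g2"
  shows "AE \<xi> in lborel. g1 \<xi> = g2 \<xi>"
proof -
  have pair: "integrable lborel (\<lambda>\<xi>. (g1 \<xi> - g2 \<xi>) * complex_of_real (\<psi> \<xi>))"
    "(\<integral>\<xi>. (g1 \<xi> - g2 \<xi>) * complex_of_real (\<psi> \<xi>) \<partial>lborel) = 0" if "test_fun \<psi>" for \<psi>
  proof -
    have i: "integrable lborel (\<lambda>\<xi>. g1 \<xi> * complex_of_real (\<psi> \<xi>))" "integrable lborel (\<lambda>\<xi>. g2 \<xi> * complex_of_real (\<psi> \<xi>))"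
      and e: "(\<integral>\<xi>. g1 \<xi> * complex_of_real (\<psi> \<xi>) \<partial>lborel) = (\<integral>\<xi>. g2 \<xi> * complex_of_real (\<psi> \<xi>) \<partial>lborel)"
      using g1 g2 that unfolding has_fourier_def by auto
    show "integrable lborel (\<lambda>\<xi>. (g1 \<xi> - g2 \<xi>) * complex_of_real (\<psi> \<xi>))"
      using i by (simp add: left_diff_distrib)
    show "(\<integral>\<xi>. (g1 \<xi> - g2 \<xi>) * complex_of_real (\<psi> \<xi>) \<partial>lborel) = 0"
      using i e by (simp add: left_diff_distrib)
  qed
  have "AE \<xi> in lborel. (g1 \<xi> - g2 \<xi>) * complex_of_real (bump (real n) \<xi>) = 0" for n
  proof (rule fourier_zero_imp_AE_zero)
    note b = test_fun_bump[of "real n"]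
    show "integrable lborel (\<lambda>\<xi>. (g1 \<xi> - g2 \<xi>) * complex_of_real (bump (real n) \<xi>))"
      by (rule pair(1)[OF b])
    fix t
    have 1: "test_fun (\<lambda>\<xi>. bump (real n) \<xi> * cos (t * \<xi> + 0))"
      and 2: "test_fun (\<lambda>\<xi>. bump (real n) \<xi> * cos (t * \<xi> + pi / 2))"
      by (intro test_fun_mult_smooth b smooth_cos_affine)+
    \<comment> \<open>Since \<open>cos (\<theta> + pi / 2) = - sin \<theta>\<close>, this splits the
      exponential into two real test functions, the only kind that \<open>has_fourier\<close>
      admits.\<close>
    have "cis (- (\<xi> * t)) * ((g1 \<xi> - g2 \<xi>) * complex_of_real (bump (real n) \<xi>))
      = (g1 \<xi> - g2 \<xi>) * complex_of_real (bump (real n) \<xi> * cos (t * \<xi> + 0))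
        + \<i> * ((g1 \<xi> - g2 \<xi>) * complex_of_real (bump (real n) \<xi> * cos (t * \<xi> + pi / 2)))" for \<xi>
      by (simp add: complex_eq_iff cos_add mult.commute[of t] algebra_simps)
    then show "fourier (\<lambda>\<xi>. (g1 \<xi> - g2 \<xi>) * complex_of_real (bump (real n) \<xi>)) t = 0"
      unfolding fourier_eq
      using pair[OF 1] pair[OF 2] by (simp del: of_real_mult)
  qed
  then have "AE \<xi> in lborel. \<forall>n. (g1 \<xi> - g2 \<xi>) * complex_of_real (bump (real n) \<xi>) = 0"
    unfolding AE_all_countable by blast
  then show ?thesis
  proof eventually_elim
    fix \<xi>
    assume *: "\<forall>n. (g1 \<xi> - g2 \<xi>) * complex_of_real (bump (real n) \<xi>) = 0"
    obtain n where "\<bar>\<xi>\<bar> < real n"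
      using reals_Archimedean2 by blast
    then have "bump (real n) \<xi> > 0"
      by (rule bump_pos)
    then show "g1 \<xi> = g2 \<xi>"
      using * by (metis less_irrefl mult_eq_0_iff of_real_eq_0_iff right_minus_eq)
  qed
qed

lemma fourier_translate:
  "fourier (\<lambda>\<xi>. f (\<xi> - a)) x = cis (- (a * x)) * fourier f x"
proof -
  have "fourier (\<lambda>\<xi>. f (\<xi> - a)) x = (\<integral>\<xi>. cis (- ((a + \<xi>) * x)) * f \<xi> \<partial>lborel)"
    unfolding fourier_eq
    using lborel_integral_real_affine[of 1 "\<lambda>\<xi>. cis (- (\<xi> * x)) * f (\<xi> - a)" a] by simp
  also have "(\<lambda>\<xi>. cis (- ((a + \<xi>) * x)) * f \<xi>) = (\<lambda>\<xi>. cis (- (a * x)) * (cis (- (\<xi> * x)) * f \<xi>))"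
    by (simp add: cis_mult distrib_right add.commute flip: mult.assoc)
  finally show ?thesis
    by (simp add: fourier_eq)
qed

text \<open>Within a quarter period the cosine is positive on the support of the bump, so the real
  part of the transform is the integral of a nonnegative function that is positive on an
  interval.\<close>

lemma fourier_bump_nonzero:
  assumes "r > 0" "\<bar>x\<bar> * r < pi / 2"
  shows "fourier (\<lambda>\<xi>. complex_of_real (bump r \<xi>)) x \<noteq> 0"
proof
  assume 0: "fourier (\<lambda>\<xi>. complex_of_real (bump r \<xi>)) x = 0"
  have int: "integrable lborel (\<lambda>\<xi>. cis (- (\<xi> * x)) * complex_of_real (bump r \<xi>))"
    using integrable_cis_mult_iff(2)[of "-x"] integrable_of_real[OF test_fun_integrable[OF test_fun_bump]] by simp
  have Re: "Re (cis (- (\<xi> * x)) * complex_of_real (bump r \<xi>)) = cos (\<xi> * x) * bump r \<xi>" for \<xi>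
    by simp
  have nonneg: "0 \<le> cos (\<xi> * x) * bump r \<xi>" and pos: "\<bar>\<xi>\<bar> < r \<Longrightarrow> 0 < cos (\<xi> * x) * bump r \<xi>" for \<xi>
  proof -
    have cos: "cos (\<xi> * x) > 0" if "\<bar>\<xi>\<bar> < r"
    proof -
      have "\<bar>\<xi> * x\<bar> \<le> r * \<bar>x\<bar>"
        using that unfolding abs_mult by (intro mult_right_mono) auto
      then show ?thesis
        using assms by (intro cos_gt_zero_pi) (auto simp: mult.commute)
    qed
    then show pos: "\<bar>\<xi>\<bar> < r \<Longrightarrow> 0 < cos (\<xi> * x) * bump r \<xi>"
      using bump_pos by (simp add: zero_less_mult_iff)
    then show "0 \<le> cos (\<xi> * x) * bump r \<xi>"
      using bump_eq_0[of r \<xi>] by (cases "\<bar>\<xi>\<bar> < r") (auto intro: less_imp_le)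
  qed
  have "(\<integral>\<xi>. cos (\<xi> * x) * bump r \<xi> \<partial>lborel) = Re (\<integral>\<xi>. cis (- (\<xi> * x)) * complex_of_real (bump r \<xi>) \<partial>lborel)"
    unfolding Re[symmetric] by (rule integral_Re[OF int])
  also have "\<dots> = 0"
    using 0 by (simp add: fourier_eq)
  finally have "AE \<xi> in lborel. cos (\<xi> * x) * bump r \<xi> = 0"
    using integrable_Re[OF int] nonneg unfolding Re
    by (subst (asm) integral_nonneg_eq_0_iff_AE) auto
  then have "AE \<xi> in lborel. \<xi> \<notin> {-r<..<r}"
  proof eventually_elim
    fix \<xi>
    assume "cos (\<xi> * x) * bump r \<xi> = 0"
    then show "\<xi> \<notin> {-r<..<r}"
      using pos[of \<xi>] by (auto simp: abs_less_iff)
  qed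
  then have "emeasure lborel {-r<..<r} = 0"
    by (subst (asm) AE_iff_measurable[of "{-r<..<r}"]) auto
  then show False
    using assms by simp
qed

text \<open>Translating \<open>\<psi>\<close> modulates its transform, so \<open>(f1 - f2)\<close> times the transform of \<open>\<psi>\<close> has vanishing Fourier
  transform; the latter does not vanish near \<open>0\<close>, and on arbitrarily large intervals for narrow bumps.\<close>

lemma has_fourier_determines_AE:
  assumes f1: "has_fourier f1 g" and f2: "has_fourier f2 g"
  shows "AE x in lborel. f1 x = f2 x"
proof -
  let ?F = "\<lambda>\<psi>. fourier (\<lambda>\<xi>. complex_of_real (\<psi> \<xi>))"
  have pair: "integrable lborel (\<lambda>x. (f1 x - f2 x) * ?F \<psi> x)"
    "(\<integral>x. (f1 x - f2 x) * ?F \<psi> x \<partial>lborel) = 0" if "test_fun \<psi>" for \<psi>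
  proof -
    have i: "integrable lborel (\<lambda>x. f1 x * ?F \<psi> x)" "integrable lborel (\<lambda>x. f2 x * ?F \<psi> x)"
      and e: "(\<integral>x. f1 x * ?F \<psi> x \<partial>lborel) = (\<integral>x. f2 x * ?F \<psi> x \<partial>lborel)"
      using f1 f2 that unfolding has_fourier_def by auto
    show "integrable lborel (\<lambda>x. (f1 x - f2 x) * ?F \<psi> x)"
      using i by (simp add: left_diff_distrib)
    show "(\<integral>x. (f1 x - f2 x) * ?F \<psi> x \<partial>lborel) = 0"
      using i e by (simp add: left_diff_distrib)
  qed
  have "AE x in lborel. (f1 x - f2 x) * ?F (bump (1 / real (Suc n))) x = 0" for n
  proof (rule fourier_zero_imp_AE_zero)
    note b = test_fun_bump[of "1 / real (Suc n)"]
    show "integrable lborel (\<lambda>x. (f1 x - f2 x) * ?F (bump (1 / real (Suc n))) x)"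
      by (rule pair(1)[OF b])
    fix t
    have "(\<lambda>x. cis (- (x * t)) * ((f1 x - f2 x) * ?F (bump (1 / real (Suc n))) x))
        = (\<lambda>x. (f1 x - f2 x) * ?F (\<lambda>\<xi>. bump (1 / real (Suc n)) (\<xi> - t)) x)"
      using fourier_translate[of "\<lambda>\<xi>. complex_of_real (bump (1 / real (Suc n)) \<xi>)" t]
      by (simp add: mult_ac)
    then show "fourier (\<lambda>x. (f1 x - f2 x) * ?F (bump (1 / real (Suc n))) x) t = 0"
      unfolding fourier_eq[where \<xi> = t] using pair(2)[OF test_fun_translate[OF b, of t]] by simp
  qed
  then have "AE x in lborel. \<forall>n. (f1 x - f2 x) * ?F (bump (1 / real (Suc n))) x = 0"
    unfolding AE_all_countable by blast
  then show ?thesis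
  proof eventually_elim
    fix x
    assume *: "\<forall>n. (f1 x - f2 x) * ?F (bump (1 / real (Suc n))) x = 0"
    obtain n where n: "\<bar>x\<bar> < real n"
      using reals_Archimedean2 by blast
    have "\<bar>x\<bar> * (1 / real (Suc n)) < 1"
      using n by (simp add: divide_simps)
    then have "?F (bump (1 / real (Suc n))) x \<noteq> 0"
      using pi_gt3 by (intro fourier_bump_nonzero) (simp, linarith)
    then show "f1 x = f2 x"
      using * by (metis mult_eq_0_iff right_minus_eq)
  qed
qed

lemma has_fourier_diff:
  assumes "has_fourier f1 g1" "has_fourier f2 g2"
  shows "has_fourier (\<lambda>x. f1 x - f2 x) (\<lambda>\<xi>. g1 \<xi> - g2 \<xi>)"
  using assms unfolding has_fourier_def
  by (auto simp: left_diff_distrib)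

lemma has_fourier_cong_AE:
  assumes f: "has_fourier f g" and "AE \<xi> in lborel. g \<xi> = g' \<xi>" and [measurable]: "g' \<in> borel_measurable lborel"
  shows "has_fourier f g'"
proof -
  have [measurable]: "g \<in> borel_measurable lborel"
    using f by (simp add: has_fourier_def)
  have 1: "integrable lborel (\<lambda>\<xi>. g' \<xi> * complex_of_real (\<psi> \<xi>)) \<longleftrightarrow> integrable lborel (\<lambda>\<xi>. g \<xi> * complex_of_real (\<psi> \<xi>))"
    "(\<integral>\<xi>. g' \<xi> * complex_of_real (\<psi> \<xi>) \<partial>lborel) = (\<integral>\<xi>. g \<xi> * complex_of_real (\<psi> \<xi>) \<partial>lborel)"
    if "test_fun \<psi>" for \<psi>
  proof -
    have [measurable]: "\<psi> \<in> borel_measurable lborel"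
      using test_fun_integrable[OF that] by auto
    have ae: "AE \<xi> in lborel. g' \<xi> * complex_of_real (\<psi> \<xi>) = g \<xi> * complex_of_real (\<psi> \<xi>)"
      using assms(2) by eventually_elim simp
    show "integrable lborel (\<lambda>\<xi>. g' \<xi> * complex_of_real (\<psi> \<xi>)) \<longleftrightarrow> integrable lborel (\<lambda>\<xi>. g \<xi> * complex_of_real (\<psi> \<xi>))"
      by (rule integrable_cong_AE[OF _ _ ae]) measurable
    show "(\<integral>\<xi>. g' \<xi> * complex_of_real (\<psi> \<xi>) \<partial>lborel) = (\<integral>\<xi>. g \<xi> * complex_of_real (\<psi> \<xi>) \<partial>lborel)"
      by (rule integral_cong_AE[OF _ _ ae]) measurable
  qed
  have 2: "set_integrable lborel {a..b} g'" if "set_integrable lborel {a..b} g" for a b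
  proof -
    have ae: "AE \<xi> in lborel. indicator {a..b} \<xi> *\<^sub>R g \<xi> = indicator {a..b} \<xi> *\<^sub>R g' \<xi>"
      using assms(2) by eventually_elim simp
    have m: "(\<lambda>\<xi>. indicator {a..b} \<xi> *\<^sub>R g \<xi>) \<in> borel_measurable lborel" "(\<lambda>\<xi>. indicator {a..b} \<xi> *\<^sub>R g' \<xi>) \<in> borel_measurable lborel"
      by measurable
    show ?thesis
      using that integrable_cong_AE[OF m ae] by (simp add: set_integrable_def)
  qed
  show ?thesis
    using f 1 2 unfolding has_fourier_def by auto
qed

subsection \<open>Plancherel-type estimates\<close>

lemma borel_measurable_cnj [measurable]:
  "f \<in> borel_measurable M \<Longrightarrow> (\<lambda>x. cnj (f x)) \<in> borel_measurable M"
  by (rule measurable_compose[of f M borel]) (auto intro!: borel_measurable_continuous_onI continuous_intros)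

lemma nn_integral_real_reflect:
  assumes [measurable]: "f \<in> borel_measurable borel"
  shows "(\<integral>\<^sup>+x. f (a - x) \<partial>lborel) = (\<integral>\<^sup>+x. f x \<partial>(lborel :: real measure))"
  using nn_integral_real_affine[of f "-1" a] by simp

text \<open>Schur's test: \<open>\<bar>a x\<bar> * \<bar>b y\<bar> <= (a x)^2 + (b y)^2\<close>
  separates the variables, and integrating out the other variable leaves the mass of
  \<open>k\<close>. Nonnegative integrals allow the exchange of integrals before anything is known
  to be finite.\<close>

lemma Schur_nn_bound:
  fixes a b k :: "real \<Rightarrow> real"
  assumes a: "integrable lborel (\<lambda>x. (a x)\<^sup>2)" and b: "integrable lborel (\<lambda>x. (b x)\<^sup>2)"
    and [measurable]: "a \<in> borel_measurable borel" "b \<in> borel_measurable borel"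
    and k: "integrable lborel k" "\<And>t. k t \<ge> 0" "\<And>t. k (- t) = k t"
  shows "(\<integral>\<^sup>+x. \<integral>\<^sup>+y. ennreal (\<bar>a x\<bar> * \<bar>b y\<bar> * k (x - y)) \<partial>lborel \<partial>lborel)
    \<le> ennreal ((\<integral>t. k t \<partial>lborel) * ((\<integral>x. (a x)\<^sup>2 \<partial>lborel) + (\<integral>x. (b x)\<^sup>2 \<partial>lborel)))"
proof -
  have [measurable]: "k \<in> borel_measurable borel"
    using k by auto
  have K: "(\<integral>\<^sup>+y. ennreal (k (x - y)) \<partial>lborel) = ennreal (\<integral>t. k t \<partial>lborel)" for x
    using nn_integral_real_reflect[of "\<lambda>t. ennreal (k t)" x] k by (simp add: nn_integral_eq_integral)
  have K': "(\<integral>\<^sup>+x. ennreal (k (x - y)) \<partial>lborel) = ennreal (\<integral>t. k t \<partial>lborel)" for y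
  proof -
    have "k (x - y) = k (y - x)" for x
      using k(3)[of "x - y"] by simp
    then show ?thesis
      using K by simp
  qed
  have A: "(\<integral>\<^sup>+x. ennreal ((c x)\<^sup>2) * ennreal (\<integral>t. k t \<partial>lborel) \<partial>lborel) = ennreal ((\<integral>t. k t \<partial>lborel) * (\<integral>x. (c x)\<^sup>2 \<partial>lborel))"
    if "integrable lborel (\<lambda>x. (c x)\<^sup>2)" and [measurable]: "c \<in> borel_measurable borel" for c
    using that k(2) by (subst nn_integral_multc) (auto simp: nn_integral_eq_integral integral_nonneg mult.commute simp flip: ennreal_mult')
  have "(\<integral>\<^sup>+x. \<integral>\<^sup>+y. ennreal (\<bar>a x\<bar> * \<bar>b y\<bar> * k (x - y)) \<partial>lborel \<partial>lborel)
    \<le> (\<integral>\<^sup>+x. \<integral>\<^sup>+y. ennreal ((a x)\<^sup>2) * ennreal (k (x - y)) + ennreal ((b y)\<^sup>2) * ennreal (k (x - y)) \<partial>lborel \<partial>lborel)"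
  proof (intro nn_integral_mono)
    fix x y
    have "2 * (\<bar>a x\<bar> * \<bar>b y\<bar>) \<le> (a x)\<^sup>2 + (b y)\<^sup>2"
      using sum_squares_bound[of "\<bar>a x\<bar>" "\<bar>b y\<bar>"] by simp
    then have "\<bar>a x\<bar> * \<bar>b y\<bar> \<le> (a x)\<^sup>2 + (b y)\<^sup>2"
      using mult_nonneg_nonneg[of "\<bar>a x\<bar>" "\<bar>b y\<bar>"] by linarith
    then have "\<bar>a x\<bar> * \<bar>b y\<bar> * k (x - y) \<le> (a x)\<^sup>2 * k (x - y) + (b y)\<^sup>2 * k (x - y)"
      using k(2) by (metis mult_right_mono distrib_right)
    then show "ennreal (\<bar>a x\<bar> * \<bar>b y\<bar> * k (x - y)) \<le> ennreal ((a x)\<^sup>2) * ennreal (k (x - y)) + ennreal ((b y)\<^sup>2) * ennreal (k (x - y))"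
      using k(2) by (simp flip: ennreal_mult ennreal_plus)
  qed
  also have "\<dots> = (\<integral>\<^sup>+x. \<integral>\<^sup>+y. ennreal ((a x)\<^sup>2) * ennreal (k (x - y)) \<partial>lborel \<partial>lborel)
      + (\<integral>\<^sup>+x. \<integral>\<^sup>+y. ennreal ((b y)\<^sup>2) * ennreal (k (x - y)) \<partial>lborel \<partial>lborel)"
    by (simp add: nn_integral_add)
  also have "(\<integral>\<^sup>+x. \<integral>\<^sup>+y. ennreal ((b y)\<^sup>2) * ennreal (k (x - y)) \<partial>lborel \<partial>lborel)
      = (\<integral>\<^sup>+y. \<integral>\<^sup>+x. ennreal ((b y)\<^sup>2) * ennreal (k (x - y)) \<partial>lborel \<partial>lborel)"
    by (rule lborel_pair.Fubini'[symmetric]) measurable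
  finally show ?thesis
    using A[OF a] A[OF b] k(2) by (simp add: nn_integral_cmult K K' distrib_left integral_nonneg)
qed

lemma Schur_bound:
  fixes F :: "real \<Rightarrow> real \<Rightarrow> complex" and a b k :: "real \<Rightarrow> real"
  assumes a: "integrable lborel (\<lambda>x. (a x)\<^sup>2)" and b: "integrable lborel (\<lambda>x. (b x)\<^sup>2)"
    and am: "a \<in> borel_measurable borel" and bm: "b \<in> borel_measurable borel"
    and k: "integrable lborel k" "\<And>t. k t \<ge> 0" "\<And>t. k (- t) = k t"
    and bd: "\<And>x y. norm (F x y) \<le> \<bar>a x\<bar> * \<bar>b y\<bar> * k (x - y)"
  shows "norm (\<integral>x. (\<integral>y. F x y \<partial>lborel) \<partial>lborel)
    \<le> (\<integral>t. k t \<partial>lborel) * ((\<integral>x. (a x)\<^sup>2 \<partial>lborel) + (\<integral>x. (b x)\<^sup>2 \<partial>lborel))"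
proof -
  \<comment> \<open>For a non-integrable \<open>G\<close> the Bochner integral is 0 by convention,
    so the bound still holds.\<close>
  have norm_le: "ennreal (norm (\<integral>y. G y \<partial>lborel)) \<le> (\<integral>\<^sup>+y. ennreal (norm (G y)) \<partial>lborel)" for G :: "real \<Rightarrow> complex"
    by (cases "integrable lborel G") (auto simp: integral_norm_bound_ennreal not_integrable_integral_eq)
  have "ennreal (norm (\<integral>x. (\<integral>y. F x y \<partial>lborel) \<partial>lborel)) \<le> (\<integral>\<^sup>+x. ennreal (norm (\<integral>y. F x y \<partial>lborel)) \<partial>lborel)"
    by (rule norm_le)
  also have "\<dots> \<le> (\<integral>\<^sup>+x. \<integral>\<^sup>+y. ennreal (norm (F x y)) \<partial>lborel \<partial>lborel)"
    by (intro nn_integral_mono norm_le)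
  also have "\<dots> \<le> (\<integral>\<^sup>+x. \<integral>\<^sup>+y. ennreal (\<bar>a x\<bar> * \<bar>b y\<bar> * k (x - y)) \<partial>lborel \<partial>lborel)"
    by (intro nn_integral_mono ennreal_leI bd)
  also have "\<dots> \<le> ennreal ((\<integral>t. k t \<partial>lborel) * ((\<integral>x. (a x)\<^sup>2 \<partial>lborel) + (\<integral>x. (b x)\<^sup>2 \<partial>lborel)))"
    by (rule Schur_nn_bound[OF a b am bm k])
  finally show ?thesis
    using k(2) by (subst (asm) ennreal_le_iff) (auto intro!: mult_nonneg_nonneg add_nonneg_nonneg integral_nonneg)
qed

text \<open>For merely integrable \<open>g1\<close> and \<open>g2\<close> the inverse transforms are
  only known to be bounded; the Gaussian makes their product integrable, at the price of smearing
  the diagonal pairing with \<open>gauss_kernel\<close>. The limit in \<open>e\<close> is left to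
  the applications.\<close>

lemma Parseval_regularized:
  assumes g1: "integrable lborel g1" and g2: "integrable lborel g2" and e: "e > 0"
  shows "(\<integral>x. inv_fourier g1 x * cnj (inv_fourier g2 x) * complex_of_real (exp (- (e * x)\<^sup>2 / 2)) \<partial>lborel)
    = (\<integral>\<xi>. (\<integral>\<eta>. g1 \<xi> * cnj (g2 \<eta>) * gauss_kernel e (\<xi> - \<eta>) \<partial>lborel) \<partial>lborel) / (2 * pi)\<^sup>2"
proof -
  have [measurable]: "g1 \<in> borel_measurable borel" "g2 \<in> borel_measurable borel"
    using g1 g2 by auto
  let ?E = "\<lambda>x. complex_of_real (exp (- (e * x)\<^sup>2 / 2))"
  let ?h = "\<lambda>x. cnj (inv_fourier g2 x) * ?E x"
  have E: "integrable lborel ?E"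
    using integrable_gaussian_scaled[of e] e by (intro integrable_of_real) auto
  have h: "integrable lborel ?h"
    by (rule integrable_mult_bounded[OF E]) (use borel_measurable_inv_fourier[of g2] in \<open>auto intro: norm_inv_fourier_le\<close>)
  have inner: "inv_fourier ?h \<xi> = (\<integral>\<eta>. cnj (g2 \<eta>) * gauss_kernel e (\<xi> - \<eta>) \<partial>lborel) / (2 * pi)\<^sup>2" for \<xi>
  proof -
    have g2': "integrable lborel (\<lambda>\<eta>. cnj (g2 (- \<eta>)))"
      using lborel_integrable_real_affine[of "\<lambda>\<eta>. cnj (g2 \<eta>)" "-1" 0] g2 by simp
    have Ex: "integrable lborel (\<lambda>x. cis (\<xi> * x) * ?E x)"
      using E by simp
    have G: "inv_fourier (\<lambda>x. cis (\<xi> * x) * ?E x) \<eta> = gauss_kernel e (\<xi> + \<eta>) / (2 * pi)" for \<eta>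
    proof -
      have "(\<lambda>x. cis (\<eta> * x) * (cis (\<xi> * x) * ?E x)) = (\<lambda>x. cis (x * (\<xi> + \<eta>)) * ?E x)"
        by (simp add: cis_mult algebra_simps flip: mult.assoc)
      then show ?thesis
        using fourier_gaussian_scaled[OF e, of "\<xi> + \<eta>"] by (simp only: inv_fourier_def) simp
    qed
    have "inv_fourier ?h \<xi> = (\<integral>x. inv_fourier (\<lambda>\<eta>. cnj (g2 (- \<eta>))) x * (cis (\<xi> * x) * ?E x) \<partial>lborel) / (2 * pi)"
      unfolding cnj_inv_fourier inv_fourier_def[of "\<lambda>x. inv_fourier _ x * _ x"] by (simp add: mult_ac)
    also have "\<dots> = (\<integral>\<eta>. cnj (g2 (- \<eta>)) * (gauss_kernel e (\<xi> + \<eta>) / (2 * pi)) \<partial>lborel) / (2 * pi)"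
      unfolding inv_fourier_transpose[OF g2' Ex] G by simp
    also have "\<dots> = (\<integral>\<eta>. cnj (g2 (- \<eta>)) * gauss_kernel e (\<xi> + \<eta>) \<partial>lborel) / (2 * pi)\<^sup>2"
      by (simp add: power2_eq_square)
    also have "(\<integral>\<eta>. cnj (g2 (- \<eta>)) * gauss_kernel e (\<xi> + \<eta>) \<partial>lborel) = (\<integral>\<eta>. cnj (g2 \<eta>) * gauss_kernel e (\<xi> - \<eta>) \<partial>lborel)"
      using lborel_integral_real_affine[of "-1" "\<lambda>\<eta>. cnj (g2 \<eta>) * complex_of_real (gauss_kernel e (\<xi> - \<eta>))" 0] by simp
    finally show ?thesis .
  qed
  have "(\<integral>x. inv_fourier g1 x * cnj (inv_fourier g2 x) * ?E x \<partial>lborel) = (\<integral>x. inv_fourier g1 x * ?h x \<partial>lborel)"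
    by (simp add: mult.assoc)
  also have "\<dots> = (\<integral>\<xi>. g1 \<xi> * inv_fourier ?h \<xi> \<partial>lborel)"
    by (rule inv_fourier_transpose[OF g1 h])
  also have "\<dots> = (\<integral>\<xi>. (\<integral>\<eta>. g1 \<xi> * cnj (g2 \<eta>) * gauss_kernel e (\<xi> - \<eta>) \<partial>lborel) / (2 * pi)\<^sup>2 \<partial>lborel)"
    unfolding inner by (simp add: mult.assoc)
  finally show ?thesis
    by (simp only: integral_divide_zero)
qed

text \<open>Schur's test bounds the regularised norms uniformly, and Fatou's lemma removes the
  cut-off. The mass \<open>2 * pi\<close> of the kernel against the \<open>(2 * pi)^2\<close> of the
  identity leaves room for the factor lost in Schur's test: the bound obtained is
  \<open>M / pi\<close>.\<close>

lemma Bessel_inv_fourier: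
  assumes g: "integrable lborel g" and g2: "integrable lborel (\<lambda>\<xi>. (norm (g \<xi>))\<^sup>2)"
  shows "integrable lborel (\<lambda>x. (norm (inv_fourier g x))\<^sup>2)"
    and "(\<integral>x. (norm (inv_fourier g x))\<^sup>2 \<partial>lborel) \<le> (\<integral>\<xi>. (norm (g \<xi>))\<^sup>2 \<partial>lborel)"
proof -
  have [measurable]: "g \<in> borel_measurable borel"
    using g by auto
  define f where "f = inv_fourier g"
  have [measurable]: "f \<in> borel_measurable borel"
    using borel_measurable_inv_fourier[of g] by (simp add: f_def)
  define M where "M = (\<integral>\<xi>. (norm (g \<xi>))\<^sup>2 \<partial>lborel)"
  have M: "M \<ge> 0"
    by (simp add: M_def)
  define E where "E = (\<lambda>n x. exp (- (eps n * x)\<^sup>2 / 2))"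
  have E_int: "integrable lborel (E n)" for n
    unfolding E_def using eps_pos[of n] by (intro integrable_gaussian_scaled) auto
  obtain B where B: "\<And>x. norm (f x) \<le> B"
    unfolding f_def using norm_inv_fourier_le by blast
  have int: "integrable lborel (\<lambda>x. (norm (f x))\<^sup>2 * E n x)" for n
  proof (rule Bochner_Integration.integrable_bound[of _ "\<lambda>x. B\<^sup>2 * E n x"])
    show "integrable lborel (\<lambda>x. B\<^sup>2 * E n x)"
      using E_int by simp
    show "AE x in lborel. norm ((norm (f x))\<^sup>2 * E n x) \<le> norm (B\<^sup>2 * E n x)"
      using B by (intro AE_I2) (auto simp: E_def abs_mult intro!: mult_right_mono power_mono)
  qed (auto simp: E_def)
  have le: "(\<integral>x. (norm (f x))\<^sup>2 * E n x \<partial>lborel) \<le> M" for n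
  proof -
    have "norm (\<integral>\<xi>. (\<integral>\<eta>. g \<xi> * cnj (g \<eta>) * complex_of_real (gauss_kernel (eps n) (\<xi> - \<eta>)) \<partial>lborel) \<partial>lborel)
      \<le> (\<integral>t. gauss_kernel (eps n) t \<partial>lborel) * ((\<integral>x. (norm (g x))\<^sup>2 \<partial>lborel) + (\<integral>x. (norm (g x))\<^sup>2 \<partial>lborel))"
      using eps_pos[of n]
      by (intro Schur_bound g2 integrable_gauss_kernel gauss_kernel_nonneg gauss_kernel_minus)
         (auto simp: norm_mult gauss_kernel_nonneg)
    then have *: "norm (\<integral>\<xi>. (\<integral>\<eta>. g \<xi> * cnj (g \<eta>) * complex_of_real (gauss_kernel (eps n) (\<xi> - \<eta>)) \<partial>lborel) \<partial>lborel) \<le> 2 * pi * (2 * M)"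
      using eps_pos[of n] by (simp add: integral_gauss_kernel M_def)
    have "complex_of_real (\<integral>x. (norm (f x))\<^sup>2 * E n x \<partial>lborel)
      = (\<integral>x. inv_fourier g x * cnj (inv_fourier g x) * complex_of_real (exp (- (eps n * x)\<^sup>2 / 2)) \<partial>lborel)"
      unfolding integral_complex_of_real[symmetric]
      by (intro Bochner_Integration.integral_cong) (simp_all add: f_def E_def complex_norm_square[symmetric])
    also have "norm \<dots> \<le> 2 * pi * (2 * M) / (2 * pi)\<^sup>2"
      unfolding Parseval_regularized[OF g g eps_pos] using divide_right_mono[OF *, of "(2 * pi)\<^sup>2"]
      by (simp only: norm_divide) (simp add: norm_power)
    also have "\<dots> = M / pi"
      by (simp add: power2_eq_square)
    also have "\<dots> \<le> M"
      using M pi_gt3 by (simp add: divide_le_eq mult_le_cancel_left1)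
    finally show ?thesis
      by (auto simp: norm_of_real)
  qed
  have nn: "(\<integral>\<^sup>+x. ennreal ((norm (f x))\<^sup>2) \<partial>lborel) \<le> ennreal M"
  proof -
    have lim: "(\<lambda>n. ennreal ((norm (f x))\<^sup>2 * E n x)) \<longlonglongrightarrow> ennreal ((norm (f x))\<^sup>2)" for x
    proof -
      have "(\<lambda>n. (norm (f x))\<^sup>2 * E n x) \<longlonglongrightarrow> (norm (f x))\<^sup>2 * exp (- (0 * x)\<^sup>2 / 2)"
        unfolding E_def by (intro tendsto_intros eps_tendsto_0) auto
      then show ?thesis
        by (intro tendsto_ennrealI) simp
    qed
    have "liminf (\<lambda>n. ennreal ((norm (f x))\<^sup>2 * E n x)) = ennreal ((norm (f x))\<^sup>2)" for x
      by (rule lim_imp_Liminf[OF _ lim]) simp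
    then have "(\<integral>\<^sup>+x. ennreal ((norm (f x))\<^sup>2) \<partial>lborel) = (\<integral>\<^sup>+x. liminf (\<lambda>n. ennreal ((norm (f x))\<^sup>2 * E n x)) \<partial>lborel)"
      by simp
    also have "\<dots> \<le> liminf (\<lambda>n. \<integral>\<^sup>+x. ennreal ((norm (f x))\<^sup>2 * E n x) \<partial>lborel)"
      by (rule nn_integral_liminf) (auto simp: E_def)
    also have "\<dots> \<le> liminf (\<lambda>n. ennreal M)"
    proof (intro Liminf_mono always_eventually allI)
      fix n
      have "(\<integral>\<^sup>+x. ennreal ((norm (f x))\<^sup>2 * E n x) \<partial>lborel) = ennreal (\<integral>x. (norm (f x))\<^sup>2 * E n x \<partial>lborel)"
        by (rule nn_integral_eq_integral[OF int]) (simp add: E_def)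
      also have "\<dots> \<le> ennreal M"
        by (intro ennreal_leI le)
      finally show "(\<integral>\<^sup>+x. ennreal ((norm (f x))\<^sup>2 * E n x) \<partial>lborel) \<le> ennreal M" .
    qed
    finally show ?thesis
      by (simp add: Liminf_const)
  qed
  show *: "integrable lborel (\<lambda>x. (norm (inv_fourier g x))\<^sup>2)"
    unfolding f_def[symmetric] using nn by (intro integrableI_bounded) (auto simp: top.not_eq_extremum[symmetric] top_unique)
  show "(\<integral>x. (norm (inv_fourier g x))\<^sup>2 \<partial>lborel) \<le> (\<integral>\<xi>. (norm (g \<xi>))\<^sup>2 \<partial>lborel)"
    using nn M nn_integral_eq_integral[OF *] unfolding f_def[symmetric] M_def[symmetric]
    by (simp add: ennreal_le_iff)
qed

lemma integrable_mult_cnj: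
  fixes f g :: "real \<Rightarrow> complex"
  assumes [measurable]: "f \<in> borel_measurable borel" "g \<in> borel_measurable borel"
    and "integrable lborel (\<lambda>x. (norm (f x))\<^sup>2)" "integrable lborel (\<lambda>x. (norm (g x))\<^sup>2)"
  shows "integrable lborel (\<lambda>x. f x * cnj (g x))"
proof (rule Bochner_Integration.integrable_bound)
  show "integrable lborel (\<lambda>x. (norm (f x))\<^sup>2 + (norm (g x))\<^sup>2)"
    using assms by simp
  show "AE x in lborel. norm (f x * cnj (g x)) \<le> norm ((norm (f x))\<^sup>2 + (norm (g x))\<^sup>2)"
  proof (rule AE_I2)
    fix x
    have "2 * (norm (f x) * norm (g x)) \<le> (norm (f x))\<^sup>2 + (norm (g x))\<^sup>2"
      using sum_squares_bound[of "norm (f x)" "norm (g x)"] by simp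
    then have "norm (f x) * norm (g x) \<le> (norm (f x))\<^sup>2 + (norm (g x))\<^sup>2"
      using mult_nonneg_nonneg[OF norm_ge_zero[of "f x"] norm_ge_zero[of "g x"]] by linarith
    then show "norm (f x * cnj (g x)) \<le> norm ((norm (f x))\<^sup>2 + (norm (g x))\<^sup>2)"
      by (simp add: norm_mult)
  qed
qed measurable

text \<open>The regularised pairing is symmetric up to the kernel \<open>(\<bar>\<xi>\<bar> - \<bar>\<eta>\<bar>) gauss_kernel e (\<xi> - \<eta>)\<close>, whose Schur norm is \<open>O(e)\<close>.\<close>

lemma absD_symmetric:
  assumes g: "integrable lborel g" "integrable lborel (\<lambda>\<xi>. (norm (g \<xi>))\<^sup>2)"
    and w: "integrable lborel (\<lambda>\<xi>. complex_of_real \<bar>\<xi>\<bar> * g \<xi>)" "integrable lborel (\<lambda>\<xi>. (norm (complex_of_real \<bar>\<xi>\<bar> * g \<xi>))\<^sup>2)"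
  shows "Im (\<integral>x. inv_fourier (\<lambda>\<xi>. complex_of_real \<bar>\<xi>\<bar> * g \<xi>) x * cnj (inv_fourier g x) \<partial>lborel) = 0"
proof -
  have [measurable]: "g \<in> borel_measurable borel"
    using g by auto
  let ?G = "\<lambda>\<xi>. complex_of_real \<bar>\<xi>\<bar> * g \<xi>"
  define P where "P = (\<lambda>x. inv_fourier ?G x * cnj (inv_fourier g x))"
  have P: "integrable lborel P"
    unfolding P_def using borel_measurable_inv_fourier[of g] borel_measurable_inv_fourier[of ?G]
    by (intro integrable_mult_cnj Bessel_inv_fourier g w) auto
  define Z where "Z = (\<lambda>n. \<integral>x. P x * complex_of_real (exp (- (eps n * x)\<^sup>2 / 2)) \<partial>lborel)"
  obtain c where c: "\<And>e. e > 0 \<Longrightarrow> integrable lborel (\<lambda>t. gauss_kernel e t * \<bar>t\<bar>)"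
    "\<And>e. e > 0 \<Longrightarrow> (\<integral>t. gauss_kernel e t * \<bar>t\<bar> \<partial>lborel) = c * e"
    using abs_moment_gauss_kernel by blast
  define M where "M = (\<integral>\<xi>. (norm (g \<xi>))\<^sup>2 \<partial>lborel)"
  have Z_lim: "Z \<longlonglongrightarrow> (\<integral>x. P x * complex_of_real (exp (- (0 * x)\<^sup>2 / 2)) \<partial>lborel)"
    unfolding Z_def
  proof (rule integral_dominated_convergence[OF _ _ integrable_norm[OF P]])
    show "AE x in lborel. (\<lambda>n. P x * complex_of_real (exp (- (eps n * x)\<^sup>2 / 2))) \<longlonglongrightarrow> P x * complex_of_real (exp (- (0 * x)\<^sup>2 / 2))"
      by (intro AE_I2 tendsto_intros eps_tendsto_0) auto
    show "AE x in lborel. norm (P x * complex_of_real (exp (- (eps n * x)\<^sup>2 / 2))) \<le> norm (P x)" for n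
      by (intro AE_I2) (auto simp: norm_mult intro!: mult_left_le)
  qed (use P in measurable)
  have diff: "norm (Z n - cnj (Z n)) \<le> c * eps n * (2 * M)" for n
  proof -
    let ?k = "\<lambda>t. complex_of_real (gauss_kernel (eps n) t)"
    \<comment> \<open>A crude sup bound that blows up with \<open>n\<close>; it serves only
      integrability and Fubini for fixed \<open>n\<close>.\<close>
    have k_bd: "norm (?k t) \<le> sqrt (2 * pi) / eps n" for t
      using eps_pos[of n] unfolding norm_of_real
      by (subst abs_of_nonneg) (auto simp: gauss_kernel_nonneg, auto simp: gauss_kernel_def divide_right_mono)
    have Zn: "Z n = (\<integral>\<xi>. (\<integral>\<eta>. ?G \<xi> * cnj (g \<eta>) * ?k (\<xi> - \<eta>) \<partial>lborel) \<partial>lborel) / (2 * pi)\<^sup>2"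
      unfolding Z_def P_def by (rule Parseval_regularized[OF w(1) g(1) eps_pos])
    have i1: "integrable lborel (\<lambda>\<eta>. ?G \<xi> * cnj (g \<eta>) * ?k (\<xi> - \<eta>))" for \<xi>
      using integrable_mult_bounded[of "\<lambda>\<eta>. ?G \<xi> * cnj (g \<eta>)" "\<lambda>\<eta>. ?k (\<xi> - \<eta>)", OF _ _ k_bd] g(1)
      by (simp add: mult.commute)
    have i2: "integrable lborel (\<lambda>\<eta>. cnj (?G \<eta>) * g \<xi> * ?k (\<eta> - \<xi>))" for \<xi>
    proof -
      have "integrable lborel (\<lambda>\<eta>. cnj (?G \<eta>))"
        using w(1) by (rule integrable_cnj)
      then have "integrable lborel (\<lambda>\<eta>. cnj (?G \<eta>) * g \<xi>)"
        by (intro integrable_mult_left)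
      then show ?thesis
        using integrable_mult_bounded[of "\<lambda>\<eta>. cnj (?G \<eta>) * g \<xi>" "\<lambda>\<eta>. ?k (\<eta> - \<xi>)", OF _ _ k_bd]
        by (simp add: mult.commute[of _ "?k _"] del: complex_cnj_mult)
    qed
    have m1: "(\<lambda>(\<xi>, \<eta>). ?G \<xi> * cnj (g \<eta>) * ?k (\<xi> - \<eta>)) \<in> borel_measurable (lborel \<Otimes>\<^sub>M lborel)"
      and m2: "(\<lambda>(\<xi>, \<eta>). cnj (?G \<xi>) * g \<eta> * ?k (\<xi> - \<eta>)) \<in> borel_measurable (lborel \<Otimes>\<^sub>M lborel)"
      by measurable
    have p1: "integrable lborel (\<lambda>\<xi>. norm (?G \<xi>))"
      using integrable_norm[OF w(1)] .
    have p2: "integrable lborel (\<lambda>\<xi>. norm (g \<xi>) * (sqrt (2 * pi) / eps n))"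
      using g(1) by (intro integrable_mult_left integrable_norm)
    have b1: "norm (?G \<xi> * cnj (g \<eta>) * ?k (\<xi> - \<eta>)) \<le> norm (?G \<xi>) * (norm (g \<eta>) * (sqrt (2 * pi) / eps n))" for \<xi> \<eta>
      using k_bd[of "\<xi> - \<eta>"] unfolding norm_mult complex_mod_cnj mult.assoc by (intro mult_left_mono) auto
    have b2: "norm (cnj (?G \<xi>) * g \<eta> * ?k (\<xi> - \<eta>)) \<le> norm (?G \<xi>) * (norm (g \<eta>) * (sqrt (2 * pi) / eps n))" for \<xi> \<eta>
      using k_bd[of "\<xi> - \<eta>"] unfolding norm_mult complex_mod_cnj mult.assoc by (intro mult_left_mono) auto
    note F1 = Fubini_dominated[OF m1 p1 p2 b1] and F2 = Fubini_dominated[OF m2 p1 p2 b2]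
    \<comment> \<open>Conjugation and Fubini exchange the roles of the two frequencies. The kernel
      is even, so subtracting leaves the multiplier
      \<open>\<bar>\<xi>\<bar> - \<bar>\<eta>\<bar>\<close>, which is at most
      \<open>\<bar>\<xi> - \<eta>\<bar>\<close>.\<close>
    have "cnj (\<integral>\<xi>. (\<integral>\<eta>. ?G \<xi> * cnj (g \<eta>) * ?k (\<xi> - \<eta>) \<partial>lborel) \<partial>lborel)
      = (\<integral>\<xi>. (\<integral>\<eta>. cnj (?G \<xi>) * g \<eta> * ?k (\<xi> - \<eta>) \<partial>lborel) \<partial>lborel)"
      by (simp flip: Bochner_Integration.integral_cnj)
    also have "\<dots> = (\<integral>\<eta>. (\<integral>\<xi>. cnj (?G \<xi>) * g \<eta> * ?k (\<xi> - \<eta>) \<partial>lborel) \<partial>lborel)"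
      by (rule F2(1))
    finally have "Z n - cnj (Z n) = ((\<integral>\<xi>. (\<integral>\<eta>. ?G \<xi> * cnj (g \<eta>) * ?k (\<xi> - \<eta>) \<partial>lborel) \<partial>lborel)
       - (\<integral>\<xi>. (\<integral>\<eta>. cnj (?G \<eta>) * g \<xi> * ?k (\<eta> - \<xi>) \<partial>lborel) \<partial>lborel)) / (2 * pi)\<^sup>2"
      by (simp add: Zn diff_divide_distrib)
    also have "(\<integral>\<xi>. (\<integral>\<eta>. ?G \<xi> * cnj (g \<eta>) * ?k (\<xi> - \<eta>) \<partial>lborel) \<partial>lborel)
       - (\<integral>\<xi>. (\<integral>\<eta>. cnj (?G \<eta>) * g \<xi> * ?k (\<eta> - \<xi>) \<partial>lborel) \<partial>lborel)
      = (\<integral>\<xi>. (\<integral>\<eta>. ?G \<xi> * cnj (g \<eta>) * ?k (\<xi> - \<eta>) - cnj (?G \<eta>) * g \<xi> * ?k (\<eta> - \<xi>) \<partial>lborel) \<partial>lborel)"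
      using F1(2) F2(3) i1 i2 by simp
    also have "(\<lambda>\<xi> \<eta>. ?G \<xi> * cnj (g \<eta>) * ?k (\<xi> - \<eta>) - cnj (?G \<eta>) * g \<xi> * ?k (\<eta> - \<xi>))
      = (\<lambda>\<xi> \<eta>. complex_of_real (\<bar>\<xi>\<bar> - \<bar>\<eta>\<bar>) * (g \<xi> * cnj (g \<eta>) * ?k (\<xi> - \<eta>)))"
    proof (intro ext)
      fix \<xi> \<eta>
      show "?G \<xi> * cnj (g \<eta>) * ?k (\<xi> - \<eta>) - cnj (?G \<eta>) * g \<xi> * ?k (\<eta> - \<xi>)
        = complex_of_real (\<bar>\<xi>\<bar> - \<bar>\<eta>\<bar>) * (g \<xi> * cnj (g \<eta>) * ?k (\<xi> - \<eta>))"
        unfolding gauss_kernel_commute[of _ \<eta> \<xi>] by (simp add: algebra_simps)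
    qed
    finally have "norm (Z n - cnj (Z n)) = norm (\<integral>\<xi>. (\<integral>\<eta>. complex_of_real (\<bar>\<xi>\<bar> - \<bar>\<eta>\<bar>) * (g \<xi> * cnj (g \<eta>) * ?k (\<xi> - \<eta>)) \<partial>lborel) \<partial>lborel) / (2 * pi)\<^sup>2"
      by (simp add: norm_divide norm_power)
    also have "\<dots> \<le> norm (\<integral>\<xi>. (\<integral>\<eta>. complex_of_real (\<bar>\<xi>\<bar> - \<bar>\<eta>\<bar>) * (g \<xi> * cnj (g \<eta>) * ?k (\<xi> - \<eta>)) \<partial>lborel) \<partial>lborel) / 1"
    proof (rule divide_left_mono)
      show "1 \<le> (2 * pi)\<^sup>2"
        by (rule one_le_power) (use pi_gt3 in linarith)
    qed auto
    also have "\<dots> \<le> (\<integral>t. gauss_kernel (eps n) t * \<bar>t\<bar> \<partial>lborel) * ((\<integral>\<xi>. (norm (g \<xi>))\<^sup>2 \<partial>lborel) + (\<integral>\<xi>. (norm (g \<xi>))\<^sup>2 \<partial>lborel))"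
      unfolding div_by_1
    proof (rule Schur_bound)
      fix \<xi> \<eta>
      have "\<bar>\<bar>\<xi>\<bar> - \<bar>\<eta>\<bar>\<bar> * (norm (g \<xi>) * norm (g \<eta>) * gauss_kernel (eps n) (\<xi> - \<eta>))
         \<le> \<bar>\<xi> - \<eta>\<bar> * (norm (g \<xi>) * norm (g \<eta>) * gauss_kernel (eps n) (\<xi> - \<eta>))"
        using gauss_kernel_nonneg[OF eps_pos[of n]] by (intro mult_right_mono abs_triangle_ineq3) auto
      then show "norm (complex_of_real (\<bar>\<xi>\<bar> - \<bar>\<eta>\<bar>) * (g \<xi> * cnj (g \<eta>) * ?k (\<xi> - \<eta>)))
        \<le> \<bar>norm (g \<xi>)\<bar> * \<bar>norm (g \<eta>)\<bar> * (gauss_kernel (eps n) (\<xi> - \<eta>) * \<bar>\<xi> - \<eta>\<bar>)"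
        using gauss_kernel_nonneg[OF eps_pos[of n]]
        by (simp add: norm_mult mult_ac del: of_real_diff)
    qed (use c(1)[OF eps_pos[of n]] g(2) gauss_kernel_nonneg[OF eps_pos[of n]] gauss_kernel_minus in auto)
    finally show ?thesis
      by (simp add: c(2)[OF eps_pos[of n]] M_def)
  qed
  have Z_lim': "Z \<longlonglongrightarrow> (\<integral>x. P x \<partial>lborel)"
    using Z_lim by simp
  then have "(\<lambda>n. norm (Z n - cnj (Z n))) \<longlonglongrightarrow> norm ((\<integral>x. P x \<partial>lborel) - cnj (\<integral>x. P x \<partial>lborel))"
    by (intro tendsto_intros)
  moreover have "(\<lambda>n. c * eps n * (2 * M)) \<longlonglongrightarrow> c * 0 * (2 * M)"
    by (intro tendsto_intros eps_tendsto_0)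
  ultimately have "norm ((\<integral>x. P x \<partial>lborel) - cnj (\<integral>x. P x \<partial>lborel)) \<le> c * 0 * (2 * M)"
    by (rule LIMSEQ_le) (use diff in auto)
  then show ?thesis
    by (simp add: P_def complex_eq_iff)
qed

section \<open>Sobolev norms and second-order bounds\<close>

lemma has_fourier_fourier_of: "has_fourier f g \<Longrightarrow> has_fourier f (fourier_of f)"
  unfolding fourier_of_def by (metis someI)

lemma has_fourier_measurable: "has_fourier f g \<Longrightarrow> g \<in> borel_measurable borel"
  by (simp add: has_fourier_def)

text \<open>Makes the \<open>SOME\<close> in \<open>fourier_of\<close> harmless: two transforms of
  the same function agree almost everywhere, so any known one may be used to compute norms.\<close>

lemma Sobolev_integral_cong:
  assumes "has_fourier f g" "has_fourier f h"
  shows "integrable lborel (\<lambda>\<xi>. (1 + \<xi>\<^sup>2) powr s * (cmod (g \<xi>))\<^sup>2) \<longleftrightarrow>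
      integrable lborel (\<lambda>\<xi>. (1 + \<xi>\<^sup>2) powr s * (cmod (h \<xi>))\<^sup>2)"
    and "(\<integral>\<xi>. (1 + \<xi>\<^sup>2) powr s * (cmod (g \<xi>))\<^sup>2 \<partial>lborel) = (\<integral>\<xi>. (1 + \<xi>\<^sup>2) powr s * (cmod (h \<xi>))\<^sup>2 \<partial>lborel)"
proof -
  have [measurable]: "g \<in> borel_measurable borel" "h \<in> borel_measurable borel"
    using assms by (auto intro: has_fourier_measurable)
  have ae: "AE \<xi> in lborel. (1 + \<xi>\<^sup>2) powr s * (cmod (g \<xi>))\<^sup>2 = (1 + \<xi>\<^sup>2) powr s * (cmod (h \<xi>))\<^sup>2"
    using has_fourier_unique[OF assms] by eventually_elim simp
  show "integrable lborel (\<lambda>\<xi>. (1 + \<xi>\<^sup>2) powr s * (cmod (g \<xi>))\<^sup>2) \<longleftrightarrow>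
      integrable lborel (\<lambda>\<xi>. (1 + \<xi>\<^sup>2) powr s * (cmod (h \<xi>))\<^sup>2)"
    by (rule integrable_cong_AE[OF _ _ ae]) measurable
  show "(\<integral>\<xi>. (1 + \<xi>\<^sup>2) powr s * (cmod (g \<xi>))\<^sup>2 \<partial>lborel) = (\<integral>\<xi>. (1 + \<xi>\<^sup>2) powr s * (cmod (h \<xi>))\<^sup>2 \<partial>lborel)"
    by (rule integral_cong_AE[OF _ _ ae]) measurable
qed

lemma sobolev_norm_eq:
  assumes "has_fourier f g"
  shows "sobolev_norm s f = (1 / sqrt (2 * pi)) * sqrt (\<integral>\<xi>. (1 + \<xi>\<^sup>2) powr s * (cmod (g \<xi>))\<^sup>2 \<partial>lborel)"
  unfolding sobolev_norm_def
  using Sobolev_integral_cong(2)[OF has_fourier_fourier_of[OF assms] assms] by simp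

lemma in_H_iff:
  assumes "has_fourier f g"
  shows "in_H s f \<longleftrightarrow> integrable lborel (\<lambda>\<xi>. (1 + \<xi>\<^sup>2) powr s * (cmod (g \<xi>))\<^sup>2)"
  unfolding in_H_def using Sobolev_integral_cong(1)[OF _ assms] assms by blast

text \<open>The set of disagreement is open and null, hence empty.\<close>

lemma AE_eq_continuous_imp_eq:
  fixes f g :: "real \<Rightarrow> complex"
  assumes f: "continuous_on UNIV f" and g: "continuous_on UNIV g" and ae: "AE x in lborel. f x = g x"
  shows "f x = g x"
proof -
  have "open {x. f x \<noteq> g x}"
    using f g by (rule open_Collect_neq)
  moreover have "{x. f x \<noteq> g x} \<in> null_sets lborel"
    using ae \<open>open {x. f x \<noteq> g x}\<close> by (intro AE_iff_null_sets[THEN iffD2]) auto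
  then have "negligible {x. f x \<noteq> g x}"
    by (simp add: negligible_iff_null_sets null_sets_completionI)
  ultimately show ?thesis
    using open_not_negligible by blast
qed

lemma cmod_diff_square_le: "(cmod (a - b))\<^sup>2 \<le> 2 * (cmod a)\<^sup>2 + 2 * (cmod b)\<^sup>2"
proof -
  have "(cmod (a - b))\<^sup>2 \<le> (cmod a + cmod b)\<^sup>2"
    by (intro power_mono norm_triangle_ineq4) auto
  also have "\<dots> \<le> 2 * (cmod a)\<^sup>2 + 2 * (cmod b)\<^sup>2"
    using sum_squares_bound[of "cmod a" "cmod b"] by (simp add: power2_sum)
  finally show ?thesis .
qed

text \<open>The squared norm of order 2 up to the factor \<open>2 * pi\<close>. Order 2 is enough
  for \<open>g\<close> and \<open>\<bar>\<xi>\<bar> * g\<close> to be both integrable and square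
  integrable, which is what the uniqueness proof consumes.\<close>

definition H2_mass :: "(real \<Rightarrow> complex) \<Rightarrow> real" where
  "H2_mass g = (\<integral>\<xi>. (1 + \<xi>\<^sup>2) powr 2 * (cmod (g \<xi>))\<^sup>2 \<partial>lborel)"

lemma integrable_dominated:
  fixes f :: "real \<Rightarrow> 'a::{banach, second_countable_topology}" and h :: "real \<Rightarrow> real"
  assumes "f \<in> borel_measurable borel" "integrable lborel h" "\<And>x. norm (f x) \<le> h x"
  shows "integrable lborel f" "(\<integral>x. norm (f x) \<partial>lborel) \<le> (\<integral>x. h x \<partial>lborel)"
proof -
  show *: "integrable lborel f"
    by (rule Bochner_Integration.integrable_bound[OF assms(2)])
       (use assms in \<open>auto intro: order_trans[OF _ abs_ge_self]\<close>)
  show "(\<integral>x. norm (f x) \<partial>lborel) \<le> (\<integral>x. h x \<partial>lborel)"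
    by (rule integral_mono[OF integrable_norm[OF *] assms(2)]) (rule assms(3))
qed

text \<open>A pointwise Young inequality replaces Cauchy-Schwarz: with
  \<open>J = 1 + \<xi>^2\<close>, the product of \<open>J * cmod (g \<xi>)\<close> and
  \<open>(1 + \<bar>\<xi>\<bar>) / J\<close> is at most the mass density plus \<open>1 / J\<close>.
  The summand \<open>pi\<close> is the integral of \<open>1 / J\<close>.\<close>

lemma H2_bounds:
  assumes [measurable]: "g \<in> borel_measurable borel"
    and int: "integrable lborel (\<lambda>\<xi>. (1 + \<xi>\<^sup>2) powr 2 * (cmod (g \<xi>))\<^sup>2)"
  defines "G \<equiv> \<lambda>\<xi>. complex_of_real \<bar>\<xi>\<bar> * g \<xi>"
  shows "integrable lborel g" "(\<integral>\<xi>. cmod (g \<xi>) \<partial>lborel) \<le> H2_mass g + pi"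
    and "integrable lborel G" "(\<integral>\<xi>. cmod (G \<xi>) \<partial>lborel) \<le> H2_mass g + pi"
    and "integrable lborel (\<lambda>\<xi>. (cmod (g \<xi>))\<^sup>2)" "(\<integral>\<xi>. (cmod (g \<xi>))\<^sup>2 \<partial>lborel) \<le> H2_mass g"
    and "integrable lborel (\<lambda>\<xi>. (cmod (G \<xi>))\<^sup>2)" "(\<integral>\<xi>. (cmod (G \<xi>))\<^sup>2 \<partial>lborel) \<le> H2_mass g"
proof -
  have [measurable]: "G \<in> borel_measurable borel"
    unfolding G_def by measurable
  have pw: "(1 + \<xi>\<^sup>2) powr 2 = (1 + \<xi>\<^sup>2)\<^sup>2" for \<xi> :: real
    using powr_numeral[of "1 + \<xi>\<^sup>2" "num.Bit0 num.One"] by (simp add: add_pos_nonneg)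
  define h where "h = (\<lambda>\<xi>. (1 + \<xi>\<^sup>2)\<^sup>2 * (cmod (g \<xi>))\<^sup>2)"
  have h: "integrable lborel h" and hS: "(\<integral>\<xi>. h \<xi> \<partial>lborel) = H2_mass g"
    using int by (simp_all add: h_def H2_mass_def pw)
  have h': "integrable lborel (\<lambda>\<xi>. h \<xi> + 1 / (1 + \<xi>\<^sup>2))"
    and h'S: "(\<integral>\<xi>. h \<xi> + 1 / (1 + \<xi>\<^sup>2) \<partial>lborel) = H2_mass g + pi"
    using h integrable_inverse_one_plus_square by (auto simp: hS integral_inverse_one_plus_square)
  have key: "(1 + \<bar>\<xi>\<bar>) * cmod (g \<xi>) \<le> h \<xi> + 1 / (1 + \<xi>\<^sup>2)" for \<xi>
  proof -
    define J where "J = 1 + \<xi>\<^sup>2"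
    have J: "J \<ge> 1"
      by (simp add: J_def)
    define a where "a = J * cmod (g \<xi>)"
    define b where "b = (1 + \<bar>\<xi>\<bar>) / J"
    have "0 \<le> (1 - \<bar>\<xi>\<bar>)\<^sup>2"
      by simp
    then have "(1 + \<bar>\<xi>\<bar>)\<^sup>2 \<le> 2 * J"
      by (simp add: J_def power2_eq_square algebra_simps)
    then have "b\<^sup>2 \<le> 2 * J / J\<^sup>2"
      by (simp add: b_def power_divide divide_right_mono)
    also have "\<dots> = 2 / J"
      using J by (simp add: power2_eq_square)
    finally have b2: "b\<^sup>2 \<le> 2 / J" .
    have "(1 + \<bar>\<xi>\<bar>) * cmod (g \<xi>) = a * b"
      using J by (simp add: a_def b_def)
    also have "a * b \<le> a\<^sup>2 + b\<^sup>2 / 2"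
      using sum_squares_bound[of a b] zero_le_power2[of a] unfolding mult.assoc by linarith
    also have "\<dots> \<le> a\<^sup>2 + 1 / J"
      using b2 by simp
    finally show ?thesis
      by (simp add: a_def h_def J_def power_mult_distrib)
  qed
  have *: "cmod (g \<xi>) \<le> h \<xi> + 1 / (1 + \<xi>\<^sup>2)" "cmod (G \<xi>) \<le> h \<xi> + 1 / (1 + \<xi>\<^sup>2)" for \<xi>
    using key[of \<xi>] mult_nonneg_nonneg[OF abs_ge_zero[of \<xi>] norm_ge_zero[of "g \<xi>"]] norm_ge_zero[of "g \<xi>"]
    unfolding G_def norm_mult norm_of_real abs_abs distrib_right by linarith+
  show "integrable lborel g" "(\<integral>\<xi>. cmod (g \<xi>) \<partial>lborel) \<le> H2_mass g + pi"
    using integrable_dominated[OF _ h' *(1)] h'S by auto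
  show "integrable lborel G" "(\<integral>\<xi>. cmod (G \<xi>) \<partial>lborel) \<le> H2_mass g + pi"
    using integrable_dominated[OF _ h' *(2)] h'S by auto
  have **: "norm ((cmod (g \<xi>))\<^sup>2) \<le> h \<xi>" "norm ((cmod (G \<xi>))\<^sup>2) \<le> h \<xi>" for \<xi>
  proof -
    have "1 * (cmod (g \<xi>))\<^sup>2 \<le> h \<xi>"
      unfolding h_def by (intro mult_right_mono one_le_power) auto
    then show "norm ((cmod (g \<xi>))\<^sup>2) \<le> h \<xi>"
      by simp
    have "\<xi>\<^sup>2 \<le> (1 + \<xi>\<^sup>2)\<^sup>2"
      using zero_le_power2[of "\<xi>\<^sup>2"] zero_le_power2[of \<xi>] by (simp add: power2_sum)
    then have "\<xi>\<^sup>2 * (cmod (g \<xi>))\<^sup>2 \<le> h \<xi>"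
      unfolding h_def by (intro mult_right_mono) auto
    then show "norm ((cmod (G \<xi>))\<^sup>2) \<le> h \<xi>"
      by (simp add: G_def norm_mult power_mult_distrib)
  qed
  show "integrable lborel (\<lambda>\<xi>. (cmod (g \<xi>))\<^sup>2)" "(\<integral>\<xi>. (cmod (g \<xi>))\<^sup>2 \<partial>lborel) \<le> H2_mass g"
    using integrable_dominated[OF _ h **(1)] hS by auto
  show "integrable lborel (\<lambda>\<xi>. (cmod (G \<xi>))\<^sup>2)" "(\<integral>\<xi>. (cmod (G \<xi>))\<^sup>2 \<partial>lborel) \<le> H2_mass g"
    using integrable_dominated[OF _ h **(2)] hS by auto
qed

text \<open>Continuity into the Sobolev space of order 2 bounds the mass near each time; compactness
  of \<open>{0..T}\<close> makes the bound uniform.\<close>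

lemma hw_solution_H2_bound:
  assumes u: "hw_solution \<mu> T \<phi> u"
  obtains C where "C \<ge> 0" "\<And>t. t \<in> {0..T} \<Longrightarrow> H2_mass (fourier_of (u t)) \<le> C"
proof -
  have hf: "has_fourier (u t) (fourier_of (u t))"
    and int: "integrable lborel (\<lambda>\<xi>. (1 + \<xi>\<^sup>2) powr 2 * (cmod (fourier_of (u t) \<xi>))\<^sup>2)" if "t \<in> {0..T}" for t
  proof -
    have "in_H 2 (u t)"
      using u that by (auto simp: hw_solution_def H_infty_def)
    then obtain g where "has_fourier (u t) g"
      by (auto simp: in_H_def)
    then show *: "has_fourier (u t) (fourier_of (u t))"
      by (rule has_fourier_fourier_of)
    show "integrable lborel (\<lambda>\<xi>. (1 + \<xi>\<^sup>2) powr 2 * (cmod (fourier_of (u t) \<xi>))\<^sup>2)"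
      using \<open>in_H 2 (u t)\<close> in_H_iff[OF *] by simp
  qed
  have loc: "\<exists>U B. open U \<and> t0 \<in> U \<and> (\<forall>t\<in>U \<inter> {0..T}. H2_mass (fourier_of (u t)) \<le> B)" if t0: "t0 \<in> {0..T}" for t0
  proof -
    have "((\<lambda>t. sobolev_norm 2 (\<lambda>x. u t x - u t0 x)) \<longlongrightarrow> 0) (at t0 within {0..T})"
      using u t0 by (auto simp: hw_solution_def)
    then have "\<forall>\<^sub>F t in at t0 within {0..T}. sobolev_norm 2 (\<lambda>x. u t x - u t0 x) < 1"
      by (rule order_tendstoD) simp
    then obtain d where d: "d > 0" "\<And>t. t \<in> {0..T} \<Longrightarrow> t \<noteq> t0 \<Longrightarrow> dist t t0 < d \<Longrightarrow> sobolev_norm 2 (\<lambda>x. u t x - u t0 x) < 1"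
      unfolding eventually_at by blast
    define m0 where "m0 = H2_mass (fourier_of (u t0))"
    have m0: "m0 \<ge> 0"
      by (simp add: m0_def H2_mass_def integral_nonneg)
    have "H2_mass (fourier_of (u t)) \<le> 2 * (2 * pi) + 2 * m0" if t: "t \<in> ball t0 d \<inter> {0..T}" for t
    proof (cases "t = t0")
      case True
      then show ?thesis
        using m0 pi_ge_zero by (simp add: m0_def)
    next
      case False
      let ?a = "fourier_of (u t)" and ?b = "fourier_of (u t0)"
      have [measurable]: "?a \<in> borel_measurable borel" "?b \<in> borel_measurable borel"
        using hf t t0 has_fourier_measurable by blast+
      have hfd: "has_fourier (\<lambda>x. u t x - u t0 x) (\<lambda>\<xi>. ?a \<xi> - ?b \<xi>)"
        using t t0 by (intro has_fourier_diff hf) auto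
      have pt: "(cmod a)\<^sup>2 \<le> 2 * (cmod (a - b))\<^sup>2 + 2 * (cmod b)\<^sup>2" for a b
        using cmod_diff_square_le[of "a - b" "- b"] by simp
      let ?W = "\<lambda>\<xi>::real. (1 + \<xi>\<^sup>2) powr 2"
      have ia: "integrable lborel (\<lambda>\<xi>. ?W \<xi> * (cmod (?a \<xi>))\<^sup>2)" and ib: "integrable lborel (\<lambda>\<xi>. ?W \<xi> * (cmod (?b \<xi>))\<^sup>2)"
        using int t t0 by auto
      \<comment> \<open>A non-integrable integrand would have integral 0 and make the small Sobolev
        norm meaningless, so integrability comes first.\<close>
      have id: "integrable lborel (\<lambda>\<xi>. ?W \<xi> * (cmod (?a \<xi> - ?b \<xi>))\<^sup>2)"
      proof (rule integrable_dominated(1))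
        show "integrable lborel (\<lambda>\<xi>. 2 * (?W \<xi> * (cmod (?a \<xi>))\<^sup>2) + 2 * (?W \<xi> * (cmod (?b \<xi>))\<^sup>2))"
          using ia ib by auto
        show "norm (?W \<xi> * (cmod (?a \<xi> - ?b \<xi>))\<^sup>2) \<le> 2 * (?W \<xi> * (cmod (?a \<xi>))\<^sup>2) + 2 * (?W \<xi> * (cmod (?b \<xi>))\<^sup>2)" for \<xi>
          using mult_left_mono[OF cmod_diff_square_le[of "?a \<xi>" "?b \<xi>"], of "?W \<xi>"] by (simp add: algebra_simps)
      qed measurable
      define D where "D = (\<integral>\<xi>. ?W \<xi> * (cmod (?a \<xi> - ?b \<xi>))\<^sup>2 \<partial>lborel)"
      have "H2_mass ?a \<le> (\<integral>\<xi>. 2 * (?W \<xi> * (cmod (?a \<xi> - ?b \<xi>))\<^sup>2) + 2 * (?W \<xi> * (cmod (?b \<xi>))\<^sup>2) \<partial>lborel)"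
        unfolding H2_mass_def
      proof (rule integral_mono[OF ia])
        show "integrable lborel (\<lambda>\<xi>. 2 * (?W \<xi> * (cmod (?a \<xi> - ?b \<xi>))\<^sup>2) + 2 * (?W \<xi> * (cmod (?b \<xi>))\<^sup>2))"
          using id ib by auto
        show "?W \<xi> * (cmod (?a \<xi>))\<^sup>2 \<le> 2 * (?W \<xi> * (cmod (?a \<xi> - ?b \<xi>))\<^sup>2) + 2 * (?W \<xi> * (cmod (?b \<xi>))\<^sup>2)" for \<xi>
          using mult_left_mono[OF pt[of "?a \<xi>" "?b \<xi>"], of "?W \<xi>"] by (simp add: algebra_simps)
      qed
      also have "\<dots> = 2 * D + 2 * m0"
        using id ib by (simp add: D_def m0_def H2_mass_def)
      \<comment> \<open>\<open>sobolev_norm\<close> carries the factor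
        \<open>1 / sqrt (2 * pi)\<close>, so a norm below 1 means \<open>D < 2 * pi\<close>.\<close>
      also have "D \<le> 2 * pi"
      proof -
        have "sobolev_norm 2 (\<lambda>x. u t x - u t0 x) < 1"
          using d(2)[of t] t False by (auto simp: dist_commute)
        then have "sqrt D < sqrt (2 * pi)"
          unfolding sobolev_norm_eq[OF hfd] D_def by (simp add: field_simps)
        then show ?thesis
          by simp
      qed
      finally show ?thesis
        by simp
    qed
    then show ?thesis
      using d(1) by (intro exI[of _ "ball t0 d"] exI[of _ "2 * (2 * pi) + 2 * m0"]) auto
  qed
  then obtain U B where UB: "\<And>t0. t0 \<in> {0..T} \<Longrightarrow> open (U t0) \<and> t0 \<in> U t0 \<and> (\<forall>t\<in>U t0 \<inter> {0..T}. H2_mass (fourier_of (u t)) \<le> B t0)"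
    by metis
  have "compact {0..T}"
    by simp
  then obtain K where K: "K \<subseteq> {0..T}" "finite K" "{0..T} \<subseteq> (\<Union>t0\<in>K. U t0)"
    by (rule compactE_image[of "{0..T}" "{0..T}" U]) (use UB in auto)
  show ?thesis
  proof (rule that[of "\<Sum>t0\<in>K. \<bar>B t0\<bar>"])
    fix t
    assume t: "t \<in> {0..T}"
    then obtain t0 where t0: "t0 \<in> K" "t \<in> U t0"
      using K by auto
    then have "H2_mass (fourier_of (u t)) \<le> B t0"
      using UB t K by blast
    also have "\<dots> \<le> (\<Sum>t0\<in>K. \<bar>B t0\<bar>)"
      using member_le_sum[of t0 K "\<lambda>t0. \<bar>B t0\<bar>"] t0 K by (simp add: abs_le_iff)
    finally show "H2_mass (fourier_of (u t)) \<le> (\<Sum>t0\<in>K. \<bar>B t0\<bar>)" .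
  qed (simp add: sum_nonneg)
qed

subsection \<open>Uniqueness of solutions\<close>

lemma continuous_on_slices:
  assumes f: "continuous_on (S \<times> UNIV) (\<lambda>(t, x). f t x)"
  shows "t \<in> S \<Longrightarrow> continuous_on UNIV (f t)" and "continuous_on S (\<lambda>t. f t x)"
proof -
  have "continuous_on UNIV (\<lambda>x. case (t, x) of (t, x) \<Rightarrow> f t x)" if "t \<in> S"
    by (rule continuous_on_compose2[OF f]) (use that in \<open>auto intro!: continuous_on_Pair\<close>)
  then show "t \<in> S \<Longrightarrow> continuous_on UNIV (f t)"
    by simp
  have "continuous_on S (\<lambda>t. case (t, x) of (t, x) \<Rightarrow> f t x)"
    by (rule continuous_on_compose2[OF f]) (auto intro!: continuous_on_Pair)
  then show "continuous_on S (\<lambda>t. f t x)"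
    by simp
qed

text \<open>The form of a solution on which the energy estimate works: concrete transforms
  \<open>g t\<close> with a mass bound uniform in time, and both \<open>u t\<close> and |D|u(t)
  written as inverse transforms.\<close>

definition hw_regular :: "real \<Rightarrow> real \<Rightarrow> (real \<Rightarrow> real \<Rightarrow> complex) \<Rightarrow> real \<Rightarrow>
    (real \<Rightarrow> real \<Rightarrow> complex) \<Rightarrow> (real \<Rightarrow> real \<Rightarrow> complex) \<Rightarrow> bool" where
  "hw_regular \<mu> T u C u' g \<longleftrightarrow> C \<ge> 0 \<and>
    continuous_on ({0..T} \<times> UNIV) (\<lambda>(t, x). u t x) \<and>
    continuous_on ({0..T} \<times> UNIV) (\<lambda>(t, x). u' t x) \<and>
    (\<forall>t\<in>{0..T}. (\<forall>x. ((\<lambda>\<tau>. u \<tau> x) has_vector_derivative u' t x) (at t within {0..T})) \<and>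
      g t \<in> borel_measurable borel \<and>
      integrable lborel (\<lambda>\<xi>. (1 + \<xi>\<^sup>2) powr 2 * (cmod (g t \<xi>))\<^sup>2) \<and> H2_mass (g t) \<le> C \<and>
      (\<forall>x. u t x = inv_fourier (g t) x) \<and>
      (AE x in lborel. \<i> * u' t x =
        inv_fourier (\<lambda>\<xi>. complex_of_real \<bar>\<xi>\<bar> * g t \<xi>) x + complex_of_real (\<mu> * (cmod (u t x))\<^sup>2) * u t x))"

text \<open>The transforms coming from \<open>fourier_of\<close> and from \<open>is_absD\<close> are
  unrelated witnesses; uniqueness identifies them almost everywhere. Continuity then upgrades the
  representation of \<open>u t\<close> from almost every point to every point.\<close>

lemma hw_solution_regular:
  assumes u: "hw_solution \<mu> T \<phi> u"
  shows "\<exists>C u' g. hw_regular \<mu> T u C u' g"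
proof -
  obtain C where C: "C \<ge> 0" "\<And>t. t \<in> {0..T} \<Longrightarrow> H2_mass (fourier_of (u t)) \<le> C"
    using hw_solution_H2_bound[OF u] by blast
  obtain u' where u': "continuous_on ({0..T} \<times> UNIV) (\<lambda>(t, x). u t x)"
      "continuous_on ({0..T} \<times> UNIV) (\<lambda>(t, x). u' t x)"
      "\<forall>x. \<forall>t\<in>{0..T}. ((\<lambda>\<tau>. u \<tau> x) has_vector_derivative u' t x) (at t within {0..T})"
      "\<forall>t\<in>{0..T}. \<exists>w. is_absD (u t) w \<and>
              (AE x in lborel. \<i> * u' t x - w x = complex_of_real (\<mu> * (cmod (u t x))\<^sup>2) * u t x)"
    using u unfolding hw_solution_def by blast
  have "hw_regular \<mu> T u C u' (\<lambda>t. fourier_of (u t))"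
    unfolding hw_regular_def
  proof (intro conjI ballI allI C(1) u'(1) u'(2))
    fix t
    assume t: "t \<in> {0..T}"
    let ?g = "fourier_of (u t)"
    show "((\<lambda>\<tau>. u \<tau> x) has_vector_derivative u' t x) (at t within {0..T})" for x
      using u'(3) t by blast
    show "H2_mass ?g \<le> C"
      using C t by blast
    have H: "in_H 2 (u t)"
      using u t by (auto simp: hw_solution_def H_infty_def)
    then have hf: "has_fourier (u t) ?g"
      using has_fourier_fourier_of by (auto simp: in_H_def)
    show meas: "?g \<in> borel_measurable borel"
      using has_fourier_measurable[OF hf] .
    show int: "integrable lborel (\<lambda>\<xi>. (1 + \<xi>\<^sup>2) powr 2 * (cmod (?g \<xi>))\<^sup>2)"
      using H in_H_iff[OF hf] by simp
    note b = H2_bounds[OF meas int]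
    have cont_u: "continuous_on UNIV (u t)"
      using continuous_on_slices(1)[OF u'(1) t] .
    show "u t x = inv_fourier ?g x" for x
      by (rule AE_eq_continuous_imp_eq[OF cont_u continuous_on_inv_fourier[OF b(1)]])
         (rule has_fourier_determines_AE[OF hf has_fourier_inv_fourier[OF b(1)]])
    obtain w g' where w: "has_fourier (u t) g'" "has_fourier w (\<lambda>\<xi>. complex_of_real \<bar>\<xi>\<bar> * g' \<xi>)"
      and eq: "AE x in lborel. \<i> * u' t x - w x = complex_of_real (\<mu> * (cmod (u t x))\<^sup>2) * u t x"
      using u'(4) t unfolding is_absD_def by blast
    have "AE \<xi> in lborel. complex_of_real \<bar>\<xi>\<bar> * g' \<xi> = complex_of_real \<bar>\<xi>\<bar> * ?g \<xi>"
      using has_fourier_unique[OF w(1) hf] by eventually_elim simp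
    then have "has_fourier w (\<lambda>\<xi>. complex_of_real \<bar>\<xi>\<bar> * ?g \<xi>)"
      using b(3) by (intro has_fourier_cong_AE[OF w(2)]) auto
    from has_fourier_determines_AE[OF this has_fourier_inv_fourier[OF b(3)]] eq
    show "AE x in lborel. \<i> * u' t x =
          inv_fourier (\<lambda>\<xi>. complex_of_real \<bar>\<xi>\<bar> * ?g \<xi>) x + complex_of_real (\<mu> * (cmod (u t x))\<^sup>2) * u t x"
    proof eventually_elim
      case (elim x)
      then show ?case
        by (metis add.commute diff_add_cancel)
    qed
  qed
  then show ?thesis
    by blast
qed

lemma cubic_Lipschitz:
  fixes a b :: complex
  assumes "cmod a \<le> K" "cmod b \<le> K"
  shows "cmod ((cmod a)\<^sup>2 * a - (cmod b)\<^sup>2 * b) \<le> 3 * K\<^sup>2 * cmod (a - b)"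
proof -
  have K: "K \<ge> 0"
    using assms(1) norm_ge_zero order_trans by blast
  have e: "(cmod a)\<^sup>2 * a - (cmod b)\<^sup>2 * b = (cmod a)\<^sup>2 * (a - b) + of_real (cmod a - cmod b) * of_real (cmod a + cmod b) * b"
    by (simp add: algebra_simps power2_eq_square)
  have "cmod ((cmod a)\<^sup>2 * a - (cmod b)\<^sup>2 * b) \<le> (cmod a)\<^sup>2 * cmod (a - b) + \<bar>cmod a - cmod b\<bar> * (cmod a + cmod b) * cmod b"
    unfolding e by (rule order_trans[OF norm_triangle_ineq]) (simp add: norm_mult norm_power del: of_real_add of_real_diff)
  also have "\<dots> \<le> K\<^sup>2 * cmod (a - b) + cmod (a - b) * (K + K) * K"
    using assms K by (intro add_mono mult_mono power_mono norm_triangle_ineq3) auto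
  also have "\<dots> = 3 * K\<^sup>2 * cmod (a - b)"
    by (simp add: power2_eq_square algebra_simps)
  finally show ?thesis .
qed

text \<open>Energy estimate for the difference \<open>h\<close> of two solutions: its squared \<open>L\<^sup>2\<close> norm \<open>E\<close> satisfies
  \<open>E t \<le> L * integral {0..t} E\<close>, because \<open>|D|\<close> is symmetric. Only Fubini is used, so no decay of \<open>h\<close>
  uniform in time is needed.\<close>

theorem hw_solution_unique:
  assumes u: "hw_solution \<mu> T \<phi> u" and v: "hw_solution \<mu> T \<phi> v" and t: "t \<in> {0..T}"
  shows "u t = v t"
proof -
  obtain C1 u' gu where reg_u: "hw_regular \<mu> T u C1 u' gu"
    using hw_solution_regular[OF u] by blast
  have u_facts:
    "C1 \<ge> 0"
    "continuous_on ({0..T} \<times> UNIV) (\<lambda>(t, x). u t x)"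
    "continuous_on ({0..T} \<times> UNIV) (\<lambda>(t, x). u' t x)"
    "\<And>t x. t \<in> {0..T} \<Longrightarrow> ((\<lambda>\<tau>. u \<tau> x) has_vector_derivative u' t x) (at t within {0..T})"
    "\<And>t. t \<in> {0..T} \<Longrightarrow> gu t \<in> borel_measurable borel"
    "\<And>t. t \<in> {0..T} \<Longrightarrow> integrable lborel (\<lambda>\<xi>. (1 + \<xi>\<^sup>2) powr 2 * (cmod (gu t \<xi>))\<^sup>2)"
    "\<And>t. t \<in> {0..T} \<Longrightarrow> H2_mass (gu t) \<le> C1"
    "\<And>t x. t \<in> {0..T} \<Longrightarrow> u t x = inv_fourier (gu t) x"
    "\<And>t. t \<in> {0..T} \<Longrightarrow> AE x in lborel. \<i> * u' t x =
          inv_fourier (\<lambda>\<xi>. complex_of_real \<bar>\<xi>\<bar> * gu t \<xi>) x + complex_of_real (\<mu> * (cmod (u t x))\<^sup>2) * u t x"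
    using reg_u unfolding hw_regular_def by blast+
  obtain C2 v' gv where reg_v: "hw_regular \<mu> T v C2 v' gv"
    using hw_solution_regular[OF v] by blast
  have v_facts:
    "C2 \<ge> 0"
    "continuous_on ({0..T} \<times> UNIV) (\<lambda>(t, x). v t x)"
    "continuous_on ({0..T} \<times> UNIV) (\<lambda>(t, x). v' t x)"
    "\<And>t x. t \<in> {0..T} \<Longrightarrow> ((\<lambda>\<tau>. v \<tau> x) has_vector_derivative v' t x) (at t within {0..T})"
    "\<And>t. t \<in> {0..T} \<Longrightarrow> gv t \<in> borel_measurable borel"
    "\<And>t. t \<in> {0..T} \<Longrightarrow> integrable lborel (\<lambda>\<xi>. (1 + \<xi>\<^sup>2) powr 2 * (cmod (gv t \<xi>))\<^sup>2)"
    "\<And>t. t \<in> {0..T} \<Longrightarrow> H2_mass (gv t) \<le> C2"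
    "\<And>t x. t \<in> {0..T} \<Longrightarrow> v t x = inv_fourier (gv t) x"
    "\<And>t. t \<in> {0..T} \<Longrightarrow> AE x in lborel. \<i> * v' t x =
          inv_fourier (\<lambda>\<xi>. complex_of_real \<bar>\<xi>\<bar> * gv t \<xi>) x + complex_of_real (\<mu> * (cmod (v t x))\<^sup>2) * v t x"
    using reg_v unfolding hw_regular_def by blast+
  define h where "h = (\<lambda>t x. u t x - v t x)"
  define q where "q = (\<lambda>t x. u' t x - v' t x)"
  define g where "g = (\<lambda>t \<xi>. gu t \<xi> - gv t \<xi>)"
  define G where "G = (\<lambda>t \<xi>. complex_of_real \<bar>\<xi>\<bar> * g t \<xi>)"
  define N where "N = (\<lambda>t x. complex_of_real \<mu> * ((cmod (u t x))\<^sup>2 * u t x - (cmod (v t x))\<^sup>2 * v t x))"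
  \<comment> \<open>By \<open>H2_bounds\<close> this dominates the L1 norms of the transforms, hence
    both solutions at every point.\<close>
  define K where "K = max C1 C2 + pi"
  \<comment> \<open>The doubled Lipschitz constant of the nonlinearity; the extra 1 pays for the
    square of \<open>h\<close> when the product of |D|h and \<open>h\<close> is split in
    \<open>P_bd\<close>.\<close>
  define L where "L = 2 * (\<bar>\<mu>\<bar> * (3 * K\<^sup>2)) + 1"
  have L: "L > 0"
    by (simp add: L_def add_nonneg_pos)
  have cont_h: "continuous_on ({0..T} \<times> UNIV) (\<lambda>(t, x). h t x)"
    and cont_q: "continuous_on ({0..T} \<times> UNIV) (\<lambda>(t, x). q t x)"
    using u_facts(2,3) v_facts(2,3) unfolding h_def q_def
    by (auto simp: case_prod_unfold intro!: continuous_intros)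
  have cont_hx: "continuous_on UNIV (h t)" and cont_qx: "continuous_on UNIV (q t)" if "t \<in> {0..T}" for t
    using that continuous_on_slices(1)[OF cont_h] continuous_on_slices(1)[OF cont_q] by auto
  have cont_ht: "continuous_on {0..t} (\<lambda>\<tau>. h \<tau> x)" and cont_qt: "continuous_on {0..t} (\<lambda>\<tau>. q \<tau> x)" if "t \<in> {0..T}" for t x
    using that continuous_on_subset[OF continuous_on_slices(2)[OF cont_h], of "{0..t}" x]
      continuous_on_subset[OF continuous_on_slices(2)[OF cont_q], of "{0..t}" x] by auto
  have meas_h: "h t \<in> borel_measurable borel" and meas_q: "q t \<in> borel_measurable borel" if "t \<in> {0..T}" for t
    using borel_measurable_continuous_onI[OF cont_hx[OF that]] borel_measurable_continuous_onI[OF cont_qx[OF that]] by auto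
  have facts: "h t x = inv_fourier (g t) x"
    "integrable lborel (g t)" "integrable lborel (\<lambda>\<xi>. (cmod (g t \<xi>))\<^sup>2)" "(\<integral>\<xi>. (cmod (g t \<xi>))\<^sup>2 \<partial>lborel) \<le> 4 * K"
    "integrable lborel (G t)" "integrable lborel (\<lambda>\<xi>. (cmod (G t \<xi>))\<^sup>2)" "(\<integral>\<xi>. (cmod (G t \<xi>))\<^sup>2 \<partial>lborel) \<le> 4 * K"
    "AE x in lborel. \<i> * q t x = inv_fourier (G t) x + N t x"
    "cmod (N t x) \<le> \<bar>\<mu>\<bar> * (3 * K\<^sup>2) * cmod (h t x)"
    if t: "t \<in> {0..T}" for t x
  proof -
    note bu = H2_bounds[OF u_facts(5)[OF t] u_facts(6)[OF t]]
    note bv = H2_bounds[OF v_facts(5)[OF t] v_facts(6)[OF t]]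
    have [measurable]: "gu t \<in> borel_measurable borel" "gv t \<in> borel_measurable borel"
      using u_facts(5)[OF t] v_facts(5)[OF t] by auto
    show "h t x = inv_fourier (g t) x"
      unfolding h_def g_def using t by (simp add: inv_fourier_diff[OF bu(1) bv(1)] u_facts(8) v_facts(8))
    show "integrable lborel (g t)"
      unfolding g_def using bu(1) bv(1) by auto
    have Geq: "G t = (\<lambda>\<xi>. complex_of_real \<bar>\<xi>\<bar> * gu t \<xi> - complex_of_real \<bar>\<xi>\<bar> * gv t \<xi>)"
      by (simp add: G_def g_def right_diff_distrib)
    show "integrable lborel (G t)"
      unfolding Geq using bu(3) bv(3) by auto
    have CK: "2 * C1 + 2 * C2 \<le> 4 * K"
    proof -
      have "C1 \<le> K" "C2 \<le> K"
        by (rule order_trans[OF max.cobounded1[of C1 C2]], simp add: K_def,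
            rule order_trans[OF max.cobounded2[of C2 C1]], simp add: K_def)
      then show ?thesis
        by simp
    qed
    have i1: "integrable lborel (\<lambda>\<xi>. 2 * (cmod (gu t \<xi>))\<^sup>2 + 2 * (cmod (gv t \<xi>))\<^sup>2)"
      using bu(5) bv(5) by auto
    have b1: "norm ((cmod (g t \<xi>))\<^sup>2) \<le> 2 * (cmod (gu t \<xi>))\<^sup>2 + 2 * (cmod (gv t \<xi>))\<^sup>2" for \<xi>
      using cmod_diff_square_le[of "gu t \<xi>" "gv t \<xi>"] by (simp add: g_def)
    note d1 = integrable_dominated[OF _ i1 b1]
    show "integrable lborel (\<lambda>\<xi>. (cmod (g t \<xi>))\<^sup>2)"
      by (rule d1(1)) (simp add: g_def)
    have "(\<integral>\<xi>. (cmod (g t \<xi>))\<^sup>2 \<partial>lborel) \<le> 2 * H2_mass (gu t) + 2 * H2_mass (gv t)"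
      using d1(2) bu(5,6) bv(5,6) by (simp add: g_def)
    then show "(\<integral>\<xi>. (cmod (g t \<xi>))\<^sup>2 \<partial>lborel) \<le> 4 * K"
      using u_facts(7)[OF t] v_facts(7)[OF t] CK by linarith
    have i2: "integrable lborel (\<lambda>\<xi>. 2 * (cmod (complex_of_real \<bar>\<xi>\<bar> * gu t \<xi>))\<^sup>2 + 2 * (cmod (complex_of_real \<bar>\<xi>\<bar> * gv t \<xi>))\<^sup>2)"
      using bu(7) bv(7) by auto
    have b2: "norm ((cmod (G t \<xi>))\<^sup>2) \<le> 2 * (cmod (complex_of_real \<bar>\<xi>\<bar> * gu t \<xi>))\<^sup>2 + 2 * (cmod (complex_of_real \<bar>\<xi>\<bar> * gv t \<xi>))\<^sup>2" for \<xi>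
      using cmod_diff_square_le[of "complex_of_real \<bar>\<xi>\<bar> * gu t \<xi>" "complex_of_real \<bar>\<xi>\<bar> * gv t \<xi>"] by (simp add: Geq)
    note d2 = integrable_dominated[OF _ i2 b2]
    show "integrable lborel (\<lambda>\<xi>. (cmod (G t \<xi>))\<^sup>2)"
      by (rule d2(1)) (simp add: Geq)
    have "(\<integral>\<xi>. (cmod (G t \<xi>))\<^sup>2 \<partial>lborel) \<le> 2 * H2_mass (gu t) + 2 * H2_mass (gv t)"
    proof -
      have "(\<integral>\<xi>. norm ((cmod (G t \<xi>))\<^sup>2) \<partial>lborel) \<le> 2 * (\<integral>\<xi>. (cmod (complex_of_real \<bar>\<xi>\<bar> * gu t \<xi>))\<^sup>2 \<partial>lborel) + 2 * (\<integral>\<xi>. (cmod (complex_of_real \<bar>\<xi>\<bar> * gv t \<xi>))\<^sup>2 \<partial>lborel)"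
        using d2(2) bu(7) bv(7) by (simp add: Geq)
      then show ?thesis
        using bu(8) bv(8) by simp
    qed
    then show "(\<integral>\<xi>. (cmod (G t \<xi>))\<^sup>2 \<partial>lborel) \<le> 4 * K"
      using u_facts(7)[OF t] v_facts(7)[OF t] CK by linarith
    show "AE x in lborel. \<i> * q t x = inv_fourier (G t) x + N t x"
      using u_facts(9)[OF t] v_facts(9)[OF t]
      unfolding Geq inv_fourier_diff[OF bu(3) bv(3)]
      by eventually_elim (simp add: q_def N_def right_diff_distrib mult.assoc)
    have bd: "cmod (inv_fourier f x) \<le> K" if "(\<integral>\<xi>. cmod (f \<xi>) \<partial>lborel) \<le> K" for f
    proof -
      have "(\<integral>\<xi>. cmod (f \<xi>) \<partial>lborel) / (2 * pi) \<le> (\<integral>\<xi>. cmod (f \<xi>) \<partial>lborel) / 1"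
        using pi_gt3 by (intro divide_left_mono) (auto intro!: integral_nonneg)
      then show ?thesis
        using norm_inv_fourier_le[of f x] that by simp
    qed
    have HK: "H2_mass (gu t) + pi \<le> K" "H2_mass (gv t) + pi \<le> K"
      using u_facts(7)[OF t] v_facts(7)[OF t] by (auto simp: K_def)
    have "cmod (u t x) \<le> K" "cmod (v t x) \<le> K"
      unfolding u_facts(8)[OF t] v_facts(8)[OF t]
      by (rule bd[OF order_trans[OF bu(2) HK(1)]], rule bd[OF order_trans[OF bv(2) HK(2)]])
    from cubic_Lipschitz[OF this] show "cmod (N t x) \<le> \<bar>\<mu>\<bar> * (3 * K\<^sup>2) * cmod (h t x)"
      unfolding N_def h_def norm_mult norm_of_real mult.assoc by (intro mult_left_mono) (auto simp: mult.assoc)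
  qed
  define E where "E = (\<lambda>t. \<integral>x. (cmod (h t x))\<^sup>2 \<partial>lborel)"
  \<comment> \<open>The time derivative of \<open>(cmod (h t x))^2\<close>.\<close>
  define P where "P = (\<lambda>t x. 2 * Re (q t x * cnj (h t x)))"
  have h2: "integrable lborel (\<lambda>x. (cmod (h t x))\<^sup>2)" and E_bd: "E t \<le> 4 * K" if "t \<in> {0..T}" for t
    unfolding E_def facts(1)[OF that]
    using Bessel_inv_fourier[OF facts(2,3)[OF that]] facts(4)[OF that] by auto
  have w2: "integrable lborel (\<lambda>x. (cmod (inv_fourier (G t) x))\<^sup>2)" and w2_bd: "(\<integral>x. (cmod (inv_fourier (G t) x))\<^sup>2 \<partial>lborel) \<le> 4 * K"
    if "t \<in> {0..T}" for t
    using Bessel_inv_fourier[OF facts(5,6)[OF that]] facts(7)[OF that] by auto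
  define M where "M = \<bar>\<mu>\<bar> * (3 * K\<^sup>2)"
  have M: "M \<ge> 0"
    by (simp add: M_def)
  have P_bd: "AE x in lborel. \<bar>P t x\<bar> \<le> (cmod (inv_fourier (G t) x))\<^sup>2 + L * (cmod (h t x))\<^sup>2" if t: "t \<in> {0..T}" for t
    using facts(8)[OF t]
  proof eventually_elim
    fix x
    assume eq: "\<i> * q t x = inv_fourier (G t) x + N t x"
    have "cmod (q t x) = cmod (\<i> * q t x)"
      by (simp add: norm_mult)
    also have "\<dots> \<le> cmod (inv_fourier (G t) x) + M * cmod (h t x)"
      unfolding eq M_def by (rule order_trans[OF norm_triangle_ineq]) (use facts(9)[OF t] in simp)
    finally have "2 * (cmod (q t x) * cmod (h t x)) \<le> 2 * ((cmod (inv_fourier (G t) x) + M * cmod (h t x)) * cmod (h t x))"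
      by (simp add: mult_right_mono)
    also have "\<dots> \<le> (cmod (inv_fourier (G t) x))\<^sup>2 + L * (cmod (h t x))\<^sup>2"
      using sum_squares_bound[of "cmod (inv_fourier (G t) x)" "cmod (h t x)"]
      by (simp add: L_def M_def algebra_simps power2_eq_square)
    finally show "\<bar>P t x\<bar> \<le> (cmod (inv_fourier (G t) x))\<^sup>2 + L * (cmod (h t x))\<^sup>2"
      using abs_Re_le_cmod[of "q t x * cnj (h t x)"] by (simp add: P_def norm_mult abs_mult)
  qed
  have P_meas: "P t \<in> borel_measurable borel" if "t \<in> {0..T}" for t
    using meas_h[OF that] meas_q[OF that] unfolding P_def by measurable
  have P_int: "integrable lborel (P t)" and P_norm: "(\<integral>x. norm (P t x) \<partial>lborel) \<le> 4 * K + L * (4 * K)" if t: "t \<in> {0..T}" for t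
  proof -
    have i: "integrable lborel (\<lambda>x. (cmod (inv_fourier (G t) x))\<^sup>2 + L * (cmod (h t x))\<^sup>2)"
      using w2[OF t] h2[OF t] by auto
    show *: "integrable lborel (P t)"
      using P_meas[OF t] P_bd[OF t] L
      by (intro Bochner_Integration.integrable_bound[OF i]) auto
    have "(\<integral>x. norm (P t x) \<partial>lborel) \<le> (\<integral>x. (cmod (inv_fourier (G t) x))\<^sup>2 + L * (cmod (h t x))\<^sup>2 \<partial>lborel)"
      using P_bd[OF t] by (intro integral_mono_AE integrable_norm * i) auto
    also have "\<dots> = (\<integral>x. (cmod (inv_fourier (G t) x))\<^sup>2 \<partial>lborel) + L * E t"
      using w2[OF t] h2[OF t] by (simp add: E_def)
    also have "\<dots> \<le> 4 * K + L * (4 * K)"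
      using w2_bd[OF t] E_bd[OF t] L by (intro add_mono mult_left_mono) auto
    finally show "(\<integral>x. norm (P t x) \<partial>lborel) \<le> 4 * K + L * (4 * K)" .
  qed
  have P_le: "(\<integral>x. P t x \<partial>lborel) \<le> L * E t" if t: "t \<in> {0..T}" for t
  proof -
    let ?w = "inv_fourier (G t)"
    have wm: "?w \<in> borel_measurable borel"
      using borel_measurable_inv_fourier[of "G t"] facts(5)[OF t] by auto
    have Z: "integrable lborel (\<lambda>x. ?w x * cnj (h t x))"
      by (rule integrable_mult_cnj[OF wm meas_h[OF t] w2[OF t] h2[OF t]])
    \<comment> \<open>Writing twice the real part of \<open>q * cnj h\<close> as twice the imaginary
      part of \<open>\<i> * q * cnj h\<close>, the contribution of |D| is the imaginary part of a
      real pairing.\<close>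
    have Im0: "Im (\<integral>x. ?w x * cnj (h t x) \<partial>lborel) = 0"
      using absD_symmetric[OF facts(2,3)[OF t] facts(5,6)[OF t, unfolded G_def]]
      unfolding facts(1)[OF t] G_def .
    have "(\<integral>x. P t x \<partial>lborel) \<le> (\<integral>x. 2 * Im (?w x * cnj (h t x)) + L * (cmod (h t x))\<^sup>2 \<partial>lborel)"
    proof (rule integral_mono_AE[OF P_int[OF t]])
      show "integrable lborel (\<lambda>x. 2 * Im (?w x * cnj (h t x)) + L * (cmod (h t x))\<^sup>2)"
        by (intro Bochner_Integration.integrable_add integrable_mult_right integrable_Im[OF Z] h2[OF t])
      show "AE x in lborel. P t x \<le> 2 * Im (?w x * cnj (h t x)) + L * (cmod (h t x))\<^sup>2"
        using facts(8)[OF t]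
      proof eventually_elim
        fix x
        assume eq: "\<i> * q t x = ?w x + N t x"
        have "P t x = 2 * Im (\<i> * q t x * cnj (h t x))"
          by (simp add: P_def)
        also have "\<dots> = 2 * Im (?w x * cnj (h t x)) + 2 * Im (N t x * cnj (h t x))"
          unfolding eq by (simp add: algebra_simps)
        also have "Im (N t x * cnj (h t x)) \<le> cmod (N t x) * cmod (h t x)"
          using abs_Im_le_cmod[of "N t x * cnj (h t x)"] unfolding norm_mult complex_mod_cnj by linarith
        also have "\<dots> \<le> (M * cmod (h t x)) * cmod (h t x)"
          using facts(9)[OF t] unfolding M_def by (intro mult_right_mono) auto
        also have "2 * Im (?w x * cnj (h t x)) + 2 * ((M * cmod (h t x)) * cmod (h t x))
            \<le> 2 * Im (?w x * cnj (h t x)) + L * (cmod (h t x))\<^sup>2"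
          by (simp add: L_def M_def algebra_simps power2_eq_square)
        finally show "P t x \<le> 2 * Im (?w x * cnj (h t x)) + L * (cmod (h t x))\<^sup>2"
          by simp
      qed
    qed
    also have "\<dots> = (\<integral>x. 2 * Im (?w x * cnj (h t x)) \<partial>lborel) + (\<integral>x. L * (cmod (h t x))\<^sup>2 \<partial>lborel)"
      by (intro Bochner_Integration.integral_add integrable_mult_right integrable_Im[OF Z] h2[OF t])
    also have "\<dots> = 2 * Im (\<integral>x. ?w x * cnj (h t x) \<partial>lborel) + L * E t"
      by (simp only: integral_mult_right_zero integral_Im[OF Z] E_def)
    finally show ?thesis
      using Im0 by simp
  qed
  have h_FTC: "(cmod (h t x))\<^sup>2 = (\<integral>\<tau>. indicator {0..t} \<tau> * P \<tau> x \<partial>lborel)" if t: "t \<in> {0..T}" for t x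
  proof -
    have "(\<integral>\<tau>. indicator {0..t} \<tau> *\<^sub>R P \<tau> x \<partial>lborel) = Re (h t x * cnj (h t x)) - Re (h 0 x * cnj (h 0 x))"
    proof (rule integral_FTC_atLeastAtMost)
      show "0 \<le> t"
        using t by simp
      show "continuous_on {0..t} (\<lambda>\<tau>. P \<tau> x)"
        unfolding P_def by (intro continuous_intros cont_ht[OF t] cont_qt[OF t])
      fix \<tau>
      assume \<tau>: "0 \<le> \<tau>" "\<tau> \<le> t"
      have D: "((\<lambda>\<tau>. h \<tau> x) has_vector_derivative q \<tau> x) (at \<tau> within {0..t})"
        unfolding h_def q_def using \<tau> t
        by (intro has_vector_derivative_diff has_vector_derivative_within_subset[OF u_facts(4)]
            has_vector_derivative_within_subset[OF v_facts(4)]) auto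
      have "((\<lambda>\<tau>. h \<tau> x * cnj (h \<tau> x)) has_vector_derivative (h \<tau> x * cnj (q \<tau> x) + q \<tau> x * cnj (h \<tau> x))) (at \<tau> within {0..t})"
        by (intro has_vector_derivative_mult D has_vector_derivative_cnj)
      from bounded_linear.has_vector_derivative[OF bounded_linear_Re this]
      show "((\<lambda>\<tau>. Re (h \<tau> x * cnj (h \<tau> x))) has_vector_derivative P \<tau> x) (at \<tau> within {0..t})"
        by (simp add: P_def mult.commute)
    qed
    moreover have "h 0 x = 0"
      using u v by (simp add: h_def hw_solution_def)
    moreover have "Re (h t x * cnj (h t x)) = (cmod (h t x))\<^sup>2"
      by (simp add: complex_norm_square[symmetric] del: complex_mult_cnj)
    ultimately show ?thesis
      by simp
  qed
  \<comment> \<open>Joint continuity gives measurability in both variables, and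
    \<open>P_norm\<close>, uniform in time, gives integrability on the strip; so the time integral
    of \<open>P\<close> may be exchanged with the one in space.\<close>
  have E_int: "integrable lborel (\<lambda>\<tau>. indicator {0..t} \<tau> * (\<integral>x. P \<tau> x \<partial>lborel))"
    and E_eq: "E t = (\<integral>\<tau>. indicator {0..t} \<tau> * (\<integral>x. P \<tau> x \<partial>lborel) \<partial>lborel)" if t: "t \<in> {0..T}" for t
  proof -
    let ?f = "\<lambda>(\<tau>, x). indicator {0..t} \<tau> * P \<tau> x"
    have sub: "{0..t} \<times> UNIV \<subseteq> {0..T} \<times> (UNIV :: real set)"
      using t by auto
    have "continuous_on ({0..t} \<times> UNIV) (\<lambda>(\<tau>, x). P \<tau> x)"
      using continuous_on_subset[OF cont_h sub] continuous_on_subset[OF cont_q sub]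
      unfolding P_def case_prod_unfold by (intro continuous_intros)
    then have "(\<lambda>z. indicator ({0..t} \<times> UNIV) z *\<^sub>R (case z of (\<tau>, x) \<Rightarrow> P \<tau> x)) \<in> borel_measurable borel"
      by (intro borel_measurable_continuous_on_indicator) (auto intro!: borel_closed closed_Times)
    moreover have "(\<lambda>z. indicator ({0..t} \<times> UNIV) z *\<^sub>R (case z of (\<tau>, x) \<Rightarrow> P \<tau> x)) = ?f"
      by (auto simp: indicator_def fun_eq_iff)
    ultimately have meas: "?f \<in> borel_measurable (lborel \<Otimes>\<^sub>M lborel)"
      by (simp add: lborel_prod)
    have bd: "norm (\<integral>x. norm (?f (\<tau>, x)) \<partial>lborel) \<le> indicator {0..t} \<tau> * (4 * K + L * (4 * K))" for \<tau>
      using P_norm[of \<tau>] t by (auto simp: indicator_def)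
    have int: "integrable (lborel \<Otimes>\<^sub>M lborel) ?f"
    proof (rule lborel_pair.Fubini_integrable[OF meas])
      show "integrable lborel (\<lambda>\<tau>. \<integral>x. norm (?f (\<tau>, x)) \<partial>lborel)"
      proof (rule integrable_dominated(1)[OF _ _ bd])
        have "(\<lambda>(\<tau>, x). norm (?f (\<tau>, x))) \<in> borel_measurable (lborel \<Otimes>\<^sub>M lborel)"
          using meas by (simp add: case_prod_unfold)
        then show "(\<lambda>\<tau>. \<integral>x. norm (?f (\<tau>, x)) \<partial>lborel) \<in> borel_measurable borel"
          using lborel.borel_measurable_lebesgue_integral[of "\<lambda>\<tau> x. norm (?f (\<tau>, x))" lborel] by simp
        show "integrable lborel (\<lambda>\<tau>. indicator {0..t} \<tau> * (4 * K + L * (4 * K)))"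
          by (intro integrable_mult_left integrable_real_indicator) (auto simp: emeasure_lborel_Icc_eq)
      qed
      show "AE \<tau> in lborel. integrable lborel (\<lambda>x. ?f (\<tau>, x))"
        using P_int t by (intro AE_I2) (auto simp: indicator_def)
    qed
    show "integrable lborel (\<lambda>\<tau>. indicator {0..t} \<tau> * (\<integral>x. P \<tau> x \<partial>lborel))"
      using lborel_pair.integrable_fst[OF int] by simp
    show "E t = (\<integral>\<tau>. indicator {0..t} \<tau> * (\<integral>x. P \<tau> x \<partial>lborel) \<partial>lborel)"
      unfolding E_def h_FTC[OF t] using lborel_pair.Fubini_integral[OF int] by simp
  qed
  have K: "K \<ge> 0"
    using u_facts(1) pi_ge_zero by (simp add: K_def)
  \<comment> \<open>Gronwall by iteration: against the weight \<open>exp (2 * L * t)\<close>, each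
    application of the integral inequality halves the constant.\<close>
  have step: "\<forall>t\<in>{0..T}. E t \<le> 4 * K / 2 ^ n * exp (2 * L * t)" for n
  proof (induction n)
    case 0
    show ?case
    proof
      fix t
      assume t: "t \<in> {0..T}"
      have "E t \<le> 4 * K * 1"
        using E_bd[OF t] by simp
      also have "\<dots> \<le> 4 * K * exp (2 * L * t)"
        using K L t by (intro mult_left_mono) auto
      finally show "E t \<le> 4 * K / 2 ^ 0 * exp (2 * L * t)"
        by simp
    qed
  next
    case (Suc n)
    show ?case
    proof
      fix t
      assume t: "t \<in> {0..T}"
      let ?S = "4 * K / 2 ^ n"
      have S: "?S \<ge> 0"
        using K by simp
      have FTC: "(\<integral>\<tau>. indicator {0..t} \<tau> *\<^sub>R (L * (?S * exp (2 * L * \<tau>))) \<partial>lborel) = ?S / 2 * exp (2 * L * t) - ?S / 2 * exp (2 * L * 0)"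
      proof (rule integral_FTC_atLeastAtMost)
        show "0 \<le> t"
          using t by simp
        show "continuous_on {0..t} (\<lambda>\<tau>. L * (?S * exp (2 * L * \<tau>)))"
          by (intro continuous_intros)
        show "((\<lambda>\<tau>. ?S / 2 * exp (2 * L * \<tau>)) has_vector_derivative L * (?S * exp (2 * L * \<tau>))) (at \<tau> within {0..t})" for \<tau>
          unfolding has_real_derivative_iff_has_vector_derivative[symmetric]
          by (auto intro!: derivative_eq_intros)
      qed
      have "E t = (\<integral>\<tau>. indicator {0..t} \<tau> * (\<integral>x. P \<tau> x \<partial>lborel) \<partial>lborel)"
        by (rule E_eq[OF t])
      also have "\<dots> \<le> (\<integral>\<tau>. indicator {0..t} \<tau> *\<^sub>R (L * (?S * exp (2 * L * \<tau>))) \<partial>lborel)"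
      proof (rule integral_mono[OF E_int[OF t]])
        have "continuous_on {0..t} (\<lambda>\<tau>. L * (?S * exp (2 * L * \<tau>)))"
          by (intro continuous_intros)
        then show "integrable lborel (\<lambda>\<tau>. indicator {0..t} \<tau> *\<^sub>R (L * (?S * exp (2 * L * \<tau>))))"
          using borel_integrable_atLeastAtMost'[of 0 t "\<lambda>\<tau>. L * (?S * exp (2 * L * \<tau>))"] by (simp add: set_integrable_def)
        fix \<tau>
        show "indicator {0..t} \<tau> * (\<integral>x. P \<tau> x \<partial>lborel) \<le> indicator {0..t} \<tau> *\<^sub>R (L * (?S * exp (2 * L * \<tau>)))"
        proof (cases "\<tau> \<in> {0..t}")
          case True
          then have \<tau>: "\<tau> \<in> {0..T}"
            using t by auto
          have "(\<integral>x. P \<tau> x \<partial>lborel) \<le> L * E \<tau>"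
            by (rule P_le[OF \<tau>])
          also have "\<dots> \<le> L * (?S * exp (2 * L * \<tau>))"
            using Suc.IH \<tau> L by (intro mult_left_mono) auto
          finally show ?thesis
            using True by simp
        qed simp
      qed
      also have "\<dots> \<le> ?S / 2 * exp (2 * L * t)"
        unfolding FTC using S by simp
      finally show "E t \<le> 4 * K / 2 ^ Suc n * exp (2 * L * t)"
        by (simp add: mult.commute)
    qed
  qed
  have "(\<lambda>n. 4 * K * exp (2 * L * t) * (1 / 2) ^ n) \<longlonglongrightarrow> 4 * K * exp (2 * L * t) * 0"
    by (intro tendsto_intros LIMSEQ_power_zero) simp
  moreover have "E t \<le> 4 * K * exp (2 * L * t) * (1 / 2) ^ n" for n
    using step[rule_format, OF t, of n] by (simp add: power_one_over field_simps)
  ultimately have "E t \<le> 4 * K * exp (2 * L * t) * 0"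
    by (intro LIMSEQ_le_const) auto
  moreover have "E t \<ge> 0"
    unfolding E_def by (rule Bochner_Integration.integral_nonneg) simp
  ultimately have "E t = 0"
    by simp
  then have "AE x in lborel. (cmod (h t x))\<^sup>2 = 0"
    using h2[OF t] unfolding E_def by (subst (asm) integral_nonneg_eq_0_iff_AE) auto
  then have "AE x in lborel. h t x = 0"
    by eventually_elim simp
  then have "h t x = 0" for x
    by (rule AE_eq_continuous_imp_eq[OF cont_hx[OF t] continuous_on_const])
  then show ?thesis
    by (simp add: h_def fun_eq_iff)
qed

subsection \<open>The weight\<close>

definition conv :: "(real \<Rightarrow> 'a) \<Rightarrow> (real \<Rightarrow> 'a) \<Rightarrow> real \<Rightarrow> 'a::{real_normed_algebra, banach, second_countable_topology}" where
  "conv f h \<xi> = (\<integral>\<eta>. f \<eta> * h (\<xi> - \<eta>) \<partial>lborel)"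

text \<open>Functions bounded by a multiple of \<open>W\<close> then form an algebra under
  convolution. Evenness makes it stable under the reflected conjugate occurring in the nonlinearity,
  and the decay clause puts its continuous elements into every Sobolev space.\<close>

definition conv_weight :: "(real \<Rightarrow> real) \<Rightarrow> real \<Rightarrow> bool" where
  "conv_weight W K \<longleftrightarrow> 0 < K \<and> continuous_on UNIV W \<and> (\<forall>\<xi>. 0 < W \<xi> \<and> W \<xi> \<le> 1 \<and> W (- \<xi>) = W \<xi> \<and> conv W W \<xi> \<le> K * W \<xi>) \<and>
    (\<forall>\<sigma>. \<exists>C. \<forall>\<xi>. (1 + \<xi>\<^sup>2) powr \<sigma> * W \<xi> \<le> C)"

text \<open>Divide \<open>1 + C <= 2 * ((1 + A) + (1 + B))\<close> by the three factors. The factor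
  2 in the hypothesis is what squaring a subadditive quantity costs.\<close>

lemma inverse_quasi_submult:
  fixes A B C :: real
  assumes "A \<ge> 0" "B \<ge> 0" "C \<ge> 0" "C \<le> 2 * A + 2 * B"
  shows "1 / (1 + A) * (1 / (1 + B)) \<le> 2 * (1 / (1 + C)) * (1 / (1 + A) + 1 / (1 + B))"
proof -
  have "1 / (1 + A) * (1 / (1 + B)) = (1 + C) / ((1 + C) * ((1 + A) * (1 + B)))"
    using assms by simp
  also have "\<dots> \<le> (2 * ((1 + A) + (1 + B))) / ((1 + C) * ((1 + A) * (1 + B)))"
    using assms by (intro divide_right_mono) auto
  also have "\<dots> = 2 * (1 / (1 + C)) * (1 / (1 + A) + 1 / (1 + B))"
    using assms by (simp add: add_frac_eq add.commute)
  finally show ?thesis .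
qed

lemma square_add_le: "(a + b)\<^sup>2 \<le> 2 * a\<^sup>2 + 2 * b\<^sup>2" for a b :: real
  using sum_squares_bound[of a b] by (simp add: power2_sum)

text \<open>Periodic with period \<open>N\<close>. Up to constants the denominator is 1 plus the
  squared distance to the nearest multiple of \<open>N\<close>, so the teeth have unit width; the
  sine provides this distance in a form with an addition theorem.\<close>

definition comb :: "real \<Rightarrow> real \<Rightarrow> real" where
  "comb N x = 1 / (1 + N\<^sup>2 * (sin (pi * x / N))\<^sup>2)"

text \<open>Makes the sum over all teeth converge. The exponential factor of \<open>weight\<close>
  could not do so: for \<open>a\<close> and \<open>b\<close> of the same sign it is exactly
  multiplicative and leaves no decay to integrate. Its task is decay beyond every power.\<close>

definition envelope :: "real \<Rightarrow> real \<Rightarrow> real" where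
  "envelope N x = 1 / (1 + (x / N)\<^sup>2)"

text \<open>Concentrated near the multiples of \<open>N\<close>. Each of the three factors is quasi-submultiplicative, so that
  \<open>weight * weight \<le> K weight\<close> for the convolution, with \<open>K\<close> independent of \<open>N\<close>; nevertheless the values
  at \<open>N\<close> and \<open>2N\<close> are bounded below.\<close>

definition weight :: "real \<Rightarrow> real \<Rightarrow> real" where
  "weight N x = exp (- \<bar>x\<bar> / N) * envelope N x * comb N x"

lemma comb_bounds: "0 < comb N x" "comb N x \<le> 1"
  by (auto simp: comb_def add_pos_nonneg divide_le_eq_1)

lemma envelope_bounds: "0 < envelope N x" "envelope N x \<le> 1"
  by (auto simp: envelope_def add_pos_nonneg divide_le_eq_1)

lemma comb_minus: "comb N (- x) = comb N x"
  by (simp add: comb_def)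

lemma envelope_minus: "envelope N (- x) = envelope N x"
  by (simp add: envelope_def)

lemma continuous_on_comb: "continuous_on S (comb N)"
  unfolding comb_def
  by (cases "N = 0") (auto intro!: continuous_intros simp: add_nonneg_eq_0_iff)

lemma continuous_on_envelope: "continuous_on S (envelope N)"
  unfolding envelope_def
  by (cases "N = 0") (auto intro!: continuous_intros simp: add_nonneg_eq_0_iff)

lemma continuous_on_weight: "N > 0 \<Longrightarrow> continuous_on S (weight N)"
  unfolding weight_def
  by (intro continuous_intros continuous_on_comb continuous_on_envelope) auto

lemma borel_measurable_comb [measurable]: "comb N \<in> borel_measurable borel"
  by (intro borel_measurable_continuous_onI continuous_on_comb)

lemma borel_measurable_envelope [measurable]: "envelope N \<in> borel_measurable borel"
  by (intro borel_measurable_continuous_onI continuous_on_envelope)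

text \<open>The modulus of the sine is subadditive, so its square is subadditive up to the factor
  2.\<close>

lemma comb_quasi_submult: "comb N a * comb N b \<le> 2 * comb N (a + b) * (comb N a + comb N b)"
  unfolding comb_def
proof (rule inverse_quasi_submult)
  let ?a = "pi * a / N" and ?b = "pi * b / N"
  have "\<bar>sin (?a + ?b)\<bar> \<le> \<bar>sin ?a * cos ?b\<bar> + \<bar>cos ?a * sin ?b\<bar>"
    unfolding sin_add by (rule abs_triangle_ineq)
  also have "\<dots> \<le> \<bar>sin ?a\<bar> * 1 + 1 * \<bar>sin ?b\<bar>"
    unfolding abs_mult by (intro add_mono mult_mono) auto
  finally have "(sin (?a + ?b))\<^sup>2 \<le> (\<bar>sin ?a\<bar> + \<bar>sin ?b\<bar>)\<^sup>2"
    by (simp add: abs_le_square_iff[symmetric])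
  also have "\<dots> \<le> 2 * (sin ?a)\<^sup>2 + 2 * (sin ?b)\<^sup>2"
    using square_add_le[of "\<bar>sin ?a\<bar>" "\<bar>sin ?b\<bar>"] by simp
  finally have "N\<^sup>2 * (sin (?a + ?b))\<^sup>2 \<le> N\<^sup>2 * (2 * (sin ?a)\<^sup>2 + 2 * (sin ?b)\<^sup>2)"
    by (rule mult_left_mono) simp
  then show "N\<^sup>2 * (sin (pi * (a + b) / N))\<^sup>2 \<le> 2 * (N\<^sup>2 * (sin ?a)\<^sup>2) + 2 * (N\<^sup>2 * (sin ?b)\<^sup>2)"
    by (simp add: distrib_left add_divide_distrib mult_ac)
qed auto

lemma envelope_quasi_submult: "envelope N a * envelope N b \<le> 2 * envelope N (a + b) * (envelope N a + envelope N b)"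
  unfolding envelope_def
  by (rule inverse_quasi_submult) (use square_add_le[of "a / N" "b / N"] in \<open>auto simp: add_divide_distrib\<close>)

text \<open>A weak form of Jordan's inequality; the constant \<open>1 / pi\<close> is what cancels
  the \<open>pi\<close> inside \<open>comb\<close>. Up to \<open>pi / 3\<close> the cosine is at
  least 1/2, and beyond that the sine is at least 1/2, which dominates
  \<open>\<theta> / pi\<close>.\<close>

lemma sin_lower_bound:
  assumes "\<bar>\<theta>\<bar> \<le> pi / 2"
  shows "\<bar>\<theta>\<bar> / pi \<le> \<bar>sin \<theta>\<bar>"
proof -
  have *: "\<theta> / pi \<le> sin \<theta>" if "0 \<le> \<theta>" "\<theta> \<le> pi / 2" for \<theta>
  proof (cases "\<theta> \<le> pi / 3")
    case True
    have "sin 0 - 0 / 2 \<le> sin \<theta> - \<theta> / 2"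
    proof (rule DERIV_nonneg_imp_nondecreasing[OF that(1)])
      fix x
      assume x: "0 \<le> x" "x \<le> \<theta>"
      have "((\<lambda>x. sin x - x / 2) has_real_derivative cos x - 1 / 2) (at x)"
        by (auto intro!: derivative_eq_intros)
      moreover have "cos (pi / 3) \<le> cos x"
        using x True pi_gt_zero by (intro cos_monotone_0_pi_le) auto
      ultimately show "\<exists>y. ((\<lambda>x. sin x - x / 2) has_real_derivative y) (at x) \<and> 0 \<le> y"
        by (auto simp: cos_60)
    qed
    moreover have "\<theta> / pi \<le> \<theta> / 2"
      using that pi_gt3 by (intro divide_left_mono) auto
    ultimately show ?thesis
      unfolding sin_zero by linarith
  next
    case False
    have "\<theta> / pi \<le> 1 / 2"
      using that pi_gt_zero by (simp add: field_simps)
    also have "1 / 2 \<le> sin (pi / 6)"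
      by (simp add: sin_30)
    also have "\<dots> \<le> sin \<theta>"
      using that False pi_gt_zero by (intro sin_monotone_2pi_le) auto
    finally show ?thesis .
  qed
  show ?thesis
    using *[of "\<bar>\<theta>\<bar>"] assms by (cases "\<theta> \<ge> 0") (auto intro: order_trans)
qed

lemma comb_le_near_0:
  assumes "N > 0" "\<bar>x\<bar> \<le> N / 2"
  shows "comb N x \<le> 1 / (1 + x\<^sup>2)"
proof -
  have "\<bar>pi * x / N\<bar> / pi \<le> \<bar>sin (pi * x / N)\<bar>"
    using assms pi_gt_zero by (intro sin_lower_bound) (auto simp: abs_mult field_simps)
  then have "\<bar>x\<bar> \<le> \<bar>N * sin (pi * x / N)\<bar>"
    using assms pi_gt_zero by (simp add: abs_mult field_simps)
  then have "x\<^sup>2 \<le> (N * sin (pi * x / N))\<^sup>2"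
    by (simp add: abs_le_square_iff)
  then show ?thesis
    unfolding comb_def by (intro divide_left_mono) (auto simp: power_mult_distrib add_pos_nonneg)
qed

lemma comb_periodic: "N > 0 \<Longrightarrow> comb N (x - N) = comb N x"
  by (simp add: comb_def right_diff_distrib diff_divide_distrib sin_diff)

text \<open>By periodicity all windows of length \<open>N\<close> give the same integral, and on the
  centred one the comb lies below \<open>1 / (1 + x^2)\<close>, whose integral is
  \<open>pi\<close>.\<close>

lemma integral_comb_period:
  assumes N: "N > 0"
  shows "(\<integral>x. indicator {y - N..y} x * comb N x \<partial>lborel) \<le> pi"
proof -
  have "\<exists>G. \<forall>x :: real. -\<infinity> < ereal x \<longrightarrow> ereal x < \<infinity> \<longrightarrow> (G has_vector_derivative comb N x) (at x)"
    by (rule einterval_antiderivative) (use continuous_on_comb[of UNIV N] in \<open>auto simp: continuous_on_eq_continuous_at\<close>)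
  then obtain G where G: "\<And>x. (G has_vector_derivative comb N x) (at x)"
    by auto
  have FTC: "(\<integral>x. indicator {y - N..y} x * comb N x \<partial>lborel) = G y - G (y - N)" for y
  proof -
    have "(\<integral>x. indicator {y - N..y} x *\<^sub>R comb N x \<partial>lborel) = G y - G (y - N)"
      using N by (intro integral_FTC_atLeastAtMost continuous_on_comb has_vector_derivative_at_within[OF G]) auto
    then show ?thesis
      by simp
  qed
  have "((\<lambda>y. G y - G (y - N)) has_real_derivative 0) (at y)" for y
  proof -
    have D: "(G has_real_derivative comb N x) (at x)" for x
      using G by (simp add: has_real_derivative_iff_has_vector_derivative)
    have "((\<lambda>y. G y - G (y - N)) has_real_derivative comb N y - comb N (y - N) * 1) (at y)"
      by (intro DERIV_diff D DERIV_chain2[where g = "\<lambda>y. y - N", OF D]) (auto intro!: derivative_eq_intros)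
    then show ?thesis
      by (simp add: comb_periodic[OF N])
  qed
  then have "G y - G (y - N) = G (N / 2) - G (N / 2 - N)"
    using DERIV_isconst_all[of "\<lambda>y. G y - G (y - N)" y "N / 2"] by blast
  then have "(\<integral>x. indicator {y - N..y} x * comb N x \<partial>lborel) = (\<integral>x. indicator {N / 2 - N..N / 2} x * comb N x \<partial>lborel)"
    by (simp only: FTC)
  also have "\<dots> \<le> (\<integral>x. 1 / (1 + x\<^sup>2) \<partial>lborel)"
  proof (rule integral_mono[OF _ integrable_inverse_one_plus_square])
    show "integrable lborel (\<lambda>x. indicator {N / 2 - N..N / 2} x * comb N x)"
      using borel_integrable_atLeastAtMost'[OF continuous_on_comb, of "N / 2 - N" "N / 2" N] by (simp add: set_integrable_def)
    show "indicator {N / 2 - N..N / 2} x * comb N x \<le> 1 / (1 + x\<^sup>2)" for x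
    proof (cases "x \<in> {N / 2 - N..N / 2}")
      case True
      then show ?thesis
        using comb_le_near_0[OF N, of x] by (auto simp: abs_le_iff)
    qed simp
  qed
  finally show ?thesis
    by (simp add: integral_inverse_one_plus_square)
qed

lemma integral_envelope:
  assumes N: "N > 0"
  shows "(\<integral>\<^sup>+y. ennreal (envelope N (s - y)) \<partial>lborel) = ennreal (pi * N)"
proof -
  have "(\<integral>\<^sup>+y. ennreal (envelope N (s - y)) \<partial>lborel) = (\<integral>\<^sup>+y. ennreal (envelope N y) \<partial>lborel)"
    by (rule nn_integral_real_reflect[where f = "\<lambda>y. ennreal (envelope N y)"]) measurable
  also have "\<dots> = ennreal N * (\<integral>\<^sup>+y. ennreal (1 / (1 + y\<^sup>2)) \<partial>lborel)"
    using nn_integral_real_affine[of "\<lambda>y. ennreal (envelope N y)" N 0] N by (simp add: envelope_def)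
  also have "(\<integral>\<^sup>+y. ennreal (1 / (1 + y\<^sup>2)) \<partial>lborel) = ennreal pi"
    by (subst nn_integral_eq_integral[OF integrable_inverse_one_plus_square])
       (auto simp: integral_inverse_one_plus_square)
  finally show ?thesis
    using N by (simp add: ennreal_mult[symmetric] mult.commute)
qed

text \<open>The envelope varies slowly at scale \<open>N\<close>, so it may be averaged over a period before integrating against the comb.\<close>

lemma nn_integral_comb_envelope:
  assumes N: "N > 0"
  shows "(\<integral>\<^sup>+a. ennreal (comb N a * envelope N (s - a)) \<partial>lborel) \<le> ennreal (3 * pi\<^sup>2)"
proof -
  \<comment> \<open>In the variable divided by \<open>N\<close> the shift is at most 1, and
    \<open>B^2 <= 2 * A^2 + 2\<close> gives the factor 3.\<close>
  have env: "envelope N (s - a) \<le> 3 * envelope N (s - y)" if "a \<le> y" "y \<le> a + N" for a y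
  proof -
    define A where "A = (s - a) / N"
    define B where "B = (s - y) / N"
    have "\<bar>B - A\<bar> \<le> 1"
      using that N by (simp add: A_def B_def diff_divide_distrib[symmetric])
    then have "(B - A)\<^sup>2 \<le> 1"
      by (simp add: abs_square_le_1)
    then have "B\<^sup>2 \<le> 2 * A\<^sup>2 + 2"
      using square_add_le[of A "B - A"] by simp
    then have "(1 + B\<^sup>2) \<le> 3 * (1 + A\<^sup>2)"
      using zero_le_power2[of A] unfolding distrib_left by linarith
    then show ?thesis
      unfolding envelope_def A_def[symmetric] B_def[symmetric]
      by (simp add: divide_simps add_pos_nonneg add_nonneg_eq_0_iff)
  qed
  have avg: "ennreal (envelope N (s - a)) \<le> (\<integral>\<^sup>+y. ennreal (3 / N) * (indicator {a..a + N} y * ennreal (envelope N (s - y))) \<partial>lborel)" for a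
  proof -
    have "ennreal (envelope N (s - a)) = (\<integral>\<^sup>+y. ennreal (envelope N (s - a) / N) * indicator {a..a + N} y \<partial>lborel)"
      using N by (simp add: nn_integral_cmult_indicator ennreal_mult[symmetric] envelope_bounds(1)[THEN less_imp_le])
    also have "\<dots> \<le> (\<integral>\<^sup>+y. ennreal (3 / N) * (indicator {a..a + N} y * ennreal (envelope N (s - y))) \<partial>lborel)"
    proof (intro nn_integral_mono)
      fix y
      show "ennreal (envelope N (s - a) / N) * indicator {a..a + N} y \<le> ennreal (3 / N) * (indicator {a..a + N} y * ennreal (envelope N (s - y)))"
        using env[of a y] N
        by (auto simp: indicator_def ennreal_mult[symmetric] envelope_bounds(1)[THEN less_imp_le] divide_right_mono intro!: ennreal_leI)
    qed
    finally show ?thesis .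
  qed
  have [measurable]: "(\<lambda>(a, y). indicator {a..a + N} y :: ennreal) \<in> borel_measurable (borel \<Otimes>\<^sub>M borel)"
  proof -
    have "(\<lambda>(a, y). indicator {a..a + N} y :: ennreal) = indicator {z. fst z \<le> snd z \<and> snd z \<le> fst z + N}"
      by (auto simp: indicator_def fun_eq_iff)
    moreover have "{z :: real \<times> real. fst z \<le> snd z \<and> snd z \<le> fst z + N} \<in> sets (borel \<Otimes>\<^sub>M borel)"
      unfolding borel_prod by (intro borel_closed closed_Collect_conj closed_Collect_le continuous_intros)
    ultimately show ?thesis
      by (simp add: borel_measurable_indicator)
  qed
  have "(\<integral>\<^sup>+a. ennreal (comb N a * envelope N (s - a)) \<partial>lborel)
    \<le> (\<integral>\<^sup>+a. (\<integral>\<^sup>+y. ennreal (comb N a) * (ennreal (3 / N) * (indicator {a..a + N} y * ennreal (envelope N (s - y)))) \<partial>lborel) \<partial>lborel)"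
  proof (intro nn_integral_mono)
    fix a
    have "ennreal (comb N a * envelope N (s - a)) = ennreal (comb N a) * ennreal (envelope N (s - a))"
      by (simp add: ennreal_mult comb_bounds(1)[THEN less_imp_le] envelope_bounds(1)[THEN less_imp_le])
    also have "\<dots> \<le> ennreal (comb N a) * (\<integral>\<^sup>+y. ennreal (3 / N) * (indicator {a..a + N} y * ennreal (envelope N (s - y))) \<partial>lborel)"
      by (intro mult_left_mono avg) auto
    finally show "ennreal (comb N a * envelope N (s - a)) \<le> (\<integral>\<^sup>+y. ennreal (comb N a) * (ennreal (3 / N) * (indicator {a..a + N} y * ennreal (envelope N (s - y)))) \<partial>lborel)"
      by (simp add: nn_integral_cmult)
  qed
  \<comment> \<open>After the exchange, the inner integral runs over one period of the comb, namely
    \<open>{y - N..y}\<close>.\<close>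
  also have "\<dots> = (\<integral>\<^sup>+y. (\<integral>\<^sup>+a. ennreal (comb N a) * (ennreal (3 / N) * (indicator {a..a + N} y * ennreal (envelope N (s - y)))) \<partial>lborel) \<partial>lborel)"
    by (rule lborel_pair.Fubini'[symmetric]) measurable
  also have "\<dots> \<le> (\<integral>\<^sup>+y. ennreal (3 / N) * ennreal (envelope N (s - y)) * ennreal pi \<partial>lborel)"
  proof (intro nn_integral_mono)
    fix y
    have int: "integrable lborel (\<lambda>a. indicator {y - N..y} a * comb N a)"
      using borel_integrable_atLeastAtMost'[OF continuous_on_comb, of "y - N" y N] by (simp add: set_integrable_def)
    have "(\<integral>\<^sup>+a. ennreal (comb N a) * (ennreal (3 / N) * (indicator {a..a + N} y * ennreal (envelope N (s - y)))) \<partial>lborel)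
      = (\<integral>\<^sup>+a. ennreal (3 / N) * ennreal (envelope N (s - y)) * ennreal (indicator {y - N..y} a * comb N a) \<partial>lborel)"
      by (intro nn_integral_cong) (auto simp: indicator_def mult_ac)
    also have "\<dots> = ennreal (3 / N) * ennreal (envelope N (s - y)) * ennreal (\<integral>a. indicator {y - N..y} a * comb N a \<partial>lborel)"
      using nn_integral_eq_integral[OF int] comb_bounds(1)[of N] by (subst nn_integral_cmult) (auto simp: less_imp_le)
    also have "\<dots> \<le> ennreal (3 / N) * ennreal (envelope N (s - y)) * ennreal pi"
      using integral_comb_period[OF N] by (intro mult_left_mono ennreal_leI) auto
    finally show "(\<integral>\<^sup>+a. ennreal (comb N a) * (ennreal (3 / N) * (indicator {a..a + N} y * ennreal (envelope N (s - y)))) \<partial>lborel)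
      \<le> ennreal (3 / N) * ennreal (envelope N (s - y)) * ennreal pi" .
  qed
  \<comment> \<open>The mass \<open>pi * N\<close> of the envelope cancels the \<open>1 / N\<close>
    of the average, so the bound is uniform in \<open>N\<close>.\<close>
  also have "\<dots> = ennreal (3 / N) * ennreal (pi * N) * ennreal pi"
    by (simp add: nn_integral_cmult nn_integral_multc integral_envelope[OF N])
  also have "\<dots> = ennreal (3 * pi\<^sup>2)"
    using N by (simp add: ennreal_mult[symmetric] power2_eq_square)
  finally show ?thesis .
qed

lemma integral_comb_envelope:
  assumes N: "N > 0"
  shows "integrable lborel (\<lambda>a. comb N a * envelope N (s - a))"
    and "(\<integral>a. comb N a * envelope N (s - a) \<partial>lborel) \<le> 3 * pi\<^sup>2"
proof -
  have nonneg: "0 \<le> comb N a * envelope N (s - a)" for a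
    using comb_bounds(1)[of N a] envelope_bounds(1)[of N "s - a"] by simp
  show *: "integrable lborel (\<lambda>a. comb N a * envelope N (s - a))"
    using nn_integral_comb_envelope[OF N, of s] nonneg
    by (intro integrableI_nonneg) (auto simp: less_top[symmetric] top_unique)
  show "(\<integral>a. comb N a * envelope N (s - a) \<partial>lborel) \<le> 3 * pi\<^sup>2"
    using nn_integral_comb_envelope[OF N, of s] nn_integral_eq_integral[OF *] nonneg
    by (simp add: ennreal_le_iff)
qed

lemma weight_pos: "0 < weight N x"
  by (simp add: weight_def comb_bounds envelope_bounds)

lemma weight_le_1: "N > 0 \<Longrightarrow> weight N x \<le> 1"
  unfolding weight_def using comb_bounds[of N x] envelope_bounds[of N x]
  by (intro mult_le_one mult_nonneg_nonneg) auto

lemma weight_minus: "weight N (- x) = weight N x"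
  by (simp add: weight_def comb_minus envelope_minus)

lemma weight_quasi_submult:
  assumes N: "N > 0"
  shows "weight N a * weight N b \<le> 4 * weight N (a + b) * ((comb N a + comb N b) * (envelope N a + envelope N b))"
proof -
  have e: "exp (- \<bar>a\<bar> / N) * exp (- \<bar>b\<bar> / N) \<le> exp (- \<bar>a + b\<bar> / N)"
  proof -
    have "\<bar>a + b\<bar> / N \<le> \<bar>a\<bar> / N + \<bar>b\<bar> / N"
      using N by (simp add: add_divide_distrib[symmetric] divide_right_mono)
    then show ?thesis
      by (simp add: exp_add[symmetric])
  qed
  note pos = comb_bounds(1)[THEN less_imp_le] envelope_bounds(1)[THEN less_imp_le]
  have "weight N a * weight N b = (exp (- \<bar>a\<bar> / N) * exp (- \<bar>b\<bar> / N)) * ((envelope N a * envelope N b) * (comb N a * comb N b))"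
    by (simp add: weight_def mult_ac)
  also have "\<dots> \<le> exp (- \<bar>a + b\<bar> / N) * ((2 * envelope N (a + b) * (envelope N a + envelope N b)) * (2 * comb N (a + b) * (comb N a + comb N b)))"
    by (intro mult_mono e envelope_quasi_submult comb_quasi_submult mult_nonneg_nonneg add_nonneg_nonneg pos) auto
  also have "\<dots> = 4 * weight N (a + b) * ((comb N a + comb N b) * (envelope N a + envelope N b))"
    by (simp add: weight_def mult_ac)
  finally show ?thesis .
qed

text \<open>Quasi-submultiplicativity pulls \<open>weight N \<xi>\<close> out with the factor 4 and
  leaves four products of a comb and an envelope. Reflections reduce each integral to
  \<open>integral_comb_envelope\<close> with \<open>s = 0\<close> or \<open>s = \<xi>\<close>, so
  each is at most \<open>3 * pi^2\<close>.\<close>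

lemma conv_weight_bound:
  assumes N: "N > 0"
  shows "conv (weight N) (weight N) \<xi> \<le> (48 * pi\<^sup>2) * weight N \<xi>"
proof -
  let ?p = "comb N" and ?q = "envelope N"
  have [measurable]: "weight N \<in> borel_measurable borel"
    by (intro borel_measurable_continuous_onI continuous_on_weight N)
  note I = integral_comb_envelope[OF N]
  have i1: "integrable lborel (\<lambda>a. ?p a * ?q a)" and v1: "(\<integral>a. ?p a * ?q a \<partial>lborel) \<le> 3 * pi\<^sup>2"
    using I[of 0] by (simp_all add: envelope_minus)
  have i2: "integrable lborel (\<lambda>a. ?p a * ?q (\<xi> - a))" and v2: "(\<integral>a. ?p a * ?q (\<xi> - a) \<partial>lborel) \<le> 3 * pi\<^sup>2"
    using I[of \<xi>] by simp_all
  have i3: "integrable lborel (\<lambda>a. ?p (\<xi> - a) * ?q a)" and v3: "(\<integral>a. ?p (\<xi> - a) * ?q a \<partial>lborel) \<le> 3 * pi\<^sup>2"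
    using lborel_integrable_real_affine[OF i2, of "-1" \<xi>]
      lborel_integral_real_affine[of "-1" "\<lambda>a. ?p a * ?q (\<xi> - a)" \<xi>] v2 by simp_all
  have i4: "integrable lborel (\<lambda>a. ?p (\<xi> - a) * ?q (\<xi> - a))" and v4: "(\<integral>a. ?p (\<xi> - a) * ?q (\<xi> - a) \<partial>lborel) \<le> 3 * pi\<^sup>2"
    using lborel_integrable_real_affine[OF i1, of "-1" \<xi>]
      lborel_integral_real_affine[of "-1" "\<lambda>a. ?p a * ?q a" \<xi>] v1 by simp_all
  let ?S = "\<lambda>a. ?p a * ?q a + ?p a * ?q (\<xi> - a) + ?p (\<xi> - a) * ?q a + ?p (\<xi> - a) * ?q (\<xi> - a)"
  have iS: "integrable lborel ?S"
    using i1 i2 i3 i4 by auto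
  have vS: "(\<integral>a. ?S a \<partial>lborel) \<le> 12 * pi\<^sup>2"
    using i1 i2 i3 i4 v1 v2 v3 v4 by simp
  have bd: "norm (weight N a * weight N (\<xi> - a)) \<le> 4 * weight N \<xi> * ?S a" for a
    using weight_quasi_submult[OF N, of a "\<xi> - a"] weight_pos[of N a] weight_pos[of N "\<xi> - a"]
    by (simp add: algebra_simps abs_mult)
  have "conv (weight N) (weight N) \<xi> \<le> (\<integral>a. norm (weight N a * weight N (\<xi> - a)) \<partial>lborel)"
    unfolding conv_def by (simp add: abs_mult abs_of_pos weight_pos)
  also have "\<dots> \<le> (\<integral>a. 4 * weight N \<xi> * ?S a \<partial>lborel)"
    by (rule integrable_dominated(2)[OF _ integrable_mult_right[OF iS] bd]) measurable
  also have "\<dots> = 4 * weight N \<xi> * (\<integral>a. ?S a \<partial>lborel)"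
    by (rule integral_mult_right_zero)
  also have "\<dots> \<le> 4 * weight N \<xi> * (12 * pi\<^sup>2)"
    using weight_pos[of N \<xi>] by (intro mult_left_mono vS) auto
  finally show ?thesis
    by (simp add: mult_ac)
qed

lemma exp_ge_power_div_fact: "0 \<le> x \<Longrightarrow> x ^ n / fact n \<le> exp (x::real)"
proof -
  assume x: "0 \<le> x"
  have "(\<Sum>k\<in>{n}. x ^ k /\<^sub>R fact k) \<le> (\<Sum>k. x ^ k /\<^sub>R fact k)"
    using x exp_converges[of x] by (intro sum_le_suminf) (auto simp: sums_iff)
  then show "x ^ n / fact n \<le> exp x"
    using exp_converges[of x] by (simp add: sums_iff divide_inverse mult.commute)
qed

text \<open>The exponential dominates the term of order \<open>2 * n\<close> in its own series. The
  constant depends on \<open>N\<close>, which is harmless: decay is needed only qualitatively, for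
  smoothness.\<close>

lemma weight_decay:
  assumes N: "N > 0"
  shows "\<exists>C. \<forall>\<xi>. (1 + \<xi>\<^sup>2) powr \<sigma> * weight N \<xi> \<le> C"
proof -
  obtain n :: nat where n: "\<sigma> \<le> real n"
    using real_arch_simple by blast
  define C where "C = N ^ (2 * n) * fact (2 * n) * exp (1 / N)"
  have "(1 + \<xi>\<^sup>2) powr \<sigma> * weight N \<xi> \<le> C" for \<xi>
  proof -
    let ?x = "(1 + \<bar>\<xi>\<bar>) / N"
    have "1 + \<xi>\<^sup>2 \<le> (1 + \<bar>\<xi>\<bar>)\<^sup>2"
      by (simp add: power2_sum)
    moreover have "(1 + \<xi>\<^sup>2) powr \<sigma> \<le> (1 + \<xi>\<^sup>2) powr real n"
      using n by (intro powr_mono) auto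
    moreover have "(1 + \<xi>\<^sup>2) powr real n = (1 + \<xi>\<^sup>2) ^ n"
      by (rule powr_realpow) (simp add: add_pos_nonneg)
    ultimately have "(1 + \<xi>\<^sup>2) powr \<sigma> \<le> ((1 + \<bar>\<xi>\<bar>)\<^sup>2) ^ n"
      using power_mono[of "1 + \<xi>\<^sup>2" "(1 + \<bar>\<xi>\<bar>)\<^sup>2" n] by simp
    also have "\<dots> = N ^ (2 * n) * fact (2 * n) * (?x ^ (2 * n) / fact (2 * n))"
      using N by (simp add: power_divide power_mult)
    also have "\<dots> \<le> N ^ (2 * n) * fact (2 * n) * exp ?x"
      using N by (intro mult_left_mono exp_ge_power_div_fact) auto
    finally have 1: "(1 + \<xi>\<^sup>2) powr \<sigma> \<le> N ^ (2 * n) * fact (2 * n) * exp ?x" .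
    have 2: "weight N \<xi> \<le> exp (- \<bar>\<xi>\<bar> / N)"
    proof -
      have "weight N \<xi> \<le> exp (- \<bar>\<xi>\<bar> / N) * 1 * 1"
        unfolding weight_def using comb_bounds[of N \<xi>] envelope_bounds[of N \<xi>] by (intro mult_mono) auto
      then show ?thesis by simp
    qed
    have "(1 + \<xi>\<^sup>2) powr \<sigma> * weight N \<xi> \<le> (N ^ (2 * n) * fact (2 * n) * exp ?x) * exp (- \<bar>\<xi>\<bar> / N)"
      using N weight_pos[of N \<xi>] by (intro mult_mono 1 2) auto
    also have "\<dots> = N ^ (2 * n) * fact (2 * n) * (exp ?x * exp (- \<bar>\<xi>\<bar> / N))"
      by simp
    also have "exp ?x * exp (- \<bar>\<xi>\<bar> / N) = exp (1 / N)"
      by (simp add: exp_add[symmetric] add_divide_distrib)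
    finally show ?thesis
      by (simp add: C_def)
  qed
  then show ?thesis
    by blast
qed

theorem conv_weight_weight: "N > 0 \<Longrightarrow> conv_weight (weight N) (48 * pi\<^sup>2)"
  unfolding conv_weight_def
  using continuous_on_weight weight_pos weight_le_1 weight_minus conv_weight_bound weight_decay
  by (auto simp: power2_eq_square)

text \<open>Here \<open>\<bar>x\<bar> <= 3 * N\<close>, which gives \<open>exp (- 3)\<close> and
  \<open>1 / (1 + 3^2)\<close> for the exponential and the envelope. The point is within 1 of a
  tooth, so \<open>N * sin\<close> is at most \<open>pi\<close> in modulus.\<close>

lemma weight_lower_bound:
  assumes N: "N \<ge> 1" and k: "k = 1 \<or> k = 2" and x: "\<bar>x - k * N\<bar> \<le> 1"
  shows "exp (- 3) / (10 * (1 + pi\<^sup>2)) \<le> weight N x"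
proof -
  have xN: "\<bar>x\<bar> \<le> 3 * N"
    using assms by auto
  have 1: "exp (- 3) \<le> exp (- \<bar>x\<bar> / N)"
    using xN N by (simp add: divide_le_eq)
  have 2: "1 / 10 \<le> envelope N x"
  proof -
    have "\<bar>x / N\<bar> \<le> 3"
      using xN N by (simp add: divide_le_eq)
    then have "(x / N)\<^sup>2 \<le> 3\<^sup>2"
      using abs_le_square_iff[of "x / N" 3] by simp
    then show ?thesis
      unfolding envelope_def by (intro divide_left_mono) (auto simp: add_pos_nonneg)
  qed
  have 3: "1 / (1 + pi\<^sup>2) \<le> comb N x"
  proof -
    have "sin (pi * x / N) = sin (pi * (x - k * N) / N + k * pi)"
      using N by (simp add: field_simps)
    also have "\<bar>\<dots>\<bar> = \<bar>sin (pi * (x - k * N) / N)\<bar>"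
      using k by (auto simp: sin_add)
    also have "\<dots> \<le> \<bar>pi * (x - k * N) / N\<bar>"
      by (rule abs_sin_x_le_abs_x)
    also have "\<dots> \<le> pi / N"
      using x N by (simp add: abs_mult divide_right_mono)
    finally have "\<bar>N * sin (pi * x / N)\<bar> \<le> \<bar>pi\<bar>"
      using N by (simp add: abs_mult field_simps)
    then have "(N * sin (pi * x / N))\<^sup>2 \<le> pi\<^sup>2"
      by (simp only: abs_le_square_iff)
    then show ?thesis
      unfolding comb_def by (intro divide_left_mono) (auto simp: power_mult_distrib add_pos_nonneg)
  qed
  have "exp (- 3) / (10 * (1 + pi\<^sup>2)) = exp (- 3) * (1 / 10) * (1 / (1 + pi\<^sup>2))"
    by simp
  also have "\<dots> \<le> weight N x"
    unfolding weight_def using envelope_bounds(1)[of N x] by (intro mult_mono 1 2 3) (auto intro!: add_nonneg_nonneg)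
  finally show ?thesis .
qed

subsection \<open>Convolution and the cubic nonlinearity\<close>

lemma conv_weightD:
  assumes "conv_weight W K"
  shows "continuous_on S W" "W \<in> borel_measurable borel" "0 < W \<xi>" "W \<xi> \<le> 1" "W (- \<xi>) = W \<xi>"
    "conv W W \<xi> \<le> K * W \<xi>" "0 < K" "integrable lborel W" "integrable lborel (\<lambda>\<eta>. W \<eta> * W (\<xi> - \<eta>))"
proof -
  have *: "continuous_on UNIV W" "\<And>\<xi>. 0 < W \<xi>" "\<And>\<xi>. W \<xi> \<le> 1" "\<And>\<xi>. W (- \<xi>) = W \<xi>" "\<And>\<xi>. conv W W \<xi> \<le> K * W \<xi>"
    "\<And>\<sigma>. \<exists>C. \<forall>\<xi>. (1 + \<xi>\<^sup>2) powr \<sigma> * W \<xi> \<le> C"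
    using assms unfolding conv_weight_def by blast+
  show "0 < K"
    using assms by (simp add: conv_weight_def)
  show "continuous_on S W" "0 < W \<xi>" "W \<xi> \<le> 1" "W (- \<xi>) = W \<xi>" "conv W W \<xi> \<le> K * W \<xi>"
    using * continuous_on_subset by blast+
  show m [measurable]: "W \<in> borel_measurable borel"
    by (intro borel_measurable_continuous_onI *(1))
  obtain C where C: "\<And>\<xi>. (1 + \<xi>\<^sup>2) powr 1 * W \<xi> \<le> C"
    using *(6) by blast
  have "norm (W \<xi>) \<le> C * (1 / (1 + \<xi>\<^sup>2))" for \<xi>
  proof -
    have "1 + \<xi>\<^sup>2 > 0"
      by (simp add: add_pos_nonneg)
    then show ?thesis
      using C[of \<xi>] *(2)[of \<xi>] by (simp add: pos_le_divide_eq mult.commute)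
  qed
  from integrable_dominated(1)[OF m integrable_mult_right[OF integrable_inverse_one_plus_square] this]
  show iW: "integrable lborel W" .
  show i: "integrable lborel (\<lambda>\<eta>. W \<eta> * W (\<xi> - \<eta>))" for \<xi>
  proof (rule integrable_dominated(1)[OF _ iW])
    show "norm (W \<eta> * W (\<xi> - \<eta>)) \<le> W \<eta>" for \<eta>
      using *(2)[of \<eta>] *(2)[of "\<xi> - \<eta>"] *(3)[of "\<xi> - \<eta>"] by (simp add: abs_mult)
  qed measurable
qed

text \<open>The algebra property on which all nonlinear estimates rest: only the moduli enter, so
  the inequality for \<open>conv W W\<close> applies.\<close>

lemma conv_bound:
  fixes f h :: "real \<Rightarrow> complex"
  assumes W: "conv_weight W K" and [measurable]: "f \<in> borel_measurable borel" "h \<in> borel_measurable borel"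
    and f: "\<And>\<xi>. norm (f \<xi>) \<le> B1 * W \<xi>" and h: "\<And>\<xi>. norm (h \<xi>) \<le> B2 * W \<xi>"
  shows "integrable lborel (\<lambda>\<eta>. f \<eta> * h (\<xi> - \<eta>))"
    and "norm (conv f h \<xi>) \<le> B1 * B2 * K * W \<xi>"
proof -
  note Wf = conv_weightD[OF W]
  have B1: "B1 \<ge> 0"
    using f[of 0] Wf(3)[of 0] by (meson norm_ge_zero order_trans zero_le_mult_iff not_less)
  have B2: "B2 \<ge> 0"
    using h[of 0] Wf(3)[of 0] by (meson norm_ge_zero order_trans zero_le_mult_iff not_less)
  have bd: "norm (f \<eta> * h (\<xi> - \<eta>)) \<le> (B1 * B2) * (W \<eta> * W (\<xi> - \<eta>))" for \<eta>
  proof -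
    have "norm (f \<eta> * h (\<xi> - \<eta>)) \<le> (B1 * W \<eta>) * (B2 * W (\<xi> - \<eta>))"
      unfolding norm_mult using f h B1 Wf(3)[of \<eta>] by (intro mult_mono) auto
    then show ?thesis
      by (simp add: mult_ac)
  qed
  note d = integrable_dominated[OF _ integrable_mult_right[OF Wf(9)] bd]
  show "integrable lborel (\<lambda>\<eta>. f \<eta> * h (\<xi> - \<eta>))"
    by (rule d(1)) measurable
  have "norm (conv f h \<xi>) \<le> (\<integral>\<eta>. norm (f \<eta> * h (\<xi> - \<eta>)) \<partial>lborel)"
    unfolding conv_def by simp
  also have "\<dots> \<le> (\<integral>\<eta>. (B1 * B2) * (W \<eta> * W (\<xi> - \<eta>)) \<partial>lborel)"
    by (rule d(2)) measurable
  also have "\<dots> = (B1 * B2) * conv W W \<xi>"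
    by (simp only: conv_def integral_mult_right_zero)
  also have "\<dots> \<le> (B1 * B2) * (K * W \<xi>)"
    using B1 B2 by (intro mult_left_mono Wf(6)) auto
  finally show "norm (conv f h \<xi>) \<le> B1 * B2 * K * W \<xi>"
    by (simp add: mult.assoc)
qed

lemma conv_continuous:
  fixes f h :: "real \<Rightarrow> real \<Rightarrow> complex"
  assumes W: "conv_weight W K"
    and fc: "continuous_on UNIV (\<lambda>(t, \<xi>). f t \<xi>)" and hc: "continuous_on UNIV (\<lambda>(t, \<xi>). h t \<xi>)"
    and f: "\<And>t \<xi>. norm (f t \<xi>) \<le> B1 * W \<xi>" and h: "\<And>t \<xi>. norm (h t \<xi>) \<le> B2 * W \<xi>"
  shows "continuous_on UNIV (\<lambda>(t, \<xi>). conv (f t) (h t) \<xi>)"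
proof -
  note Wf = conv_weightD[OF W]
  have B1: "B1 \<ge> 0"
    using f[of 0 0] Wf(3)[of 0] by (meson norm_ge_zero order_trans zero_le_mult_iff not_less)
  have B2: "B2 \<ge> 0"
    using h[of 0 0] Wf(3)[of 0] by (meson norm_ge_zero order_trans zero_le_mult_iff not_less)
  have fc': "continuous_on S (\<lambda>z. f (a z) (b z))" and hc': "continuous_on S (\<lambda>z. h (a z) (b z))"
    if "continuous_on S a" "continuous_on S b" for a b :: "'c::topological_space \<Rightarrow> real" and S
    using continuous_on_compose2[OF fc continuous_on_Pair[OF that]] continuous_on_compose2[OF hc continuous_on_Pair[OF that]]
    by auto
  have "continuous_on UNIV (\<lambda>z. \<integral>\<eta>. f (fst z) \<eta> * h (fst z) (snd z - \<eta>) \<partial>lborel)"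
  \<comment> \<open>Estimating the weight at \<open>\<xi> - \<eta>\<close> by 1 makes the majorant
    independent of \<xi>, as dominated convergence in both variables requires.\<close>
  proof (rule continuous_on_lborel_integral[where h = "\<lambda>\<eta>. (B1 * B2) * W \<eta>"])
    show "(\<lambda>\<eta>. f (fst z) \<eta> * h (fst z) (snd z - \<eta>)) \<in> borel_measurable lborel" for z :: "real \<times> real"
      unfolding measurable_lborel2 by (intro borel_measurable_continuous_onI continuous_intros fc' hc')
    show "continuous_on UNIV (\<lambda>z. f (fst z) \<eta> * h (fst z) (snd z - \<eta>))" for \<eta>
      by (intro continuous_intros fc' hc')
    show "integrable lborel (\<lambda>\<eta>. (B1 * B2) * W \<eta>)"
      by (intro integrable_mult_right Wf(8))
    show "norm (f (fst z) \<eta> * h (fst z) (snd z - \<eta>)) \<le> (B1 * B2) * W \<eta>" for z :: "real \<times> real" and \<eta>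
    proof -
      have "norm (f (fst z) \<eta> * h (fst z) (snd z - \<eta>)) \<le> (B1 * W \<eta>) * (B2 * 1)"
        unfolding norm_mult using f h[of "fst z" "snd z - \<eta>"] B1 B2 Wf(3)[of \<eta>] Wf(4)[of "snd z - \<eta>"]
        by (intro mult_mono) (auto intro: order_trans mult_left_le)
      then show ?thesis
        by (simp add: mult_ac)
    qed
  qed
  then show ?thesis
    by (simp add: conv_def case_prod_unfold)
qed

text \<open>If \<open>g\<close> is the transform of \<open>f\<close>, this is the transform of |f|^2
  f: conjugation of \<open>f\<close> becomes the reflected conjugate of \<open>g\<close>, and each
  product costs a factor \<open>1 / (2 * pi)\<close>.\<close>

definition cubic :: "(real \<Rightarrow> complex) \<Rightarrow> real \<Rightarrow> complex" where
  "cubic g \<xi> = conv (conv g g) (\<lambda>\<eta>. cnj (g (- \<eta>))) \<xi> / (2 * pi)\<^sup>2"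

lemma borel_measurable_conv [measurable]:
  fixes f h :: "real \<Rightarrow> complex"
  assumes [measurable]: "f \<in> borel_measurable borel" "h \<in> borel_measurable borel"
  shows "conv f h \<in> borel_measurable borel"
  unfolding conv_def by measurable

lemma norm_div_4pi2_le: "norm (z / complex_of_real ((2 * pi)\<^sup>2)) \<le> norm z"
proof -
  have "1 \<le> (2 * pi)\<^sup>2"
    by (rule one_le_power) (use pi_gt3 in linarith)
  then have "norm z / (2 * pi)\<^sup>2 \<le> norm z / 1"
    by (intro divide_left_mono) auto
  then show ?thesis
    by (simp add: norm_divide norm_power norm_mult)
qed

lemma cubic_bound:
  assumes W: "conv_weight W K" and m: "g \<in> borel_measurable borel" and g: "\<And>\<xi>. norm (g \<xi>) \<le> R * W \<xi>"
  shows "norm (cubic g \<xi>) \<le> K\<^sup>2 * R ^ 3 * W \<xi>"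
proof -
  have [measurable]: "g \<in> borel_measurable borel"
    by (rule m)
  have g': "norm (cnj (g (- \<eta>))) \<le> R * W \<eta>" for \<eta>
    using g[of "- \<eta>"] conv_weightD(5)[OF W] by simp
  have "norm (conv (conv g g) (\<lambda>\<eta>. cnj (g (- \<eta>))) \<xi>) \<le> (R * R * K) * R * K * W \<xi>"
    by (rule conv_bound(2)[OF W _ _ conv_bound(2)[OF W m m g g] g']) measurable
  then show ?thesis
    unfolding cubic_def
    by (intro order_trans[OF norm_div_4pi2_le]) (simp add: power2_eq_square power3_eq_cube mult_ac)
qed

text \<open>Telescoping replaces one of the three factors at a time, which yields the factor
  3.\<close>

lemma cubic_diff_bound:
  assumes W: "conv_weight W K" and mg: "g \<in> borel_measurable borel" and mh: "h \<in> borel_measurable borel"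
    and g: "\<And>\<xi>. norm (g \<xi>) \<le> R * W \<xi>" and h: "\<And>\<xi>. norm (h \<xi>) \<le> R * W \<xi>"
    and d: "\<And>\<xi>. norm (g \<xi> - h \<xi>) \<le> \<delta> * W \<xi>"
  shows "norm (cubic g \<xi> - cubic h \<xi>) \<le> 3 * K\<^sup>2 * R\<^sup>2 * \<delta> * W \<xi>"
proof -
  have [measurable]: "g \<in> borel_measurable borel" "h \<in> borel_measurable borel"
    by (rule mg mh)+
  let ?r = "\<lambda>f \<eta>. cnj (f (- \<eta>))"
  let ?e = "\<lambda>\<xi>. g \<xi> - h \<xi>"
  have g': "norm (?r g \<eta>) \<le> R * W \<eta>" and d': "norm (?r ?e \<eta>) \<le> \<delta> * W \<eta>" for \<eta>
    using g[of "- \<eta>"] d[of "- \<eta>"] conv_weightD(5)[OF W] unfolding complex_mod_cnj by simp_all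
  note cb = conv_bound[OF W]
  have hh: "norm (conv h h \<eta>) \<le> (R * R * K) * W \<eta>" for \<eta>
    by (rule cb(2)) (auto intro: h)
  have split1: "conv g g \<eta> - conv h h \<eta> = conv ?e g \<eta> + conv h ?e \<eta>" for \<eta>
  proof -
    have i: "integrable lborel (\<lambda>\<zeta>. g \<zeta> * g (\<eta> - \<zeta>))" "integrable lborel (\<lambda>\<zeta>. h \<zeta> * h (\<eta> - \<zeta>))"
      "integrable lborel (\<lambda>\<zeta>. ?e \<zeta> * g (\<eta> - \<zeta>))" "integrable lborel (\<lambda>\<zeta>. h \<zeta> * ?e (\<eta> - \<zeta>))"
      by (rule cb(1); (rule mg mh g h d | measurable))+
    show ?thesis
      unfolding conv_def Bochner_Integration.integral_diff[OF i(1,2), symmetric] Bochner_Integration.integral_add[OF i(3,4), symmetric]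
      by (intro Bochner_Integration.integral_cong) (auto simp: algebra_simps)
  qed
  have e1: "norm (conv g g \<eta> - conv h h \<eta>) \<le> (2 * (R * \<delta> * K)) * W \<eta>" for \<eta>
  proof -
    have "norm (conv ?e g \<eta>) \<le> \<delta> * R * K * W \<eta>" "norm (conv h ?e \<eta>) \<le> R * \<delta> * K * W \<eta>"
      by (rule cb(2); (rule mg mh g h d | measurable))+
    then show ?thesis
      unfolding split1 by (intro order_trans[OF norm_triangle_ineq]) (simp add: algebra_simps)
  qed
  have split2: "conv (conv g g) (?r g) \<xi> - conv (conv h h) (?r h) \<xi>
    = conv (\<lambda>\<eta>. conv g g \<eta> - conv h h \<eta>) (?r g) \<xi> + conv (conv h h) (?r ?e) \<xi>"
  proof -
    have gg: "norm (conv g g \<eta>) \<le> (R * R * K) * W \<eta>" for \<eta>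
      by (rule cb(2)) (auto intro: g)
    have h': "norm (?r h \<eta>) \<le> R * W \<eta>" for \<eta>
      using h[of "- \<eta>"] conv_weightD(5)[OF W] by simp
    have i: "integrable lborel (\<lambda>\<zeta>. conv g g \<zeta> * ?r g (\<xi> - \<zeta>))" "integrable lborel (\<lambda>\<zeta>. conv h h \<zeta> * ?r h (\<xi> - \<zeta>))"
      "integrable lborel (\<lambda>\<zeta>. (conv g g \<zeta> - conv h h \<zeta>) * ?r g (\<xi> - \<zeta>))" "integrable lborel (\<lambda>\<zeta>. conv h h \<zeta> * ?r ?e (\<xi> - \<zeta>))"
      by (rule cb(1); (rule gg hh e1 g' h' d' | measurable))+
    show ?thesis
      unfolding conv_def[of "conv _ _"] conv_def[of "\<lambda>\<eta>. conv _ _ \<eta> - _ \<eta>"]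
        Bochner_Integration.integral_diff[OF i(1,2), symmetric] Bochner_Integration.integral_add[OF i(3,4), symmetric]
      by (intro Bochner_Integration.integral_cong) (auto simp: algebra_simps)
  qed
  have "norm (conv (\<lambda>\<eta>. conv g g \<eta> - conv h h \<eta>) (?r g) \<xi>) \<le> (2 * (R * \<delta> * K)) * R * K * W \<xi>"
    "norm (conv (conv h h) (?r ?e) \<xi>) \<le> (R * R * K) * \<delta> * K * W \<xi>"
    by (rule cb(2); (rule e1 hh g' d' | measurable))+
  then have "norm (conv (conv g g) (?r g) \<xi> - conv (conv h h) (?r h) \<xi>) \<le> 3 * K\<^sup>2 * R\<^sup>2 * \<delta> * W \<xi>"
    unfolding split2 by (intro order_trans[OF norm_triangle_ineq]) (simp add: algebra_simps power2_eq_square)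
  then show ?thesis
    unfolding cubic_def diff_divide_distrib[symmetric] by (intro order_trans[OF norm_div_4pi2_le])
qed

lemma cubic_continuous:
  fixes g :: "real \<Rightarrow> real \<Rightarrow> complex"
  assumes W: "conv_weight W K" and gc: "continuous_on UNIV (\<lambda>(t, \<xi>). g t \<xi>)"
    and g: "\<And>t \<xi>. norm (g t \<xi>) \<le> R * W \<xi>"
  shows "continuous_on UNIV (\<lambda>(t, \<xi>). cubic (g t) \<xi>)"
proof -
  have m: "g t \<in> borel_measurable borel" for t
    using continuous_on_slices(1)[of UNIV g t] gc by (intro borel_measurable_continuous_onI) simp
  have "continuous_on UNIV (\<lambda>z. case (fst z, - snd z) of (t, \<xi>) \<Rightarrow> g t \<xi>)"
    by (rule continuous_on_compose2[OF gc]) (auto intro!: continuous_intros)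
  then have gc': "continuous_on UNIV (\<lambda>(t, \<xi>). cnj (g t (- \<xi>)))"
    by (auto simp: case_prod_unfold intro!: continuous_intros)
  have g': "norm (cnj (g t (- \<eta>))) \<le> R * W \<eta>" for t \<eta>
    using g[of t "- \<eta>"] conv_weightD(5)[OF W] by simp
  have "continuous_on UNIV (\<lambda>(t, \<xi>). conv (conv (g t) (g t)) (\<lambda>\<eta>. cnj (g t (- \<eta>))) \<xi>)"
    by (rule conv_continuous[where f = "\<lambda>t. conv (g t) (g t)" and h = "\<lambda>t \<eta>. cnj (g t (- \<eta>))",
          OF W conv_continuous[where f = g and h = g, OF W gc gc g g] gc' conv_bound(2)[OF W m m g g] g'])
  then show ?thesis
    unfolding cubic_def case_prod_unfold by (intro continuous_intros) auto
qed

lemma inv_fourier_conv: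
  assumes f: "integrable lborel f" and h: "integrable lborel h"
  shows "integrable lborel (conv f h)" and "inv_fourier (conv f h) x = 2 * pi * (inv_fourier f x * inv_fourier h x)"
proof -
  have [measurable]: "f \<in> borel_measurable borel" "h \<in> borel_measurable borel"
    using f h by auto
  have h': "integrable lborel (\<lambda>\<xi>. h (\<xi> - \<eta>))" for \<eta>
    using lborel_integrable_real_affine[OF h, of 1 "- \<eta>"] by simp
  have shift: "(\<integral>\<xi>. r (\<xi> - \<eta>) \<partial>lborel) = (\<integral>\<xi>. r \<xi> \<partial>lborel)" for r :: "real \<Rightarrow> 'b::{banach, second_countable_topology}" and \<eta>
    using lborel_integral_real_affine[of 1 r "- \<eta>"] by simp
  have int: "integrable (lborel \<Otimes>\<^sub>M lborel) (\<lambda>(\<eta>, \<xi>). c \<xi> * (f \<eta> * h (\<xi> - \<eta>)))"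
    if [measurable]: "c \<in> borel_measurable borel" and c: "\<And>\<xi>. norm (c \<xi>) = 1" for c :: "real \<Rightarrow> complex"
  proof (rule lborel_pair.Fubini_integrable)
    show "(\<lambda>(\<eta>, \<xi>). c \<xi> * (f \<eta> * h (\<xi> - \<eta>))) \<in> borel_measurable (lborel \<Otimes>\<^sub>M lborel)"
      by measurable
    show "integrable lborel (\<lambda>\<eta>. \<integral>\<xi>. norm (case (\<eta>, \<xi>) of (\<eta>, \<xi>) \<Rightarrow> c \<xi> * (f \<eta> * h (\<xi> - \<eta>))) \<partial>lborel)"
      using f by (simp add: norm_mult c shift[of "\<lambda>\<xi>. norm (h \<xi>)"])
    show "AE \<eta> in lborel. integrable lborel (\<lambda>\<xi>. case (\<eta>, \<xi>) of (\<eta>, \<xi>) \<Rightarrow> c \<xi> * (f \<eta> * h (\<xi> - \<eta>)))"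
      using integrable_mult_bounded[OF integrable_mult_right[OF h'], of c 1] c by simp
  qed
  show "integrable lborel (conv f h)"
    using lborel_pair.integrable_snd[OF int[of "\<lambda>_. 1"]] unfolding conv_def by simp
  have "(\<integral>\<xi>. cis (x * \<xi>) * conv f h \<xi> \<partial>lborel) = (\<integral>\<xi>. (\<integral>\<eta>. cis (x * \<xi>) * (f \<eta> * h (\<xi> - \<eta>)) \<partial>lborel) \<partial>lborel)"
    by (simp add: conv_def)
  also have "\<dots> = (\<integral>\<eta>. (\<integral>\<xi>. cis (x * \<xi>) * (f \<eta> * h (\<xi> - \<eta>)) \<partial>lborel) \<partial>lborel)"
    using lborel_pair.Fubini_integral[OF int[of "\<lambda>\<xi>. cis (x * \<xi>)"]] by simp
  also have "\<dots> = (\<integral>\<eta>. (cis (x * \<eta>) * f \<eta>) * (\<integral>\<xi>. cis (x * \<xi>) * h \<xi> \<partial>lborel) \<partial>lborel)"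
  proof (rule Bochner_Integration.integral_cong[OF refl])
    fix \<eta>
    have "cis (x * \<xi>) * (f \<eta> * h (\<xi> - \<eta>)) = (cis (x * \<eta>) * f \<eta>) * (cis (x * (\<xi> - \<eta>)) * h (\<xi> - \<eta>))" for \<xi>
      using cis_mult[of "x * \<eta>" "x * (\<xi> - \<eta>)"] by (simp add: right_diff_distrib mult_ac)
    then have "(\<integral>\<xi>. cis (x * \<xi>) * (f \<eta> * h (\<xi> - \<eta>)) \<partial>lborel)
        = (cis (x * \<eta>) * f \<eta>) * (\<integral>\<xi>. cis (x * (\<xi> - \<eta>)) * h (\<xi> - \<eta>) \<partial>lborel)"
      by (simp only: integral_mult_right_zero)
    then show "(\<integral>\<xi>. cis (x * \<xi>) * (f \<eta> * h (\<xi> - \<eta>)) \<partial>lborel) = (cis (x * \<eta>) * f \<eta>) * (\<integral>\<xi>. cis (x * \<xi>) * h \<xi> \<partial>lborel)"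
      using shift[of "\<lambda>\<xi>. cis (x * \<xi>) * h \<xi>" \<eta>] by simp
  qed
  also have "\<dots> = (\<integral>\<eta>. cis (x * \<eta>) * f \<eta> \<partial>lborel) * (\<integral>\<xi>. cis (x * \<xi>) * h \<xi> \<partial>lborel)"
    by (rule integral_mult_left_zero)
  finally show "inv_fourier (conv f h) x = 2 * pi * (inv_fourier f x * inv_fourier h x)"
    by (simp add: inv_fourier_def)
qed

lemma inv_fourier_cubic:
  assumes g: "integrable lborel g"
  shows "inv_fourier (cubic g) x = complex_of_real ((cmod (inv_fourier g x))\<^sup>2) * inv_fourier g x"
proof -
  have g': "integrable lborel (\<lambda>\<eta>. cnj (g (- \<eta>)))"
    using lborel_integrable_real_affine[OF integrable_cnj[OF g], of "-1" 0] by simp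
  have "inv_fourier (cubic g) x = inv_fourier (conv (conv g g) (\<lambda>\<eta>. cnj (g (- \<eta>)))) x / (2 * pi)\<^sup>2"
    using inv_fourier_cmult[of "1 / (2 * pi)\<^sup>2"] by (simp add: cubic_def[abs_def])
  also have "\<dots> = inv_fourier g x * inv_fourier g x * cnj (inv_fourier g x)"
    by (simp add: inv_fourier_conv(2)[OF inv_fourier_conv(1)[OF g g] g'] inv_fourier_conv(2)[OF g g] cnj_inv_fourier power2_eq_square)
  also have "\<dots> = complex_of_real ((cmod (inv_fourier g x))\<^sup>2) * inv_fourier g x"
    by (simp only: complex_norm_square mult_ac)
  finally show ?thesis .
qed

subsection \<open>Existence of solutions\<close>

text \<open>Freezes time outside \<open>[0, T]\<close>, so that the unknown lives on the whole
  plane, where the bounded continuous functions are a ready-made complete space.\<close>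

definition time_clamp :: "real \<Rightarrow> real \<Rightarrow> real" where
  "time_clamp T t = max 0 (min T t)"

text \<open>Rescaled to \<open>[0, 1]\<close> to make the joint continuity in \<open>(t, \<xi>)\<close> visible; for \<open>0 \<le> t \<le> T\<close> this is the
  integral of \<open>cis (\<tau> \<bar>\<xi>\<bar>) F(\<tau>, \<xi>)\<close> over \<open>0 \<le> \<tau> \<le> t\<close>.\<close>

definition duhamel :: "real \<Rightarrow> (real \<Rightarrow> real \<Rightarrow> complex) \<Rightarrow> real \<Rightarrow> real \<Rightarrow> complex" where
  "duhamel T F t \<xi> = time_clamp T t * (\<integral>\<theta>. indicator {0..1} \<theta> *\<^sub>R
     (cis (time_clamp T t * \<theta> * \<bar>\<xi>\<bar>) * F (time_clamp T t * \<theta>) \<xi>) \<partial>lborel)"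

lemma time_clamp_bounds: "T \<ge> 0 \<Longrightarrow> 0 \<le> time_clamp T t" "T \<ge> 0 \<Longrightarrow> time_clamp T t \<le> T"
  by (auto simp: time_clamp_def)

lemma time_clamp_id: "t \<in> {0..T} \<Longrightarrow> time_clamp T t = t"
  by (auto simp: time_clamp_def)

lemma continuous_on_time_clamp [continuous_intros]:
  "continuous_on S f \<Longrightarrow> continuous_on S (\<lambda>x. time_clamp T (f x))"
  unfolding time_clamp_def by (intro continuous_intros)

lemma joint_continuous_compose:
  fixes F :: "real \<Rightarrow> real \<Rightarrow> complex"
  assumes F: "continuous_on UNIV (\<lambda>(t, \<xi>). F t \<xi>)" and "continuous_on S a" "continuous_on S b"
  shows "continuous_on S (\<lambda>z. F (a z) (b z))"
  using continuous_on_compose2[OF F continuous_on_Pair[OF assms(2,3)]] by auto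

lemma duhamel_integrand:
  assumes F: "continuous_on UNIV (\<lambda>(t, \<xi>). F t \<xi>)"
  shows "(\<lambda>\<theta>. indicator {0..1} \<theta> *\<^sub>R (cis (c * \<theta> * \<bar>\<xi>\<bar>) * F (c * \<theta>) \<xi>)) \<in> borel_measurable borel"
  by (intro borel_measurable_continuous_on_indicator continuous_intros joint_continuous_compose[OF F]) auto

lemma integrable_indicator_01: "integrable lborel (\<lambda>\<theta>::real. B * indicator {0..1} \<theta> :: real)"
  by (intro integrable_mult_right integrable_real_indicator) auto

lemma duhamel_bound:
  assumes T: "T \<ge> 0" and F: "continuous_on UNIV (\<lambda>(t, \<xi>). F t \<xi>)" and B: "\<And>t. norm (F t \<xi>) \<le> B"
  shows "norm (duhamel T F t \<xi>) \<le> T * B"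
proof -
  let ?f = "\<lambda>\<theta>. indicator {0..1} \<theta> *\<^sub>R (cis (time_clamp T t * \<theta> * \<bar>\<xi>\<bar>) * F (time_clamp T t * \<theta>) \<xi>)"
  have B0: "B \<ge> 0"
    using B[of 0] norm_ge_zero order_trans by blast
  have bd: "norm (?f \<theta>) \<le> B * indicator {0..1} \<theta>" for \<theta>
    using B by (auto simp: indicator_def norm_mult)
  have "norm (\<integral>\<theta>. ?f \<theta> \<partial>lborel) \<le> (\<integral>\<theta>. norm (?f \<theta>) \<partial>lborel)"
    by (rule integral_norm_bound)
  also have "\<dots> \<le> (\<integral>\<theta>. B * indicator {0..1::real} \<theta> \<partial>lborel)"
    by (rule integrable_dominated(2)[OF duhamel_integrand[OF F] integrable_indicator_01 bd])
  also have "\<dots> = B"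
    by simp
  finally have "time_clamp T t * norm (\<integral>\<theta>. ?f \<theta> \<partial>lborel) \<le> T * B"
    using time_clamp_bounds[OF T, of t] B0 T by (intro mult_mono) auto
  then show ?thesis
    using time_clamp_bounds[OF T, of t] by (simp add: duhamel_def norm_mult)
qed

lemma duhamel_diff:
  assumes F: "continuous_on UNIV (\<lambda>(t, \<xi>). F t \<xi>)" and B: "\<And>t. norm (F t \<xi>) \<le> B"
    and G: "continuous_on UNIV (\<lambda>(t, \<xi>). G t \<xi>)" and C: "\<And>t. norm (G t \<xi>) \<le> C"
  shows "duhamel T F t \<xi> - duhamel T G t \<xi> = duhamel T (\<lambda>t \<xi>. F t \<xi> - G t \<xi>) t \<xi>"
proof -
  have i: "integrable lborel (\<lambda>\<theta>. indicator {0..1} \<theta> *\<^sub>R (cis (time_clamp T t * \<theta> * \<bar>\<xi>\<bar>) * F (time_clamp T t * \<theta>) \<xi>))"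
    if F: "continuous_on UNIV (\<lambda>(t, \<xi>). F t \<xi>)" and B: "\<And>t. norm (F t \<xi>) \<le> B" for F B
    by (rule integrable_dominated(1)[OF duhamel_integrand[OF F] integrable_indicator_01[of B]])
       (use B in \<open>auto simp: indicator_def norm_mult\<close>)
  show ?thesis
    unfolding duhamel_def right_diff_distrib[symmetric] Bochner_Integration.integral_diff[OF i[OF F B] i[OF G C], symmetric]
    by (intro arg_cong[where f = "\<lambda>z. _ * z"] Bochner_Integration.integral_cong)
       (auto simp: algebra_simps)
qed

lemma duhamel_continuous:
  assumes F: "continuous_on UNIV (\<lambda>(t, \<xi>). F t \<xi>)" and B: "\<And>t \<xi>. norm (F t \<xi>) \<le> B"
  shows "continuous_on UNIV (\<lambda>(t, \<xi>). duhamel T F t \<xi>)"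
proof -
  have "continuous_on UNIV (\<lambda>z. \<integral>\<theta>. indicator {0..1} \<theta> *\<^sub>R
     (cis (time_clamp T (fst z) * \<theta> * \<bar>snd z\<bar>) * F (time_clamp T (fst z) * \<theta>) (snd z)) \<partial>lborel)"
  proof (rule continuous_on_lborel_integral[where h = "\<lambda>\<theta>. B * indicator {0..1} \<theta>"])
    show "continuous_on UNIV (\<lambda>z. indicator {0..1} \<theta> *\<^sub>R (cis (time_clamp T (fst z) * \<theta> * \<bar>snd z\<bar>) * F (time_clamp T (fst z) * \<theta>) (snd z)))" for \<theta> :: real
      by (intro continuous_intros joint_continuous_compose[OF F])
    show "norm (indicator {0..1} \<theta> *\<^sub>R (cis (time_clamp T (fst z) * \<theta> * \<bar>snd z\<bar>) * F (time_clamp T (fst z) * \<theta>) (snd z))) \<le> B * indicator {0..1} \<theta>"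
      for z :: "real \<times> real" and \<theta>
      using B by (auto simp: indicator_def norm_mult)
  qed (use duhamel_integrand[OF F] integrable_indicator_01 in auto)
  then show ?thesis
    unfolding duhamel_def case_prod_unfold by (intro continuous_intros)
qed

text \<open>Banach's theorem for the quotient of \<open>g\<close> by \<open>W\<close>, for which the
  weighted norm is the sup norm. On the ball of radius \<open>2 * A\<close>, invariance asks for
  \<open>8 K^2 A^2 T <= 1\<close> and the contraction constant is \<open>12 K^2 A^2 T\<close>; the
  24 in the smallness condition makes it at most 1/2.\<close>

theorem Picard_fixed_point:
  fixes \<mu> A T K :: real and \<phi> :: "real \<Rightarrow> complex"
  assumes W: "conv_weight W K" and \<phi>c: "continuous_on UNIV \<phi>" and \<phi>: "\<And>\<xi>. norm (\<phi> \<xi>) \<le> A * W \<xi>"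
    and A: "A > 0" and T: "T \<ge> 0" and small: "24 * K\<^sup>2 * A\<^sup>2 * T \<le> 1" and \<mu>: "\<bar>\<mu>\<bar> \<le> 1"
  obtains g :: "real \<Rightarrow> real \<Rightarrow> complex" where "continuous_on UNIV (\<lambda>(t, \<xi>). g t \<xi>)"
    and "\<And>t \<xi>. norm (g t \<xi>) \<le> 2 * A * W \<xi>"
    and "\<And>t \<xi>. g t \<xi> = cis (- (time_clamp T t * \<bar>\<xi>\<bar>)) * (\<phi> \<xi> - \<i> * \<mu> * duhamel T (\<lambda>\<tau>. cubic (g \<tau>)) t \<xi>)"
proof -
  note Wf = conv_weightD[OF W]
  define lift :: "((real \<times> real) \<Rightarrow>\<^sub>C complex) \<Rightarrow> real \<Rightarrow> real \<Rightarrow> complex" where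
    "lift = (\<lambda>b t \<xi>. complex_of_real (W \<xi>) * b (t, \<xi>))"
  define D where "D = (\<lambda>b. duhamel T (\<lambda>\<tau>. cubic (lift b \<tau>)))"
  define \<Phi> where "\<Phi> = (\<lambda>b t \<xi>. cis (- (time_clamp T t * \<bar>\<xi>\<bar>)) * (\<phi> \<xi> - \<i> * \<mu> * D b t \<xi>))"
  define R where "R = 2 * A"
  have R: "R > 0"
    using A by (simp add: R_def)
  have lift_c: "continuous_on UNIV (\<lambda>(t, \<xi>). lift b t \<xi>)" for b
    unfolding lift_def case_prod_unfold by (auto intro!: continuous_intros continuous_on_compose2[OF Wf(1)])
  have lift_m: "lift b t \<in> borel_measurable borel" for b t
    using continuous_on_slices(1)[of UNIV "lift b" t] lift_c by (intro borel_measurable_continuous_onI) simp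
  have lift_bd: "norm (lift b t \<xi>) \<le> r * W \<xi>" if "norm b \<le> r" for b t \<xi> r
  proof -
    have "norm (b (t, \<xi>)) \<le> r"
      using norm_bounded[of b "(t, \<xi>)"] that by linarith
    then show ?thesis
      using Wf(3)[of \<xi>] by (simp add: lift_def norm_mult mult.commute mult_right_mono)
  qed
  have N_c: "continuous_on UNIV (\<lambda>(t, \<xi>). cubic (lift b t) \<xi>)" for b
    by (rule cubic_continuous[OF W lift_c lift_bd[OF order_refl]])
  have N_bd: "norm (cubic (lift b t) \<xi>) \<le> K\<^sup>2 * r ^ 3 * W \<xi>" if "norm b \<le> r" for b t \<xi> r
    by (rule cubic_bound[OF W lift_m lift_bd[OF that]])
  have N_bd': "norm (cubic (lift b t) \<xi>) \<le> K\<^sup>2 * (norm b) ^ 3" for b t \<xi>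
  proof -
    have "K\<^sup>2 * (norm b) ^ 3 * W \<xi> \<le> K\<^sup>2 * (norm b) ^ 3 * 1"
      by (intro mult_left_mono Wf(4)) auto
    then show ?thesis
      using N_bd[OF order_refl, of b t \<xi>] by simp
  qed
  have D_c: "continuous_on UNIV (\<lambda>(t, \<xi>). D b t \<xi>)" for b
    unfolding D_def by (rule duhamel_continuous[OF N_c N_bd'])
  have D_bd: "norm (D b t \<xi>) \<le> T * (K\<^sup>2 * r ^ 3 * W \<xi>)" if "norm b \<le> r" for b t \<xi> r
    unfolding D_def by (rule duhamel_bound[OF T N_c N_bd[OF that]])
  have \<Phi>_bd: "norm (\<Phi> b t \<xi>) \<le> (A + T * K\<^sup>2 * r ^ 3) * W \<xi>" if "norm b \<le> r" for b t \<xi> r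
  proof -
    have "norm (\<Phi> b t \<xi>) \<le> norm (\<phi> \<xi>) + \<bar>\<mu>\<bar> * norm (D b t \<xi>)"
      unfolding \<Phi>_def norm_mult norm_cis mult_1_left
      by (rule order_trans[OF norm_triangle_ineq4]) (simp add: norm_mult)
    also have "\<dots> \<le> A * W \<xi> + 1 * (T * (K\<^sup>2 * r ^ 3 * W \<xi>))"
      using \<mu> by (intro add_mono \<phi> mult_mono D_bd that) auto
    finally show ?thesis
      by (simp add: algebra_simps)
  qed
  have \<Phi>_c: "continuous_on UNIV (\<lambda>(t, \<xi>). \<Phi> b t \<xi>)" for b
    using D_c[of b] unfolding \<Phi>_def case_prod_unfold
    by (intro continuous_intros continuous_on_compose2[OF \<phi>c]) auto
  have bc: "(\<lambda>z. \<Phi> b (fst z) (snd z) / W (snd z)) \<in> bcontfun" for b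
  proof (rule bcontfun_normI)
    show "continuous_on UNIV (\<lambda>z. \<Phi> b (fst z) (snd z) / complex_of_real (W (snd z)))"
      using \<Phi>_c[of b] Wf(3) unfolding case_prod_unfold
      by (intro continuous_intros continuous_on_compose2[OF Wf(1)]) (auto simp: less_le)
    show "norm (\<Phi> b (fst z) (snd z) / complex_of_real (W (snd z))) \<le> A + T * K\<^sup>2 * norm b ^ 3" for z
      using \<Phi>_bd[OF order_refl, of b "fst z" "snd z"] Wf(3)[of "snd z"] by (simp add: norm_divide divide_le_eq)
  qed
  define \<Psi> where "\<Psi> = (\<lambda>b. Bcontfun (\<lambda>z. \<Phi> b (fst z) (snd z) / complex_of_real (W (snd z))))"
  have \<Psi>: "apply_bcontfun (\<Psi> b) z = \<Phi> b (fst z) (snd z) / W (snd z)" for b z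
    unfolding \<Psi>_def by (simp add: Bcontfun_inverse[OF bc])
  have "\<exists>!b. b \<in> cball 0 R \<and> \<Psi> b = b"
  proof (rule Banach_fix[OF complete_eq_closed[THEN iffD2, OF closed_cball], where c = "1/2"])
    show "cball (0 :: (real \<times> real) \<Rightarrow>\<^sub>C complex) R \<noteq> {}"
      using R by simp
    show "\<Psi> ` cball 0 R \<subseteq> cball 0 R"
    proof (intro image_subsetI)
      fix b :: "(real \<times> real) \<Rightarrow>\<^sub>C complex"
      assume "b \<in> cball 0 R"
      then have b: "norm b \<le> R"
        by simp
      have "A + T * K\<^sup>2 * R ^ 3 \<le> R"
      proof -
        have "T * K\<^sup>2 * R ^ 3 = (24 * K\<^sup>2 * A\<^sup>2 * T) * (A / 3)"
          by (simp add: R_def power2_eq_square power3_eq_cube)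
        also have "\<dots> \<le> 1 * (A / 3)"
          using A by (intro mult_right_mono small) auto
        finally show ?thesis
          using A by (simp add: R_def)
      qed
      then have "norm (\<Psi> b) \<le> R"
      proof (intro norm_bound)
        fix z
        have "norm (\<Phi> b (fst z) (snd z)) \<le> R * W (snd z)"
          using \<Phi>_bd[OF b, of "fst z" "snd z"] \<open>A + T * K\<^sup>2 * R ^ 3 \<le> R\<close> Wf(3)[of "snd z"]
          by (meson mult_right_mono less_imp_le order_trans)
        then show "norm (apply_bcontfun (\<Psi> b) z) \<le> R"
          unfolding \<Psi> using Wf(3)[of "snd z"] by (simp add: norm_divide divide_le_eq)
      qed
      then show "\<Psi> b \<in> cball 0 R"
        by simp
    qed
    show "dist (\<Psi> b) (\<Psi> b') \<le> 1 / 2 * dist b b'" if "b \<in> cball 0 R" "b' \<in> cball 0 R" for b b' :: "(real \<times> real) \<Rightarrow>\<^sub>C complex"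
    proof -
      have b: "norm b \<le> R" and b': "norm b' \<le> R"
        using that by auto
      define \<delta> where "\<delta> = dist b b'"
      have \<delta>: "\<delta> \<ge> 0"
        by (simp add: \<delta>_def)
      have ld: "norm (lift b t \<xi> - lift b' t \<xi>) \<le> \<delta> * W \<xi>" for t \<xi>
        using dist_bounded[of b "(t, \<xi>)" b'] Wf(3)[of \<xi>]
        by (simp add: lift_def norm_mult mult.commute mult_right_mono dist_norm \<delta>_def flip: right_diff_distrib)
      have Nd: "norm (cubic (lift b t) \<xi> - cubic (lift b' t) \<xi>) \<le> 3 * K\<^sup>2 * R\<^sup>2 * \<delta> * W \<xi>" for t \<xi>
        by (rule cubic_diff_bound[OF W lift_m lift_m lift_bd[OF b] lift_bd[OF b'] ld])
      have "norm (D b t \<xi> - D b' t \<xi>) \<le> T * (3 * K\<^sup>2 * R\<^sup>2 * \<delta> * W \<xi>)" for t \<xi>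
        unfolding D_def duhamel_diff[OF N_c N_bd' N_c N_bd']
        using N_c[of b] N_c[of b'] by (intro duhamel_bound[OF T] Nd) (auto simp: case_prod_unfold intro!: continuous_intros)
      then have "norm (\<Phi> b t \<xi> - \<Phi> b' t \<xi>) \<le> 1 * (T * (3 * K\<^sup>2 * R\<^sup>2 * \<delta> * W \<xi>))" for t \<xi>
      proof -
        have "\<Phi> b t \<xi> - \<Phi> b' t \<xi> = cis (- (time_clamp T t * \<bar>\<xi>\<bar>)) * (\<i> * \<mu> * (D b' t \<xi> - D b t \<xi>))"
          by (simp add: \<Phi>_def algebra_simps)
        then have "norm (\<Phi> b t \<xi> - \<Phi> b' t \<xi>) = \<bar>\<mu>\<bar> * norm (D b t \<xi> - D b' t \<xi>)"
          by (simp add: norm_mult norm_minus_commute)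
        also have "\<dots> \<le> 1 * (T * (3 * K\<^sup>2 * R\<^sup>2 * \<delta> * W \<xi>))"
          using \<mu> \<open>\<And>\<xi> t. norm (D b t \<xi> - D b' t \<xi>) \<le> T * (3 * K\<^sup>2 * R\<^sup>2 * \<delta> * W \<xi>)\<close> by (intro mult_mono) auto
        finally show ?thesis .
      qed
      moreover have "1 * (T * (3 * K\<^sup>2 * R\<^sup>2 * \<delta> * W \<xi>)) \<le> (1 / 2 * \<delta>) * W \<xi>" for \<xi>
      proof -
        have "1 * (T * (3 * K\<^sup>2 * R\<^sup>2 * \<delta> * W \<xi>)) = (24 * K\<^sup>2 * A\<^sup>2 * T) * (1 / 2 * \<delta> * W \<xi>)"
          by (simp add: R_def power2_eq_square)
        also have "\<dots> \<le> 1 * (1 / 2 * \<delta> * W \<xi>)"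
          using \<delta> Wf(3)[of \<xi>] by (intro mult_right_mono small) auto
        finally show ?thesis
          by simp
      qed
      ultimately have *: "norm (\<Phi> b t \<xi> - \<Phi> b' t \<xi>) \<le> (1 / 2 * \<delta>) * W \<xi>" for t \<xi>
        using order_trans by blast
      show ?thesis
      proof (rule dist_bound)
        fix z
        have "norm (\<Phi> b (fst z) (snd z) - \<Phi> b' (fst z) (snd z)) / W (snd z) \<le> 1 / 2 * \<delta>"
          using *[of "fst z" "snd z"] Wf(3)[of "snd z"] by (subst pos_divide_le_eq) auto
        moreover have "dist (apply_bcontfun (\<Psi> b) z) (apply_bcontfun (\<Psi> b') z)
            = norm (\<Phi> b (fst z) (snd z) - \<Phi> b' (fst z) (snd z)) / W (snd z)"
          unfolding \<Psi> dist_norm diff_divide_distrib[symmetric] norm_divide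
          using Wf(3)[of "snd z"] by simp
        ultimately show "dist (apply_bcontfun (\<Psi> b) z) (apply_bcontfun (\<Psi> b') z) \<le> 1 / 2 * dist b b'"
          unfolding \<delta>_def by simp
      qed
    qed
  qed auto
  then obtain b where b: "norm b \<le> R" "\<Psi> b = b"
    by auto
  show ?thesis
  proof (rule that[of "lift b"])
    show "continuous_on UNIV (\<lambda>(t, \<xi>). lift b t \<xi>)"
      by (rule lift_c)
    show "norm (lift b t \<xi>) \<le> 2 * A * W \<xi>" for t \<xi>
      using lift_bd[OF b(1)] by (simp add: R_def)
    show "lift b t \<xi> = cis (- (time_clamp T t * \<bar>\<xi>\<bar>)) * (\<phi> \<xi> - \<i> * \<mu> * duhamel T (\<lambda>\<tau>. cubic (lift b \<tau>)) t \<xi>)" for t \<xi>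
    proof -
      have "lift b t \<xi> = complex_of_real (W \<xi>) * apply_bcontfun (\<Psi> b) (t, \<xi>)"
        by (simp add: lift_def b(2))
      also have "\<dots> = \<Phi> b t \<xi>"
        unfolding \<Psi> using Wf(3)[of \<xi>] by simp
      finally show ?thesis
        by (simp add: \<Phi>_def D_def)
    qed
  qed
qed

section \<open>From the fixed point back to a solution in physical space\<close>

lemma duhamel_eq_integral:
  assumes F: "continuous_on UNIV (\<lambda>(t, \<xi>). F t \<xi>)" and t: "t \<in> {0..T}"
  shows "duhamel T F t \<xi> = integral {0..t} (\<lambda>\<tau>. cis (\<tau> * \<bar>\<xi>\<bar>) * F \<tau> \<xi>)"
\<comment> \<open>The substitution \<open>\<tau> = t * \<theta>\<close> degenerates at 0, where both
  sides vanish.\<close>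
proof (cases "t = 0")
  case True
  then show ?thesis
    using t by (simp add: duhamel_def time_clamp_id)
next
  case False
  let ?f = "\<lambda>\<tau>. cis (\<tau> * \<bar>\<xi>\<bar>) * F \<tau> \<xi>"
  have c: "continuous_on {0..t} ?f"
    by (intro continuous_intros joint_continuous_compose[OF F])
  have t0: "t > 0"
    using False t by auto
  have "integral {0..t} ?f = (\<integral>\<tau>. indicator {0..t} \<tau> *\<^sub>R ?f \<tau> \<partial>lborel)"
    using set_borel_integral_eq_integral(2)[OF borel_integrable_atLeastAtMost'[OF c]]
    by (simp add: set_lebesgue_integral_def)
  also have "\<dots> = t *\<^sub>R (\<integral>\<theta>. indicator {0..t} (t * \<theta>) *\<^sub>R ?f (t * \<theta>) \<partial>lborel)"
    using lborel_integral_real_affine[of t "\<lambda>\<tau>. indicator {0..t} \<tau> *\<^sub>R ?f \<tau>" 0] t0 by simp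
  also have "(\<lambda>\<theta>. indicator {0..t} (t * \<theta>) *\<^sub>R ?f (t * \<theta>)) = (\<lambda>\<theta>. indicator {0..1} \<theta> *\<^sub>R ?f (t * \<theta>))"
    using t0 by (auto simp: indicator_def fun_eq_iff zero_le_mult_iff)
  finally show ?thesis
    using t by (simp add: duhamel_def time_clamp_id scaleR_conv_of_real)
qed

text \<open>One factor \<open>W\<close> absorbs the polynomial weight, the other remains as an
  integrable majorant.\<close>

lemma conv_weight_decay:
  assumes W: "conv_weight W K"
  shows "\<exists>C\<ge>0. \<forall>\<xi>. (1 + \<xi>\<^sup>2) powr \<sigma> * (W \<xi>)\<^sup>2 \<le> C * W \<xi>"
    and "integrable lborel (\<lambda>\<xi>. \<bar>\<xi>\<bar> * W \<xi>)"
proof -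
  note Wf = conv_weightD[OF W]
  have ex: "\<exists>C. \<forall>\<xi>. (1 + \<xi>\<^sup>2) powr \<sigma> * W \<xi> \<le> C" for \<sigma>
    using W unfolding conv_weight_def by blast
  obtain C where C: "\<And>\<xi>. (1 + \<xi>\<^sup>2) powr \<sigma> * W \<xi> \<le> C"
    using ex by blast
  have "C \<ge> 0"
    using C[of 0] Wf(3)[of 0] by simp
  moreover have "(1 + \<xi>\<^sup>2) powr \<sigma> * (W \<xi>)\<^sup>2 \<le> C * W \<xi>" for \<xi>
    using mult_right_mono[OF C[of \<xi>], of "W \<xi>"] Wf(3)[of \<xi>] by (simp add: power2_eq_square mult.assoc)
  ultimately show "\<exists>C\<ge>0. \<forall>\<xi>. (1 + \<xi>\<^sup>2) powr \<sigma> * (W \<xi>)\<^sup>2 \<le> C * W \<xi>"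
    by blast
  obtain C2 where C2: "\<And>\<xi>. (1 + \<xi>\<^sup>2) powr 2 * W \<xi> \<le> C2"
    using ex by blast
  show "integrable lborel (\<lambda>\<xi>. \<bar>\<xi>\<bar> * W \<xi>)"
  proof (rule integrable_dominated(1)[OF _ integrable_mult_right[OF integrable_inverse_one_plus_square]])
    show "(\<lambda>\<xi>. \<bar>\<xi>\<bar> * W \<xi>) \<in> borel_measurable borel"
      using Wf(2) by measurable
    show "norm (\<bar>\<xi>\<bar> * W \<xi>) \<le> C2 * (1 / (1 + \<xi>\<^sup>2))" for \<xi>
    proof -
      have pos: "1 + \<xi>\<^sup>2 > 0"
        by (simp add: add_pos_nonneg)
      have "2 * \<bar>\<xi>\<bar> \<le> 1 + \<xi>\<^sup>2"
        using sum_squares_bound[of 1 "\<bar>\<xi>\<bar>"] by simp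
      then have "\<bar>\<xi>\<bar> \<le> 1 + \<xi>\<^sup>2"
        by linarith
      then have "(\<bar>\<xi>\<bar> * W \<xi>) * (1 + \<xi>\<^sup>2) \<le> ((1 + \<xi>\<^sup>2) * W \<xi>) * (1 + \<xi>\<^sup>2)"
        using pos Wf(3)[of \<xi>] by (intro mult_right_mono) auto
      also have "\<dots> = (1 + \<xi>\<^sup>2) powr 2 * W \<xi>"
        using powr_numeral[of "1 + \<xi>\<^sup>2" "num.Bit0 num.One"] pos by (simp add: power2_eq_square)
      also have "\<dots> \<le> C2"
        by (rule C2)
      finally show ?thesis
        using pos Wf(3)[of \<xi>] by (simp add: pos_le_divide_eq abs_mult)
    qed
  qed
qed

text \<open>The fundamental theorem of calculus gives the equation frequency by frequency.
  Everything else follows from the majorant \<open>R * W\<close>, which is uniform in time: it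
  provides all Sobolev norms, their continuity, and differentiation under the inverse
  transform.\<close>

theorem hw_solution_of_fixed_point:
  fixes \<mu> T K R :: real and \<phi> :: "real \<Rightarrow> complex" and g :: "real \<Rightarrow> real \<Rightarrow> complex"
  assumes W: "conv_weight W K" and T: "T > 0"
    and gc: "continuous_on UNIV (\<lambda>(t, \<xi>). g t \<xi>)" and bd: "\<And>t \<xi>. norm (g t \<xi>) \<le> R * W \<xi>"
    and fp: "\<And>t \<xi>. g t \<xi> = cis (- (time_clamp T t * \<bar>\<xi>\<bar>)) * (\<phi> \<xi> - \<i> * \<mu> * duhamel T (\<lambda>\<tau>. cubic (g \<tau>)) t \<xi>)"
  shows "hw_solution \<mu> T (inv_fourier \<phi>) (\<lambda>t. inv_fourier (g t))"
    and "\<And>t. has_fourier (inv_fourier (g t)) (g t)"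
    and "\<And>t \<sigma>. integrable lborel (\<lambda>\<xi>. (1 + \<xi>\<^sup>2) powr \<sigma> * (cmod (g t \<xi>))\<^sup>2)"
proof -
  note Wf = conv_weightD[OF W]
  have R: "R \<ge> 0"
    using bd[of 0 0] Wf(3)[of 0] by (meson norm_ge_zero order_trans zero_le_mult_iff not_less)
  have gcx: "continuous_on UNIV (g t)" for t
    using continuous_on_slices(1)[of UNIV g t] gc by simp
  have gct: "continuous_on S (\<lambda>t. g t \<xi>)" for \<xi> S
    using continuous_on_slices(2)[of UNIV g \<xi>] gc continuous_on_subset by auto
  have gm [measurable]: "g t \<in> borel_measurable borel" for t
    by (intro borel_measurable_continuous_onI gcx)
  have iRW: "integrable lborel (\<lambda>\<xi>. R * W \<xi>)"
    by (intro integrable_mult_right Wf(8))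
  have gi: "integrable lborel (g t)" for t
    by (rule integrable_dominated(1)[OF gm iRW bd])
  show hf: "has_fourier (inv_fourier (g t)) (g t)" for t
    by (rule has_fourier_inv_fourier[OF gi])
  define F where "F = (\<lambda>t. cubic (g t))"
  have Fc: "continuous_on UNIV (\<lambda>(t, \<xi>). F t \<xi>)"
    unfolding F_def by (rule cubic_continuous[OF W gc bd])
  define R3 where "R3 = K\<^sup>2 * R ^ 3"
  have Fbd: "norm (F t \<xi>) \<le> R3 * W \<xi>" for t \<xi>
    unfolding F_def R3_def by (rule cubic_bound[OF W gm bd])
  have R3: "R3 \<ge> 0"
    using R by (simp add: R3_def)
  have Fm [measurable]: "F t \<in> borel_measurable borel" for t
    using continuous_on_slices(1)[of UNIV F t] Fc by (intro borel_measurable_continuous_onI) simp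
  have Fi: "integrable lborel (F t)" for t
    by (rule integrable_dominated(1)[OF Fm integrable_mult_right[OF Wf(8)] Fbd])
  define g' where "g' = (\<lambda>t \<xi>. - \<i> * (complex_of_real \<bar>\<xi>\<bar> * g t \<xi> + \<mu> * F t \<xi>))"
  have g'c: "continuous_on UNIV (\<lambda>(t, \<xi>). g' t \<xi>)"
    using gc Fc unfolding g'_def case_prod_unfold by (intro continuous_intros)
  have g'm [measurable]: "g' t \<in> borel_measurable borel" for t
    unfolding g'_def by measurable
  \<comment> \<open>A majorant of the time derivative that does not depend on time.\<close>
  define H where "H = (\<lambda>\<xi>. R * (\<bar>\<xi>\<bar> * W \<xi>) + \<bar>\<mu>\<bar> * R3 * W \<xi>)"
  have Hi: "integrable lborel H"
    unfolding H_def by (intro Bochner_Integration.integrable_add integrable_mult_right conv_weight_decay(2)[OF W] Wf(8))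
  have g'bd: "norm (g' t \<xi>) \<le> H \<xi>" for t \<xi>
  proof -
    have "norm (g' t \<xi>) \<le> \<bar>\<xi>\<bar> * norm (g t \<xi>) + \<bar>\<mu>\<bar> * norm (F t \<xi>)"
      unfolding g'_def norm_mult norm_minus_cancel norm_ii mult_1_left
      by (rule order_trans[OF norm_triangle_ineq]) (simp add: norm_mult)
    also have "\<dots> \<le> \<bar>\<xi>\<bar> * (R * W \<xi>) + \<bar>\<mu>\<bar> * (R3 * W \<xi>)"
      by (intro add_mono mult_left_mono bd Fbd) auto
    finally show ?thesis
      by (simp add: H_def mult_ac)
  qed
  have der: "((\<lambda>t. g t \<xi>) has_vector_derivative g' t \<xi>) (at t within {0..T})" if t: "t \<in> {0..T}" for t \<xi>
  proof -
    let ?f = "\<lambda>\<tau>. cis (\<tau> * \<bar>\<xi>\<bar>) * F \<tau> \<xi>"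
    have fc: "continuous_on {0..T} ?f"
      by (intro continuous_intros joint_continuous_compose[OF Fc])
    have "((\<lambda>t. integral {0..t} ?f) has_vector_derivative ?f t) (at t within {0..T})"
      by (rule integral_has_vector_derivative[OF fc t])
    then have D1: "((\<lambda>t. \<phi> \<xi> - \<i> * \<mu> * integral {0..t} ?f) has_vector_derivative 0 - \<i> * \<mu> * ?f t) (at t within {0..T})"
      by (intro has_vector_derivative_diff has_vector_derivative_const has_vector_derivative_mult_right)
    have D2: "((\<lambda>t. cis (- \<bar>\<xi>\<bar> * t)) has_vector_derivative \<i> * (- \<bar>\<xi>\<bar>) * cis (- \<bar>\<xi>\<bar> * t)) (at t within {0..T})"
      using has_vector_derivative_cis_linear[of "- \<bar>\<xi>\<bar>" t "{0..T}"] by simp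
    have geq: "g t \<xi> = cis (- \<bar>\<xi>\<bar> * t) * (\<phi> \<xi> - \<i> * \<mu> * integral {0..t} ?f)" if "t \<in> {0..T}" for t
      using fp[of t \<xi>] duhamel_eq_integral[OF Fc that, of \<xi>] that by (simp add: F_def time_clamp_id mult.commute)
    have "cis (- \<bar>\<xi>\<bar> * t) * (0 - \<i> * \<mu> * ?f t) + \<i> * (- \<bar>\<xi>\<bar>) * cis (- \<bar>\<xi>\<bar> * t) * (\<phi> \<xi> - \<i> * \<mu> * integral {0..t} ?f) = g' t \<xi>"
    proof -
      have c1: "cis (- \<bar>\<xi>\<bar> * t) * cis (t * \<bar>\<xi>\<bar>) = 1"
        by (simp add: cis_mult mult.commute)
      have "cis (- \<bar>\<xi>\<bar> * t) * (0 - \<i> * \<mu> * ?f t) = - \<i> * \<mu> * F t \<xi> * (cis (- \<bar>\<xi>\<bar> * t) * cis (t * \<bar>\<xi>\<bar>))"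
        by (simp add: mult_ac)
      moreover have "\<i> * (- \<bar>\<xi>\<bar>) * cis (- \<bar>\<xi>\<bar> * t) * (\<phi> \<xi> - \<i> * \<mu> * integral {0..t} ?f) = - \<i> * \<bar>\<xi>\<bar> * g t \<xi>"
        unfolding geq[OF t] by (simp add: mult_ac)
      ultimately show ?thesis
        unfolding c1 by (simp add: g'_def algebra_simps)
    qed
    then have "((\<lambda>t. cis (- \<bar>\<xi>\<bar> * t) * (\<phi> \<xi> - \<i> * \<mu> * integral {0..t} ?f)) has_vector_derivative g' t \<xi>) (at t within {0..T})"
      using has_vector_derivative_mult[OF D2 D1] by simp
    then show ?thesis
      by (rule has_vector_derivative_transform[OF t, rotated]) (use geq in auto)
  qed
  have wi: "integrable lborel (\<lambda>\<xi>. complex_of_real \<bar>\<xi>\<bar> * g t \<xi>)" for t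
  proof (rule integrable_dominated(1))
    show "integrable lborel (\<lambda>\<xi>. R * (\<bar>\<xi>\<bar> * W \<xi>))"
      by (intro integrable_mult_right conv_weight_decay(2)[OF W])
    show "norm (complex_of_real \<bar>\<xi>\<bar> * g t \<xi>) \<le> R * (\<bar>\<xi>\<bar> * W \<xi>)" for \<xi>
      using mult_left_mono[OF bd[of t \<xi>], of "\<bar>\<xi>\<bar>"] by (simp add: norm_mult mult_ac)
  qed measurable
  have g'i: "integrable lborel (g' t)" for t
    by (rule integrable_dominated(1)[OF g'm Hi g'bd])
  \<comment> \<open>Stated for a general family because it is applied to \<open>g\<close> itself and
    to the differences \<open>g t - g t0\<close>.\<close>
  have Sob: "\<exists>C\<ge>0. \<forall>t \<xi>. norm ((1 + \<xi>\<^sup>2) powr \<sigma> * (cmod (k t \<xi>))\<^sup>2) \<le> C * W \<xi>"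
    if "\<And>t \<xi>. norm (k t \<xi>) \<le> r * W \<xi>" for \<sigma> r and k :: "real \<Rightarrow> real \<Rightarrow> complex"
  proof -
    obtain C where C: "C \<ge> 0" "\<And>\<xi>. (1 + \<xi>\<^sup>2) powr \<sigma> * (W \<xi>)\<^sup>2 \<le> C * W \<xi>"
      using conv_weight_decay(1)[OF W] by blast
    have "norm ((1 + \<xi>\<^sup>2) powr \<sigma> * (cmod (k t \<xi>))\<^sup>2) \<le> (r\<^sup>2 * C) * W \<xi>" for t \<xi>
    proof -
      have "(1 + \<xi>\<^sup>2) powr \<sigma> * (cmod (k t \<xi>))\<^sup>2 \<le> (1 + \<xi>\<^sup>2) powr \<sigma> * (r * W \<xi>)\<^sup>2"
        by (intro mult_left_mono power_mono that) auto
      also have "\<dots> = r\<^sup>2 * ((1 + \<xi>\<^sup>2) powr \<sigma> * (W \<xi>)\<^sup>2)"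
        by (simp add: power_mult_distrib)
      also have "\<dots> \<le> r\<^sup>2 * (C * W \<xi>)"
        by (intro mult_left_mono C) auto
      finally show ?thesis
        by (simp add: abs_mult mult.assoc)
    qed
    then show ?thesis
      using C(1) by (intro exI[of _ "r\<^sup>2 * C"]) auto
  qed
  show Hs: "integrable lborel (\<lambda>\<xi>. (1 + \<xi>\<^sup>2) powr \<sigma> * (cmod (g t \<xi>))\<^sup>2)" for t \<sigma>
  proof -
    obtain C where C: "C \<ge> 0" "\<And>t \<xi>. norm ((1 + \<xi>\<^sup>2) powr \<sigma> * (cmod (g t \<xi>))\<^sup>2) \<le> C * W \<xi>"
      using Sob[of g R \<sigma>] bd by blast
    show ?thesis
      by (rule integrable_dominated(1)[OF _ integrable_mult_right[OF Wf(8)] C(2)]) measurable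
  qed
  show "hw_solution \<mu> T (inv_fourier \<phi>) (\<lambda>t. inv_fourier (g t))"
    unfolding hw_solution_def
  proof (intro conjI ballI allI impI exI[of _ "\<lambda>t. inv_fourier (g' t)"])
    have "g 0 = \<phi>"
      using fp[of 0] T by (auto simp: time_clamp_def duhamel_def fun_eq_iff)
    then show "inv_fourier (g 0) = inv_fourier \<phi>"
      by simp
    show "H_infty (inv_fourier (g t))" for t
      unfolding H_infty_def using in_H_iff[OF hf] Hs by blast
    show "((\<lambda>t. sobolev_norm \<sigma> (\<lambda>x. inv_fourier (g t) x - inv_fourier (g t0) x)) \<longlongrightarrow> 0) (at t0 within {0..T})"
      if "t0 \<in> {0..T}" for \<sigma> t0
    proof -
      let ?S = "\<lambda>t. \<integral>\<xi>. (1 + \<xi>\<^sup>2) powr \<sigma> * (cmod (g t \<xi> - g t0 \<xi>))\<^sup>2 \<partial>lborel"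
      have "norm (g t \<xi> - g t0 \<xi>) \<le> (2 * R) * W \<xi>" for t \<xi>
        using norm_triangle_ineq4[of "g t \<xi>" "g t0 \<xi>"] bd[of t \<xi>] bd[of t0 \<xi>] by simp
      then obtain C where C: "\<And>t \<xi>. norm ((1 + \<xi>\<^sup>2) powr \<sigma> * (cmod (g t \<xi> - g t0 \<xi>))\<^sup>2) \<le> C * W \<xi>"
        using Sob[of "\<lambda>t \<xi>. g t \<xi> - g t0 \<xi>" "2 * R" \<sigma>] by blast
      have "continuous_on {0..T} ?S"
        by (rule continuous_on_lborel_integral[OF _ _ integrable_mult_right[OF Wf(8)] C])
           (auto intro!: continuous_intros gct)
      then have "(?S \<longlongrightarrow> ?S t0) (at t0 within {0..T})"
        using that unfolding continuous_on_def by blast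
      then have "((\<lambda>t. (1 / sqrt (2 * pi)) * sqrt (?S t)) \<longlongrightarrow> (1 / sqrt (2 * pi)) * sqrt (?S t0)) (at t0 within {0..T})"
        by (intro tendsto_intros)
      then show ?thesis
        unfolding sobolev_norm_eq[OF has_fourier_diff[OF hf hf]] by simp
    qed
    have joint: "continuous_on UNIV (\<lambda>(t, x). inv_fourier (k t) x)"
      if kc: "continuous_on UNIV (\<lambda>(t, \<xi>). k t \<xi>)" and kb: "\<And>t \<xi>. norm (k t \<xi>) \<le> h \<xi>" and hi: "integrable lborel h"
      for k :: "real \<Rightarrow> real \<Rightarrow> complex" and h
    proof -
      have km: "k t \<in> borel_measurable borel" for t
        using continuous_on_slices(1)[of UNIV k t] kc by (intro borel_measurable_continuous_onI) simp
      have "continuous_on UNIV (\<lambda>z. \<integral>\<xi>. cis (snd z * \<xi>) * k (fst z) \<xi> \<partial>lborel)"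
        by (rule continuous_on_lborel_integral[OF _ _ hi])
           (use km in \<open>auto intro!: continuous_intros joint_continuous_compose[OF kc] simp: norm_mult kb\<close>)
      then show ?thesis
        unfolding inv_fourier_def case_prod_unfold by (intro continuous_intros) auto
    qed
    show "continuous_on ({0..T} \<times> UNIV) (\<lambda>(t, x). inv_fourier (g t) x)"
      using joint[OF gc bd iRW] by (rule continuous_on_subset) auto
    show "continuous_on ({0..T} \<times> UNIV) (\<lambda>(t, x). inv_fourier (g' t) x)"
      using joint[OF g'c g'bd Hi] by (rule continuous_on_subset) auto
    show "((\<lambda>\<tau>. inv_fourier (g \<tau>) x) has_vector_derivative inv_fourier (g' t) x) (at t within {0..T})"
      if t: "t \<in> {0..T}" for x t
    proof -
      have "((\<lambda>t. \<integral>\<xi>. cis (x * \<xi>) * g t \<xi> \<partial>lborel) has_vector_derivative (\<integral>\<xi>. cis (x * \<xi>) * g' t \<xi> \<partial>lborel)) (at t within {0..T})"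
      proof (rule has_vector_derivative_lborel_integral[OF _ _ _ Hi _ t])
        show "((\<lambda>t. cis (x * \<xi>) * g t \<xi>) has_vector_derivative cis (x * \<xi>) * g' t \<xi>) (at t within {0..T})"
          if "t \<in> {0..T}" for t \<xi>
          by (intro has_vector_derivative_mult_right der that)
      qed (auto simp: gi norm_mult g'bd)
      then show ?thesis
        unfolding inv_fourier_def by (intro has_vector_derivative_divide)
    qed
    show "\<exists>w. is_absD (inv_fourier (g t)) w \<and> (AE x in lborel. \<i> * inv_fourier (g' t) x - w x
        = complex_of_real (\<mu> * (cmod (inv_fourier (g t) x))\<^sup>2) * inv_fourier (g t) x)" for t
    proof (intro exI conjI AE_I2)
      let ?w = "inv_fourier (\<lambda>\<xi>. complex_of_real \<bar>\<xi>\<bar> * g t \<xi>)"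
      show "is_absD (inv_fourier (g t)) ?w"
        unfolding is_absD_def using hf has_fourier_inv_fourier[OF wi] by blast
      fix x
      have "inv_fourier (g' t) x = - \<i> * (?w x + \<mu> * inv_fourier (F t) x)"
        unfolding g'_def inv_fourier_cmult
        using inv_fourier_add[OF wi integrable_mult_right[OF Fi], of t \<mu> t x] by (simp add: inv_fourier_cmult)
      then show "\<i> * inv_fourier (g' t) x - ?w x = complex_of_real (\<mu> * (cmod (inv_fourier (g t) x))\<^sup>2) * inv_fourier (g t) x"
        by (simp add: F_def inv_fourier_cubic[OF gi] mult.assoc)
    qed
  qed
qed

subsection \<open>Norm inflation\<close>

text \<open>A trapezoid, equal to 1 on \<open>[-1/2, 1/2]\<close> and 0 outside
  \<open>[-1, 1]\<close>; the fixed point argument asks for a continuous datum.\<close>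

definition tent :: "real \<Rightarrow> real" where
  "tent x = max 0 (min 1 (2 - 2 * \<bar>x\<bar>))"

text \<open>The factor \<open>weight\<close> makes the bound \<open>A * weight\<close> required by
  the iteration hold with constant 1; on the two bumps it costs only a constant independent of
  \<open>N\<close>.\<close>

definition datum :: "real \<Rightarrow> real \<Rightarrow> real \<Rightarrow> real" where
  "datum A N \<xi> = A * weight N \<xi> * (tent (\<xi> - N) + tent (\<xi> - 2 * N))"

lemma datum_facts:
  assumes A: "A > 0" and N: "N \<ge> 3"
  shows "continuous_on UNIV (datum A N)" "0 \<le> datum A N \<xi>" "datum A N \<xi> \<le> A * weight N \<xi>"
    and "datum A N \<xi> \<noteq> 0 \<Longrightarrow> \<xi> \<in> {N - 1..N + 1} \<union> {2 * N - 1..2 * N + 1}"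
    and "k = 1 \<or> k = 2 \<Longrightarrow> \<bar>\<xi> - k * N\<bar> \<le> 1 / 2 \<Longrightarrow> A * (exp (- 3) / (10 * (1 + pi\<^sup>2))) \<le> datum A N \<xi>"
proof -
  show "continuous_on UNIV (datum A N)"
    unfolding datum_def tent_def using N by (intro continuous_intros continuous_on_weight) auto
  have t: "0 \<le> tent (\<xi> - N) + tent (\<xi> - 2 * N)" "tent (\<xi> - N) + tent (\<xi> - 2 * N) \<le> 1"
  proof -
    \<comment> \<open>The distance between the two centres is at least 3, so the tents never
      overlap.\<close>
    have "\<bar>\<xi> - N\<bar> \<ge> 1 \<or> \<bar>\<xi> - 2 * N\<bar> \<ge> 1"
      using N by arith
    then have "tent (\<xi> - N) = 0 \<or> tent (\<xi> - 2 * N) = 0"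
      by (auto simp: tent_def)
    moreover have "0 \<le> tent x" "tent x \<le> 1" for x
      by (auto simp: tent_def)
    ultimately show "0 \<le> tent (\<xi> - N) + tent (\<xi> - 2 * N)" "tent (\<xi> - N) + tent (\<xi> - 2 * N) \<le> 1"
      by auto
  qed
  show "0 \<le> datum A N \<xi>"
    unfolding datum_def using A weight_pos[of N \<xi>] t by (intro mult_nonneg_nonneg) auto
  have "A * weight N \<xi> * (tent (\<xi> - N) + tent (\<xi> - 2 * N)) \<le> A * weight N \<xi> * 1"
    using A weight_pos[of N \<xi>] t by (intro mult_left_mono) auto
  then show "datum A N \<xi> \<le> A * weight N \<xi>"
    by (simp add: datum_def)
  show "\<xi> \<in> {N - 1..N + 1} \<union> {2 * N - 1..2 * N + 1}" if "datum A N \<xi> \<noteq> 0"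
  proof (rule ccontr)
    assume "\<not> ?thesis"
    then have "tent (\<xi> - N) = 0" "tent (\<xi> - 2 * N) = 0"
      by (auto simp: tent_def)
    then show False
      using that by (simp add: datum_def)
  qed
  assume k: "k = 1 \<or> k = 2" and x: "\<bar>\<xi> - k * N\<bar> \<le> 1 / 2"
  have "1 \<le> tent (\<xi> - N) + tent (\<xi> - 2 * N)"
    using k x by (auto simp: tent_def)
  moreover have "exp (- 3) / (10 * (1 + pi\<^sup>2)) \<le> weight N \<xi>"
    using N k x by (intro weight_lower_bound[where k = k]) auto
  ultimately have "A * (exp (- 3) / (10 * (1 + pi\<^sup>2))) * 1 \<le> A * weight N \<xi> * (tent (\<xi> - N) + tent (\<xi> - 2 * N))"
    using A weight_pos[of N \<xi>] by (intro mult_mono mult_left_mono) auto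
  then show "A * (exp (- 3) / (10 * (1 + pi\<^sup>2))) \<le> datum A N \<xi>"
    by (simp add: datum_def)
qed

lemma integral_ge_on_interval:
  fixes f :: "real \<Rightarrow> real"
  assumes f: "integrable lborel f" "\<And>x. 0 \<le> f x" and ab: "a \<le> b" and m: "\<And>x. x \<in> {a..b} \<Longrightarrow> m \<le> f x"
  shows "(b - a) * m \<le> (\<integral>x. f x \<partial>lborel)"
proof -
  have "(b - a) * m = (\<integral>x. m * indicator {a..b} x \<partial>lborel)"
    using ab by simp
  also have "\<dots> \<le> (\<integral>x. f x \<partial>lborel)"
  proof (rule integral_mono[OF _ f(1)])
    show "integrable lborel (\<lambda>x. m * indicator {a..b} x)"
      by (intro integrable_mult_right integrable_real_indicator) (auto simp: emeasure_lborel_Icc_eq)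
    show "m * indicator {a..b} x \<le> f x" for x
      using m[of x] f(2)[of x] by (auto simp: indicator_def)
  qed
  finally show ?thesis .
qed

lemma conv_of_real: "conv (\<lambda>\<xi>. complex_of_real (f \<xi>)) (\<lambda>\<xi>. complex_of_real (h \<xi>)) \<eta> = complex_of_real (conv f h \<eta>)"
  by (simp add: conv_def flip: of_real_mult)

lemma conv_nonneg: "(\<And>\<xi>. 0 \<le> f \<xi>) \<Longrightarrow> (\<And>\<xi>. 0 \<le> h \<xi>) \<Longrightarrow> 0 \<le> conv f h (\<eta> :: real)" for f h :: "real \<Rightarrow> real"
  unfolding conv_def by (intro Bochner_Integration.integral_nonneg) auto

text \<open>The interaction \<open>N - 2N + N\<close> feeds the frequencies near zero.\<close>

lemma cubic_datum_lower_bound: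
  assumes A: "A > 0" and N: "N \<ge> 3" and \<xi>: "\<xi> \<in> {0..1/2}"
  defines "c \<equiv> exp (- 3) / (10 * (1 + pi\<^sup>2))"
  obtains r where "cubic (\<lambda>\<eta>. complex_of_real (datum A N \<eta>)) \<xi> = complex_of_real r"
    and "A ^ 3 * (c ^ 3 / (32 * pi\<^sup>2)) \<le> r"
proof
  let ?d = "datum A N"
  note df = datum_facts[OF A N]
  have c: "c > 0"
    by (simp add: c_def add_pos_nonneg)
  have W: "conv_weight (weight N) (48 * pi\<^sup>2)"
    using N by (intro conv_weight_weight) auto
  have m [measurable]: "?d \<in> borel_measurable borel"
    by (intro borel_measurable_continuous_onI df(1))
  have cm: "(\<lambda>\<eta>. complex_of_real (?d \<eta>)) \<in> borel_measurable borel"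
    by measurable
  have cd: "norm (complex_of_real (?d \<eta>)) \<le> A * weight N \<eta>" for \<eta>
    using df(2,3)[of \<eta>] by simp
  have int1: "integrable lborel (\<lambda>\<zeta>. ?d \<zeta> * ?d (\<eta> - \<zeta>))" for \<eta>
    using integrable_Re[OF conv_bound(1)[OF W cm cm cd cd, of \<eta>]] by simp
  \<comment> \<open>For \<open>\<zeta>\<close> in a window of length 1/4 above \<open>N\<close>,
    both \<open>\<zeta>\<close> and \<open>\<eta> - \<zeta>\<close> are within 1/2 of
    \<open>N\<close>, where the datum is at least \<open>A * c\<close>.\<close>
  have cv: "A\<^sup>2 * c\<^sup>2 / 4 \<le> conv ?d ?d \<eta>" if \<eta>: "\<eta> \<in> {2 * N..2 * N + 1/2}" for \<eta>
  proof -
    have "((N + 1/4) - N) * ((A * c) * (A * c)) \<le> conv ?d ?d \<eta>"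
      unfolding conv_def
    proof (rule integral_ge_on_interval[OF int1])
      show "0 \<le> ?d x * ?d (\<eta> - x)" for x
        using df(2) by simp
      show "(A * c) * (A * c) \<le> ?d \<zeta> * ?d (\<eta> - \<zeta>)" if "\<zeta> \<in> {N..N + 1/4}" for \<zeta>
      proof -
        have "\<bar>\<zeta> - 1 * N\<bar> \<le> 1 / 2" "\<bar>(\<eta> - \<zeta>) - 1 * N\<bar> \<le> 1 / 2"
          using that \<eta> unfolding abs_le_iff by auto
        then show ?thesis
          using A c df(2) by (intro mult_mono df(5)[where k = 1, folded c_def]) auto
      qed
    qed auto
    then show ?thesis
      by (simp add: power2_eq_square mult_ac)
  qed
  define r where "r = (\<integral>\<eta>. conv ?d ?d \<eta> * ?d (\<eta> - \<xi>) \<partial>lborel) / (2 * pi)\<^sup>2"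
  have eq: "(\<lambda>\<eta>. complex_of_real (conv ?d ?d \<eta>) * cnj (complex_of_real (?d (- (\<xi> - \<eta>))))) = (\<lambda>\<eta>. complex_of_real (conv ?d ?d \<eta> * ?d (\<eta> - \<xi>)))"
    by simp
  show "cubic (\<lambda>\<eta>. complex_of_real (?d \<eta>)) \<xi> = complex_of_real r"
    unfolding cubic_def conv_of_real conv_def[of "\<lambda>\<eta>. complex_of_real (conv _ _ \<eta>)"] conv_of_real eq
    unfolding r_def by (simp only: integral_complex_of_real of_real_divide)
  have cm2: "(\<lambda>\<eta>. complex_of_real (conv ?d ?d \<eta>)) \<in> borel_measurable borel"
    unfolding conv_of_real[symmetric] using cm by measurable
  have cd2: "norm (complex_of_real (conv ?d ?d \<eta>)) \<le> (A * A * (48 * pi\<^sup>2)) * weight N \<eta>" for \<eta>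
    using conv_bound(2)[OF W cm cm cd cd, of \<eta>] by (simp add: conv_of_real)
  have cd': "norm (complex_of_real (?d (- \<eta>))) \<le> A * weight N \<eta>" for \<eta>
    using cd[of "- \<eta>"] by (simp add: weight_minus)
  have int2: "integrable lborel (\<lambda>\<eta>. conv ?d ?d \<eta> * ?d (\<eta> - \<xi>))"
    using integrable_Re[OF conv_bound(1)[OF W cm2 _ cd2 cd', of \<xi>]] by simp
  \<comment> \<open>The outer window has length 1/2. Together with the inner 1/4 and the
    \<open>(2 * pi)^2\<close> in \<open>cubic\<close> this makes the \<open>32 * pi^2\<close> of the
    claim.\<close>
  have "((2 * N + 1/2) - 2 * N) * ((A\<^sup>2 * c\<^sup>2 / 4) * (A * c)) \<le> (\<integral>\<eta>. conv ?d ?d \<eta> * ?d (\<eta> - \<xi>) \<partial>lborel)"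
  proof (rule integral_ge_on_interval[OF int2])
    show "0 \<le> conv ?d ?d x * ?d (x - \<xi>)" for x
      using df(2) by (intro mult_nonneg_nonneg conv_nonneg) auto
    show "(A\<^sup>2 * c\<^sup>2 / 4) * (A * c) \<le> conv ?d ?d \<eta> * ?d (\<eta> - \<xi>)" if "\<eta> \<in> {2 * N..2 * N + 1/2}" for \<eta>
    proof -
      have "\<bar>(\<eta> - \<xi>) - 2 * N\<bar> \<le> 1 / 2"
        using that \<xi> unfolding abs_le_iff by auto
      then show ?thesis
        using that A c df(2) by (intro mult_mono cv conv_nonneg df(5)[where k = 2, folded c_def]) auto
    qed
  qed auto
  then have "((2 * N + 1/2) - 2 * N) * ((A\<^sup>2 * c\<^sup>2 / 4) * (A * c)) / (2 * pi)\<^sup>2 \<le> r"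
    unfolding r_def by (intro divide_right_mono) auto
  then show "A ^ 3 * (c ^ 3 / (32 * pi\<^sup>2)) \<le> r"
    by (simp add: power2_eq_square power3_eq_cube mult_ac)
qed

text \<open>This is the exact resonance. A phase linear in the frequency is a character: it adds up
  along convolutions and is unchanged by reflecting and conjugating. In physical space it is a
  translation.\<close>

lemma cubic_modulate: "cubic (\<lambda>\<eta>. cis (- (a * \<eta>)) * f \<eta>) \<xi> = cis (- (a * \<xi>)) * cubic f \<xi>"
proof -
  have cc: "conv (\<lambda>\<eta>. cis (- (a * \<eta>)) * f \<eta>) (\<lambda>\<eta>. cis (- (a * \<eta>)) * h \<eta>) \<xi> = cis (- (a * \<xi>)) * conv f h \<xi>" for f h \<xi>
  proof -
    have "(cis (- (a * \<eta>)) * f \<eta>) * (cis (- (a * (\<xi> - \<eta>))) * h (\<xi> - \<eta>)) = cis (- (a * \<xi>)) * (f \<eta> * h (\<xi> - \<eta>))" for \<eta>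
      using cis_mult[of "- (a * \<eta>)" "- (a * (\<xi> - \<eta>))"] by (simp add: right_diff_distrib mult_ac)
    then show ?thesis
      by (simp only: conv_def integral_mult_right_zero)
  qed
  have "(\<lambda>\<eta>. cnj (cis (- (a * - \<eta>)) * f (- \<eta>))) = (\<lambda>\<eta>. cis (- (a * \<eta>)) * cnj (f (- \<eta>)))"
    by (simp add: cis_cnj)
  moreover have "conv (\<lambda>\<eta>. cis (- (a * \<eta>)) * f \<eta>) (\<lambda>\<eta>. cis (- (a * \<eta>)) * f \<eta>) = (\<lambda>\<eta>. cis (- (a * \<eta>)) * conv f f \<eta>)"
    by (rule ext) (rule cc)
  ultimately show ?thesis
    unfolding cubic_def by (simp only: cc) simp
qed

text \<open>Both constants are fixed before \<open>A\<close>, \<open>N\<close> and \<mu>. Their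
  independence of \<open>N\<close> is what allows \<open>N\<close> to be sent to infinity when
  \<open>A\<close> and the time are already fixed.\<close>

theorem low_frequency_growth:
  obtains \<delta> c where "\<delta> > 0" "c > 0"
    and "\<And>A N \<mu>. A > 0 \<Longrightarrow> N \<ge> 3 \<Longrightarrow> \<bar>\<mu>\<bar> = 1 \<Longrightarrow>
      \<exists>g. hw_solution \<mu> (\<delta> / A\<^sup>2) (inv_fourier (\<lambda>\<xi>. complex_of_real (datum A N \<xi>))) (\<lambda>t. inv_fourier (g t)) \<and>
        has_fourier (inv_fourier (g (\<delta> / A\<^sup>2))) (g (\<delta> / A\<^sup>2)) \<and>
        (\<forall>\<sigma>. integrable lborel (\<lambda>\<xi>. (1 + \<xi>\<^sup>2) powr \<sigma> * (cmod (g (\<delta> / A\<^sup>2) \<xi>))\<^sup>2)) \<and>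
        (\<forall>\<xi>\<in>{0..1/2}. c * A \<le> cmod (g (\<delta> / A\<^sup>2) \<xi>))"
proof -
  define K where "K = 48 * pi\<^sup>2"
  define c0 where "c0 = (exp (- 3) / (10 * (1 + pi\<^sup>2))) ^ 3 / (32 * pi\<^sup>2)"
  \<comment> \<open>The first bound makes the iteration contract. The second makes the error
    \<open>96 K^4 \<delta>^2 A\<close>, from replacing \<open>g\<close> by the free evolution, at
    most half of the resonant term \<open>\<delta> * c0 * A\<close>.\<close>
  define \<delta> where "\<delta> = min (1 / (24 * K\<^sup>2)) (c0 / (192 * K ^ 4))"
  have K: "K > 0"
    by (simp add: K_def)
  have c0: "c0 > 0"
    by (simp add: c0_def add_pos_nonneg)
  have \<delta>: "\<delta> > 0"
    using K c0 by (simp add: \<delta>_def)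
  have \<delta>1: "24 * K\<^sup>2 * \<delta> \<le> 1"
  proof -
    have "24 * K\<^sup>2 * \<delta> \<le> 24 * K\<^sup>2 * (1 / (24 * K\<^sup>2))"
      by (intro mult_left_mono) (auto simp: \<delta>_def)
    then show ?thesis
      using K by simp
  qed
  have \<delta>2: "96 * K ^ 4 * \<delta> \<le> c0 / 2"
  proof -
    have "96 * K ^ 4 * \<delta> \<le> 96 * K ^ 4 * (c0 / (192 * K ^ 4))"
      using K by (intro mult_left_mono) (auto simp: \<delta>_def)
    then show ?thesis
      using K by simp
  qed
  show ?thesis
  proof (rule that[of \<delta> "\<delta> * c0 / 2"])
    show "\<delta> > 0" "\<delta> * c0 / 2 > 0"
      using \<delta> c0 by auto
    fix A N \<mu> :: real
    assume A: "A > 0" and N: "N \<ge> 3" and \<mu>: "\<bar>\<mu>\<bar> = 1"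
    let ?W = "weight N"
    define T where "T = \<delta> / A\<^sup>2"
    define \<phi> where "\<phi> = (\<lambda>\<xi>. complex_of_real (datum A N \<xi>))"
    note df = datum_facts[OF A N]
    have W: "conv_weight ?W K"
      unfolding K_def using N by (intro conv_weight_weight) auto
    note Wf = conv_weightD[OF W]
    have T: "T > 0"
      using \<delta> A by (simp add: T_def)
    have T': "T \<ge> 0"
      using T by simp
    have \<phi>c: "continuous_on UNIV \<phi>"
      unfolding \<phi>_def using df(1) by (intro continuous_intros)
    have \<phi>bd: "norm (\<phi> \<xi>) \<le> A * ?W \<xi>" for \<xi>
      using df(2,3)[of \<xi>] by (simp add: \<phi>_def)
    have small: "24 * K\<^sup>2 * A\<^sup>2 * T \<le> 1"
      using \<delta>1 A by (simp add: T_def)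
    obtain g :: "real \<Rightarrow> real \<Rightarrow> complex" where gc: "continuous_on UNIV (\<lambda>(t, \<xi>). g t \<xi>)"
      and gbd: "\<And>t \<xi>. norm (g t \<xi>) \<le> 2 * A * ?W \<xi>"
      and fp: "\<And>t \<xi>. g t \<xi> = cis (- (time_clamp T t * \<bar>\<xi>\<bar>)) * (\<phi> \<xi> - \<i> * \<mu> * duhamel T (\<lambda>\<tau>. cubic (g \<tau>)) t \<xi>)"
      using Picard_fixed_point[OF W \<phi>c \<phi>bd A T' small, of \<mu>] \<mu> by auto
    have gm: "g t \<in> borel_measurable borel" for t
      using continuous_on_slices(1)[of UNIV g t] gc by (intro borel_measurable_continuous_onI) simp
    \<comment> \<open>The free evolution of the datum, to be put in place of \<open>g\<close> inside
      the nonlinearity.\<close>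
    define l where "l = (\<lambda>t \<xi>. cis (- (time_clamp T t * \<bar>\<xi>\<bar>)) * \<phi> \<xi>)"
    have lc: "continuous_on UNIV (\<lambda>(t, \<xi>). l t \<xi>)"
      unfolding l_def case_prod_unfold by (intro continuous_intros continuous_on_compose2[OF \<phi>c]) auto
    have lbd: "norm (l t \<xi>) \<le> 2 * A * ?W \<xi>" for t \<xi>
      using \<phi>bd[of \<xi>] mult_pos_pos[OF A Wf(3)[of \<xi>]] by (simp add: l_def norm_mult)
    have lm: "l t \<in> borel_measurable borel" for t
      using continuous_on_slices(1)[of UNIV l t] lc by (intro borel_measurable_continuous_onI) simp
    have Gc: "continuous_on UNIV (\<lambda>(t, \<xi>). cubic (g t) \<xi>)" and Lc: "continuous_on UNIV (\<lambda>(t, \<xi>). cubic (l t) \<xi>)"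
      by (rule cubic_continuous[OF W gc gbd], rule cubic_continuous[OF W lc lbd])
    have Gbd: "norm (cubic (g t) \<xi>) \<le> K\<^sup>2 * (2 * A) ^ 3 * ?W \<xi>" and Lbd: "norm (cubic (l t) \<xi>) \<le> K\<^sup>2 * (2 * A) ^ 3 * ?W \<xi>" for t \<xi>
      by (rule cubic_bound[OF W gm gbd], rule cubic_bound[OF W lm lbd])
    define d where "d = T * (K\<^sup>2 * (2 * A) ^ 3)"
    have diff: "norm (g t \<xi> - l t \<xi>) \<le> d * ?W \<xi>" for t \<xi>
    proof -
      have "g t \<xi> - l t \<xi> = - (cis (- (time_clamp T t * \<bar>\<xi>\<bar>)) * (\<i> * \<mu> * duhamel T (\<lambda>\<tau>. cubic (g \<tau>)) t \<xi>))"
        by (subst fp) (simp add: l_def algebra_simps)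
      then have "norm (g t \<xi> - l t \<xi>) = norm (duhamel T (\<lambda>\<tau>. cubic (g \<tau>)) t \<xi>)"
        using \<mu> by (simp add: norm_mult)
      also have "\<dots> \<le> T * (K\<^sup>2 * (2 * A) ^ 3 * ?W \<xi>)"
        by (rule duhamel_bound[OF T' Gc Gbd])
      finally show ?thesis
        by (simp add: d_def mult.assoc)
    qed
    have cdiff: "norm (cubic (g t) \<xi> - cubic (l t) \<xi>) \<le> 3 * K\<^sup>2 * (2 * A)\<^sup>2 * d * ?W \<xi>" for t \<xi>
      by (rule cubic_diff_bound[OF W gm lm gbd lbd diff])
    have low: "\<delta> * c0 / 2 * A \<le> cmod (g T \<xi>)" if \<xi>: "\<xi> \<in> {0..1/2}" for \<xi>
    proof -
      obtain r where r: "cubic \<phi> \<xi> = complex_of_real r" "A ^ 3 * c0 \<le> r"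
        using cubic_datum_lower_bound[OF A N \<xi>] unfolding \<phi>_def c0_def by blast
      have r0: "r \<ge> 0"
        using r(2) A c0 by (meson mult_nonneg_nonneg less_imp_le order_trans zero_le_power)
      \<comment> \<open>The datum lives at frequencies at least \<open>N - 1\<close>, so at low
        frequency all of \<open>g T\<close> comes from the Duhamel term.\<close>
      have "\<phi> \<xi> = 0"
        using df(4)[of \<xi>] N \<xi> unfolding \<phi>_def by fastforce
      then have gT: "norm (g T \<xi>) = norm (duhamel T (\<lambda>\<tau>. cubic (g \<tau>)) T \<xi>)"
        using \<mu> by (subst fp) (simp add: norm_mult)
      \<comment> \<open>The datum has only positive frequencies, so the phase of its evolution is
        linear and \<open>cubic_modulate\<close> applies.\<close>
      have l_eq: "l t = (\<lambda>\<eta>. cis (- (time_clamp T t * \<eta>)) * \<phi> \<eta>)" for t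
      proof
        fix \<eta>
        show "l t \<eta> = cis (- (time_clamp T t * \<eta>)) * \<phi> \<eta>"
          using df(4)[of \<eta>] N by (cases "datum A N \<eta> = 0") (auto simp: l_def \<phi>_def)
      qed
      \<comment> \<open>The phase inside the Duhamel integral cancels that of
        \<open>cubic (l \<tau>)\<close>, so the integrand is constant in time and contributes
        linearly in \<open>T\<close>.\<close>
      have "duhamel T (\<lambda>\<tau>. cubic (l \<tau>)) T \<xi> = T * (\<integral>\<theta>. indicator {0..1::real} \<theta> *\<^sub>R cubic \<phi> \<xi> \<partial>lborel)"
      proof -
        have "indicator {0..1} \<theta> *\<^sub>R (cis (T * \<theta> * \<bar>\<xi>\<bar>) * cubic (l (T * \<theta>)) \<xi>) = indicator {0..1} \<theta> *\<^sub>R cubic \<phi> \<xi>" for \<theta> :: real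
        proof (cases "\<theta> \<in> {0..1}")
          case True
          then have "T * \<theta> \<in> {0..T}"
            using T by (auto simp: mult_left_le)
          then have "cis (T * \<theta> * \<bar>\<xi>\<bar>) * cubic (l (T * \<theta>)) \<xi> = (cis (T * \<theta> * \<xi>) * cis (- (T * \<theta> * \<xi>))) * cubic \<phi> \<xi>"
            unfolding l_eq cubic_modulate using \<xi> by (simp add: time_clamp_id)
          then show ?thesis
            by (simp add: cis_mult)
        qed simp
        then have "(\<lambda>\<theta>. indicator {0..1} \<theta> *\<^sub>R (cis (T * \<theta> * \<bar>\<xi>\<bar>) * cubic (l (T * \<theta>)) \<xi>)) = (\<lambda>\<theta>::real. indicator {0..1} \<theta> *\<^sub>R cubic \<phi> \<xi>)"
          by (rule ext)
        moreover have "time_clamp T T = T"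
          using T by (simp add: time_clamp_id)
        ultimately show ?thesis
          by (simp only: duhamel_def)
      qed
      also have "\<dots> = complex_of_real (T * r)"
        by (simp add: r(1) scaleR_conv_of_real)
      finally have lin: "norm (duhamel T (\<lambda>\<tau>. cubic (l \<tau>)) T \<xi>) = T * r"
        using T r0 by (simp add: norm_mult)
      have "norm (duhamel T (\<lambda>\<tau>. cubic (g \<tau>)) T \<xi> - duhamel T (\<lambda>\<tau>. cubic (l \<tau>)) T \<xi>) \<le> T * (3 * K\<^sup>2 * (2 * A)\<^sup>2 * d * ?W \<xi>)"
        unfolding duhamel_diff[OF Gc Gbd Lc Lbd]
        using Gc Lc by (intro duhamel_bound[OF T'] cdiff) (auto simp: case_prod_unfold intro!: continuous_intros)
      also have "\<dots> \<le> T * (3 * K\<^sup>2 * (2 * A)\<^sup>2 * d * 1)"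
        using T A K Wf(4)[of \<xi>] by (intro mult_left_mono) (auto simp: d_def)
      finally have i1: "T * r - T * (3 * K\<^sup>2 * (2 * A)\<^sup>2 * d) \<le> norm (g T \<xi>)"
        unfolding gT lin[symmetric] using norm_triangle_ineq2[of "duhamel T (\<lambda>\<tau>. cubic (l \<tau>)) T \<xi>" "duhamel T (\<lambda>\<tau>. cubic (g \<tau>)) T \<xi>"]
        by (simp add: norm_minus_commute)
      have "\<delta> * c0 * A = T * (A ^ 3 * c0)"
        using A by (simp add: T_def power2_eq_square power3_eq_cube)
      also have "\<dots> \<le> T * r"
        using T r(2) by (intro mult_left_mono) auto
      finally have i2: "\<delta> * c0 * A \<le> T * r" .
      have "T * (3 * K\<^sup>2 * (2 * A)\<^sup>2 * d) = (96 * K ^ 4 * \<delta>) * (\<delta> * A)"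
        using A by (simp add: T_def d_def power2_eq_square power3_eq_cube power4_eq_xxxx)
      also have "\<dots> \<le> c0 / 2 * (\<delta> * A)"
        using \<delta> A by (intro mult_right_mono \<delta>2) auto
      finally have i3: "T * (3 * K\<^sup>2 * (2 * A)\<^sup>2 * d) \<le> c0 / 2 * (\<delta> * A)" .
      have "\<delta> * c0 / 2 * A = \<delta> * c0 * A - c0 / 2 * (\<delta> * A)"
        by (simp add: field_simps)
      also have "\<dots> \<le> T * r - T * (3 * K\<^sup>2 * (2 * A)\<^sup>2 * d)"
        by (rule diff_mono[OF i2 i3])
      also note i1
      finally show ?thesis .
    qed
    have "hw_solution \<mu> T (inv_fourier \<phi>) (\<lambda>t. inv_fourier (g t))"
      "has_fourier (inv_fourier (g T)) (g T)"
      "\<And>\<sigma>. integrable lborel (\<lambda>\<xi>. (1 + \<xi>\<^sup>2) powr \<sigma> * (cmod (g T \<xi>))\<^sup>2)"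
      using hw_solution_of_fixed_point[OF W T gc gbd fp] by auto
    then show "\<exists>g. hw_solution \<mu> (\<delta> / A\<^sup>2) (inv_fourier (\<lambda>\<xi>. complex_of_real (datum A N \<xi>))) (\<lambda>t. inv_fourier (g t)) \<and>
        has_fourier (inv_fourier (g (\<delta> / A\<^sup>2))) (g (\<delta> / A\<^sup>2)) \<and>
        (\<forall>\<sigma>. integrable lborel (\<lambda>\<xi>. (1 + \<xi>\<^sup>2) powr \<sigma> * (cmod (g (\<delta> / A\<^sup>2) \<xi>))\<^sup>2)) \<and>
        (\<forall>\<xi>\<in>{0..1/2}. \<delta> * c0 / 2 * A \<le> cmod (g (\<delta> / A\<^sup>2) \<xi>))"
      using low unfolding T_def \<phi>_def by blast
  qed
qed

text \<open>The datum is at most \<open>A\<close> on two intervals of length 2, where the Sobolev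
  weight is at most \<open>(N - 1) powr s\<close>. The crude bound
  \<open>1 + \<xi>^2 >= N - 1\<close> is enough, since only convergence is needed and no
  rate.\<close>

lemma sobolev_norm_datum_tendsto_0:
  assumes s: "s < 0" and A: "A > 0"
  shows "((\<lambda>N. sobolev_norm s (inv_fourier (\<lambda>\<xi>. complex_of_real (datum A N \<xi>)))) \<longlongrightarrow> 0) at_top"
proof -
  have bound: "0 \<le> sobolev_norm s (inv_fourier (\<lambda>\<xi>. complex_of_real (datum A N \<xi>)))"
    "sobolev_norm s (inv_fourier (\<lambda>\<xi>. complex_of_real (datum A N \<xi>))) \<le> (1 / sqrt (2 * pi)) * sqrt ((N - 1) powr s * (4 * A\<^sup>2))"
    if N: "N \<ge> 3" for N
  proof -
    note df = datum_facts[OF A N]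
    let ?d = "datum A N" and ?S = "{N - 1..N + 1} \<union> {2 * N - 1..2 * N + 1}"
    have [measurable]: "?d \<in> borel_measurable borel"
      by (intro borel_measurable_continuous_onI df(1))
    have W: "conv_weight (weight N) (48 * pi\<^sup>2)"
      using N by (intro conv_weight_weight) auto
    have di: "integrable lborel (\<lambda>\<xi>. complex_of_real (?d \<xi>))"
      by (rule integrable_dominated(1)[OF _ integrable_mult_right[OF conv_weightD(8)[OF W], of A]]) (use df(2,3) in auto)
    have dA: "?d \<xi> \<le> A" for \<xi>
    proof -
      have "A * weight N \<xi> \<le> A * 1"
        using A N by (intro mult_left_mono weight_le_1) auto
      then show ?thesis
        using df(3)[of \<xi>] by simp
    qed
    have bd: "norm ((1 + \<xi>\<^sup>2) powr s * (cmod (complex_of_real (?d \<xi>)))\<^sup>2) \<le> ((N - 1) powr s * A\<^sup>2) * (indicator {N - 1..N + 1} \<xi> + indicator {2 * N - 1..2 * N + 1} \<xi>)" for \<xi>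
    proof (cases "?d \<xi> = 0")
      case False
      then have \<xi>: "\<xi> \<in> ?S"
        by (rule df(4))
      then have "N - 1 \<le> \<xi>"
        using N by auto
      moreover have "2 * \<xi> \<le> 1 + \<xi>\<^sup>2"
        using sum_squares_bound[of 1 \<xi>] by simp
      ultimately have "(1 + \<xi>\<^sup>2) powr s \<le> (N - 1) powr s"
        using N s by (intro powr_mono2') auto
      moreover have "(cmod (complex_of_real (?d \<xi>)))\<^sup>2 \<le> A\<^sup>2"
        using dA[of \<xi>] df(2)[of \<xi>] by (intro power_mono) auto
      ultimately have "(1 + \<xi>\<^sup>2) powr s * (cmod (complex_of_real (?d \<xi>)))\<^sup>2 \<le> ((N - 1) powr s * A\<^sup>2) * 1"
        unfolding mult_1_right by (intro mult_mono) auto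
      also have "\<dots> \<le> ((N - 1) powr s * A\<^sup>2) * (indicator {N - 1..N + 1} \<xi> + indicator {2 * N - 1..2 * N + 1} \<xi>)"
        using \<xi> by (intro mult_left_mono) (auto simp: indicator_def)
      finally show ?thesis
        by (simp add: abs_mult)
    qed simp
    have "(\<integral>\<xi>. norm ((1 + \<xi>\<^sup>2) powr s * (cmod (complex_of_real (?d \<xi>)))\<^sup>2) \<partial>lborel)
      \<le> (\<integral>\<xi>. ((N - 1) powr s * A\<^sup>2) * (indicator {N - 1..N + 1} \<xi> + indicator {2 * N - 1..2 * N + 1} \<xi>) \<partial>lborel)"
    proof (rule integrable_dominated(2)[OF _ _ bd])
      show "integrable lborel (\<lambda>\<xi>. ((N - 1) powr s * A\<^sup>2) * (indicator {N - 1..N + 1} \<xi> + indicator {2 * N - 1..2 * N + 1} \<xi>))"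
        by (intro integrable_mult_right Bochner_Integration.integrable_add integrable_real_indicator) (auto simp: emeasure_lborel_Icc_eq)
    qed measurable
    also have "\<dots> = (N - 1) powr s * A\<^sup>2 * (2 + 2)"
      by (subst integral_mult_right_zero, subst Bochner_Integration.integral_add)
         (auto intro!: integrable_real_indicator simp: emeasure_lborel_Icc_eq)
    finally have le: "(\<integral>\<xi>. (1 + \<xi>\<^sup>2) powr s * (cmod (complex_of_real (?d \<xi>)))\<^sup>2 \<partial>lborel) \<le> (N - 1) powr s * (4 * A\<^sup>2)"
      by simp
    show "sobolev_norm s (inv_fourier (\<lambda>\<xi>. complex_of_real (datum A N \<xi>))) \<le> (1 / sqrt (2 * pi)) * sqrt ((N - 1) powr s * (4 * A\<^sup>2))"
      unfolding sobolev_norm_eq[OF has_fourier_inv_fourier[OF di]] by (intro mult_left_mono real_sqrt_le_mono le) auto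
    show "0 \<le> sobolev_norm s (inv_fourier (\<lambda>\<xi>. complex_of_real (datum A N \<xi>)))"
      unfolding sobolev_norm_def by (intro mult_nonneg_nonneg real_sqrt_ge_zero Bochner_Integration.integral_nonneg) auto
  qed
  have "filterlim (\<lambda>N::real. N - 1) at_top at_top"
    using filterlim_tendsto_add_at_top[OF tendsto_const[of "-1::real"] filterlim_ident] by simp
  then have "((\<lambda>N. (N - 1) powr s) \<longlongrightarrow> 0) at_top"
    by (rule tendsto_neg_powr[OF s])
  then have "((\<lambda>N. (1 / sqrt (2 * pi)) * sqrt ((N - 1) powr s * (4 * A\<^sup>2))) \<longlongrightarrow> (1 / sqrt (2 * pi)) * sqrt (0 * (4 * A\<^sup>2))) at_top"
    by (intro tendsto_intros)
  then have lim: "((\<lambda>N. (1 / sqrt (2 * pi)) * sqrt ((N - 1) powr s * (4 * A\<^sup>2))) \<longlongrightarrow> 0) at_top"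
    by simp
  show ?thesis
    by (rule tendsto_sandwich[OF _ _ tendsto_const lim])
       (use bound in \<open>auto intro: eventually_at_top_linorderI[of 3]\<close>)
qed

theorem theorem1p2:
  fixes s \<mu> :: real
  assumes "s < 0" and "\<mu> = -1 \<or> \<mu> = 1"
  shows "\<exists>\<epsilon>0>0. \<forall>\<epsilon>. 0 < \<epsilon> \<and> \<epsilon> < \<epsilon>0 \<longrightarrow>
           (\<exists>\<phi> T. H_infty \<phi> \<and> sobolev_norm s \<phi> < \<epsilon> \<and> 0 < T \<and> T < \<epsilon> \<and>
              (\<exists>u. hw_solution \<mu> T \<phi> u) \<and>
              (\<forall>u. hw_solution \<mu> T \<phi> u \<longrightarrow> sobolev_norm s (u T) > 1 / \<epsilon>))"
proof -
  obtain \<delta> c where \<delta>: "\<delta> > 0" and c: "c > 0"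
    and growth: "\<And>A N \<mu>. A > 0 \<Longrightarrow> N \<ge> 3 \<Longrightarrow> \<bar>\<mu>\<bar> = 1 \<Longrightarrow>
      \<exists>g. hw_solution \<mu> (\<delta> / A\<^sup>2) (inv_fourier (\<lambda>\<xi>. complex_of_real (datum A N \<xi>))) (\<lambda>t. inv_fourier (g t)) \<and>
        has_fourier (inv_fourier (g (\<delta> / A\<^sup>2))) (g (\<delta> / A\<^sup>2)) \<and>
        (\<forall>\<sigma>. integrable lborel (\<lambda>\<xi>. (1 + \<xi>\<^sup>2) powr \<sigma> * (cmod (g (\<delta> / A\<^sup>2) \<xi>))\<^sup>2)) \<and>
        (\<forall>\<xi>\<in>{0..1/2}. c * A \<le> cmod (g (\<delta> / A\<^sup>2) \<xi>))"
    by (rule low_frequency_growth) blast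
  \<comment> \<open>The Sobolev norm at time \<open>T\<close> per unit of \<open>A\<close>: on
    \<open>{0..1/2}\<close>, of length 1/2, the Sobolev weight is at least \<open>2 powr s\<close>
    because \<open>s\<close> is negative.\<close>
  define b where "b = (1 / sqrt (2 * pi)) * (sqrt (2 powr s / 2) * c)"
  have b: "b > 0"
    using c by (simp add: b_def)
  have "\<exists>\<phi> T. H_infty \<phi> \<and> sobolev_norm s \<phi> < \<epsilon> \<and> 0 < T \<and> T < \<epsilon> \<and>
              (\<exists>u. hw_solution \<mu> T \<phi> u) \<and>
              (\<forall>u. hw_solution \<mu> T \<phi> u \<longrightarrow> sobolev_norm s (u T) > 1 / \<epsilon>)" if \<epsilon>: "0 < \<epsilon>" for \<epsilon>
  proof -
    \<comment> \<open>The three summands secure in turn \<open>A >= 1\<close>,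
      \<open>T < \<epsilon>\<close> and \<open>b * A > 1 / \<epsilon>\<close>.\<close>
    define A where "A = 1 + \<delta> / \<epsilon> + 1 / (b * \<epsilon>)"
    have A1: "A \<ge> 1" and A2: "\<delta> / \<epsilon> < A" and A3: "1 / (b * \<epsilon>) < A"
      using \<delta> b \<epsilon> by (auto simp: A_def add_pos_nonneg add_nonneg_pos)
    have A: "A > 0"
      using A1 by simp
    define T where "T = \<delta> / A\<^sup>2"
    have T: "T > 0"
      using \<delta> A by (simp add: T_def)
    have "\<delta> < \<epsilon> * A"
      using A2 \<epsilon> by (simp add: divide_less_eq mult.commute)
    also have "\<dots> \<le> \<epsilon> * A\<^sup>2"
      using A1 \<epsilon> by (intro mult_left_mono self_le_power) auto
    finally have T\<epsilon>: "T < \<epsilon>"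
      using A by (simp add: T_def divide_less_eq)
    \<comment> \<open>Only now is \<open>N\<close> chosen: \<open>A\<close> and \<open>T\<close>
      stay fixed while the norm of the datum is made small.\<close>
    have "eventually (\<lambda>N. sobolev_norm s (inv_fourier (\<lambda>\<xi>. complex_of_real (datum A N \<xi>))) < \<epsilon>) at_top"
      by (rule order_tendstoD(2)[OF sobolev_norm_datum_tendsto_0[OF assms(1) A] \<epsilon>])
    then have "eventually (\<lambda>N. sobolev_norm s (inv_fourier (\<lambda>\<xi>. complex_of_real (datum A N \<xi>))) < \<epsilon> \<and> N \<ge> 3) at_top"
      using eventually_ge_at_top[of "3::real"] by eventually_elim simp
    then obtain N where N: "sobolev_norm s (inv_fourier (\<lambda>\<xi>. complex_of_real (datum A N \<xi>))) < \<epsilon>" "N \<ge> 3"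
      by (metis (mono_tags, lifting) eventually_at_top_linorder order_refl)
    define \<phi> where "\<phi> = inv_fourier (\<lambda>\<xi>. complex_of_real (datum A N \<xi>))"
    obtain g where sol: "hw_solution \<mu> T \<phi> (\<lambda>t. inv_fourier (g t))"
      and hf: "has_fourier (inv_fourier (g T)) (g T)"
      and int: "\<And>\<sigma>. integrable lborel (\<lambda>\<xi>. (1 + \<xi>\<^sup>2) powr \<sigma> * (cmod (g T \<xi>))\<^sup>2)"
      and low: "\<And>\<xi>. \<xi> \<in> {0..1/2} \<Longrightarrow> c * A \<le> cmod (g T \<xi>)"
      using growth[OF A N(2), of \<mu>] assms(2) unfolding T_def \<phi>_def by auto
    have "1 / \<epsilon> < sobolev_norm s (inv_fourier (g T))"
    proof -
      have "(1/2 - 0) * (2 powr s * (c * A)\<^sup>2) \<le> (\<integral>\<xi>. (1 + \<xi>\<^sup>2) powr s * (cmod (g T \<xi>))\<^sup>2 \<partial>lborel)"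
      proof (rule integral_ge_on_interval[OF int])
        fix \<xi> :: real
        assume \<xi>: "\<xi> \<in> {0..1/2}"
        have "\<xi>\<^sup>2 \<le> 1"
          using \<xi> by (intro power_le_one) auto
        then have "2 powr s \<le> (1 + \<xi>\<^sup>2) powr s"
          using assms(1) by (intro powr_mono2') (auto simp: add_pos_nonneg)
        then show "2 powr s * (c * A)\<^sup>2 \<le> (1 + \<xi>\<^sup>2) powr s * (cmod (g T \<xi>))\<^sup>2"
          using c A by (intro mult_mono power_mono low \<xi>) auto
      qed auto
      then have "(1 / sqrt (2 * pi)) * sqrt ((1/2 - 0) * (2 powr s * (c * A)\<^sup>2)) \<le> sobolev_norm s (inv_fourier (g T))"
        unfolding sobolev_norm_eq[OF hf] by (intro mult_left_mono real_sqrt_le_mono) auto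
      moreover have "(1/2 - 0) * (2 powr s * (c * A)\<^sup>2) = (2 powr s / 2) * (c * A)\<^sup>2"
        by simp
      moreover have "sqrt ((2 powr s / 2) * (c * A)\<^sup>2) = sqrt (2 powr s / 2) * (c * A)"
        using c A by (subst real_sqrt_mult) simp
      ultimately have "b * A \<le> sobolev_norm s (inv_fourier (g T))"
        by (simp add: b_def mult.assoc)
      moreover have "1 / \<epsilon> < b * A"
        using A3 b \<epsilon> by (simp add: divide_less_eq mult_ac)
      ultimately show ?thesis
        by simp
    qed
    \<comment> \<open>Uniqueness carries the growth of the constructed solution over to every
      solution.\<close>
    moreover have "u T = inv_fourier (g T)" if "hw_solution \<mu> T \<phi> u" for u
      using hw_solution_unique[OF that sol, of T] T by simp
    moreover have "H_infty \<phi>"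
      using sol T unfolding hw_solution_def by (metis atLeastAtMost_iff less_imp_le order_refl)
    ultimately show ?thesis
      using sol T T\<epsilon> N(1) unfolding \<phi>_def[symmetric] by (intro exI[of _ \<phi>] exI[of _ T]) auto
  qed
  then show ?thesis
    \<comment> \<open>The argument covers every positive \<epsilon>, so the threshold is an
      arbitrary choice.\<close>
    by (intro exI[of _ 1]) auto
qed

end
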